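(* Let $(\Omega,\mathcal F,P)$ be a probability space, let $S$ be a $\mathcal T_{\varepsilon,\lambda}$-complete random normed module over $K$ ($K=\mathbb R$ or $\mathbb C$) with base $(\Omega,\mathcal F,P)$, and let $C\in B(S)$ be injective. Let $(A,D(A))$ be a module homomorphism on $S$ and let $W:[0,\infty)\to B(S)$ be a strongly continuous family such that, for some $M\in L^0_+(\mathcal F)$ and $\xi\in L^0(\mathcal F,\mathbb R)$, $\|W(s)\|\le Me^{\xi s}$ for all $s\ge0$. Then the following statements are equivalent: (a) $\{W(s):s\ge0\}$ is a $C$-semigroup on $S$ with infinitesimal generator $(A,D(A))$. (b) Both of the following hold: ($b_1$) $A=C^{-1}AC$; ($b_2$) if $\eta\in G_\xi$, then $\eta\in\rho_C(A)$ and $R_C(\eta,A)x=\int_0^\infty e^{-\eta s}W(s)x\,ds$ for every $x\in S$.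
   Context: $L^0(\mathcal F,K)$ is the algebra of ($P$-a.s.) equivalence classes of $K$-valued $\mathcal F$-measurable random variables on $\Omega$. For $f,g\in L^0(\mathcal F,\mathbb R)$, $f\le g$ means a.s. inequality and "$f>g$ on $\Omega$" means $f(\omega)>g(\omega)$ for almost all $\omega$. $L^0_+(\mathcal F)=\{\xi\in L^0(\mathcal F,\mathbb R):\xi\ge 0\}$ and $G_\xi=\{\eta\in L^0(\mathcal F,\mathbb R):\eta>\xi\text{ on }\Omega\}$. A random normed module over $K$ with base $(\Omega,\mathcal F,P)$ is a left $L^0(\mathcal F,K)$-module $S$ with a map $\|\cdot\|:S\to L^0_+(\mathcal F)$ (the $L^0$-norm) such that $\|x\|=0\Rightarrow x=\theta$ (the zero of $S$), $\|\zeta x\|=|\zeta|\,\|x\|$ and $\|x+y\|\le\|x\|+\|y\|$ for $\zeta\in L^0(\mathcal F,K)$, $x,y\in S$. The $(\varepsilon,\lambda)$-topology $\mathcal T_{\varepsilon,\lambda}$ on $S$ is the metrizable linear topology with local base at $\theta$ the sets $\{z: P(\|z\|<\varepsilon)>1-\lambda\}$, $\varepsilon>0$, $0<\lambda<1$; thus $z_n\to z$ iff $\|z_n-z\|\to0$ in probability. All limits and continuity below are with respect to $\mathcal T_{\varepsilon,\lambda}$. $B(S)$ is the set of almost surely bounded linear operators $T:S\to S$, i.e. those for which there is $\eta\in L^0_+(\mathcal F)$ with $\|Tz\|\le\eta\|z\|$ for all $z\in S$ (equivalently, continuous $L^0(\mathcal F,K)$-module homomorphisms); $\|T\|$ is the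 infimum (in the a.s. order) of all such $\eta$. A module homomorphism $(A,D(A))$ on $S$ is an $L^0(\mathcal F,K)$-linear map $A:D(A)\to S$ defined on a submodule $D(A)\subseteq S$. $R(T)$ denotes the range of $T$. Integrals over compact intervals are Riemann integrals ($\mathcal T_{\varepsilon,\lambda}$-limits of Riemann sums), and $\int_0^\infty$ is the $\mathcal T_{\varepsilon,\lambda}$-limit of $\int_0^L$ as $L\to\infty$. $W$ is strongly continuous if $s\mapsto W(s)x$ is continuous from $[0,\infty)$ to $(S,\mathcal T_{\varepsilon,\lambda})$ for each $x\in S$. A $C$-semigroup on $S$ ($C\in B(S)$ injective) is a strongly continuous family $\{W(t):t\ge0\}\subset B(S)$ with $W(0)=C$ and $CW(s+t)=W(t)W(s)$ for all $s,t\ge0$. Its infinitesimal generator $(A,D(A))$ is given by $D(A)=\{x\in S:\lim_{s\to0}\frac{W(s)x-Cx}{s}\text{ exists and belongs to }R(C)\}$ and $Ax=C^{-1}\lim_{s\to0}\frac{W(s)x-Cx}{s}$. For a module homomorphism $(A,D(A))$, $C^{-1}AC$ has domain $\{x\in S: Cx\in D(A),\ ACx\in R(C)\}$, and equality of operators includes equality of domains. $\rho_C(A)=\{\eta\in L^0(\mathcal F,K):\eta-A:D(A)\to S\text{ is injective and }R(C)\subseteq R(\eta-A)\}$, and for $\eta\in\rho_C(A)$, $R_C(\eta,A)=(\eta-A)^{-1}C$. *)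

theory Defs
  imports "HOL-Probability.Probability"
begin

text \<open>
  Conventions. An element of \<open>L\<^sup>0(F, K)\<close> is given by a representative, i.e. by a function in
  \<open>borel_measurable M\<close>; all relations between elements of \<open>L\<^sup>0\<close> are almost-sure ones, and
  every operation below is insensitive to the choice of representatives. The scalar field is a
  type of sort \<open>{real_normed_field, euclidean_space}\<close>: the instances of this sort are, up to
  isometric isomorphism, exactly the real and the complex numbers (the norm is multiplicative and
  the dimension finite).
\<close>

definition L0_pos :: "'w measure \<Rightarrow> ('w \<Rightarrow> real) set" where
  "L0_pos M = {\<xi> \<in> borel_measurable M. AE w in M. 0 \<le> \<xi> w}"

definition L0_above :: "'w measure \<Rightarrow> ('w \<Rightarrow> real) \<Rightarrow> ('w \<Rightarrow> real) set" where
  "L0_above M \<xi> = {\<eta> \<in> borel_measurable M. AE w in M. \<xi> w < \<eta> w}"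

text \<open>The assumption \<open>smul_cong\<close> makes \<open>smul\<close> an action of the almost-sure equivalence classes.\<close>

locale random_normed_module = prob_space M
  for M :: "'w measure" +
  fixes smul :: "('w \<Rightarrow> 'k::{real_normed_field,euclidean_space}) \<Rightarrow> 's::ab_group_add \<Rightarrow> 's"
    and nrm :: "'s \<Rightarrow> 'w \<Rightarrow> real"
  assumes smul_cong: "\<lbrakk>f \<in> borel_measurable M; g \<in> borel_measurable M; AE w in M. f w = g w\<rbrakk>
      \<Longrightarrow> smul f x = smul g x"
    and smul_add_right: "f \<in> borel_measurable M \<Longrightarrow> smul f (x + y) = smul f x + smul f y"
    and smul_add_left: "\<lbrakk>f \<in> borel_measurable M; g \<in> borel_measurable M\<rbrakk>
      \<Longrightarrow> smul (\<lambda>w. f w + g w) x = smul f x + smul g x"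
    and smul_smul: "\<lbrakk>f \<in> borel_measurable M; g \<in> borel_measurable M\<rbrakk>
      \<Longrightarrow> smul (\<lambda>w. f w * g w) x = smul f (smul g x)"
    and smul_one: "smul (\<lambda>w. 1) x = x"
    and nrm_L0_pos: "nrm x \<in> L0_pos M"
    and nrm_zeroD: "(AE w in M. nrm x w = 0) \<Longrightarrow> x = 0"
    and nrm_smul: "f \<in> borel_measurable M \<Longrightarrow> AE w in M. nrm (smul f x) w = norm (f w) * nrm x w"
    and nrm_triangle: "AE w in M. nrm (x + y) w \<le> nrm x w + nrm y w"


subsection \<open>The \<open>(\<epsilon>, \<lambda>)\<close>-topology\<close>

definition el_nbhd :: "'w measure \<Rightarrow> ('s \<Rightarrow> 'w \<Rightarrow> real) \<Rightarrow> real \<Rightarrow> real \<Rightarrow> 's set" where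
  "el_nbhd M nrm \<epsilon> \<mu> = {z. measure M {w \<in> space M. nrm z w < \<epsilon>} > 1 - \<mu>}"

definition el_topology :: "'w measure \<Rightarrow> ('s::ab_group_add \<Rightarrow> 'w \<Rightarrow> real) \<Rightarrow> 's topology" where
  "el_topology M nrm =
     topology (\<lambda>U. \<forall>x\<in>U. \<exists>\<epsilon>>0. \<exists>\<mu>\<in>{0<..<1}. \<forall>z. z - x \<in> el_nbhd M nrm \<epsilon> \<mu> \<longrightarrow> z \<in> U)"

text \<open>As the topology is metrizable, completeness is expressed by Cauchy sequences.\<close>

definition el_complete :: "'w measure \<Rightarrow> ('s::ab_group_add \<Rightarrow> 'w \<Rightarrow> real) \<Rightarrow> bool" where
  "el_complete M nrm \<longleftrightarrow>
     (\<forall>x :: nat \<Rightarrow> 's.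
        (\<forall>\<epsilon>>0. \<forall>\<mu>\<in>{0<..<1}. \<exists>N. \<forall>m\<ge>N. \<forall>n\<ge>N. x m - x n \<in> el_nbhd M nrm \<epsilon> \<mu>)
        \<longrightarrow> (\<exists>l. limitin (el_topology M nrm) x l sequentially))"

context random_normed_module
begin

lemma nrm_measurable [measurable]: "nrm x \<in> borel_measurable M"
  using nrm_L0_pos by (auto simp: L0_pos_def)

lemma nrm_nonneg: "AE w in M. 0 \<le> nrm x w"
  using nrm_L0_pos by (auto simp: L0_pos_def)

lemma smul_zero: "smul (\<lambda>w. 0) x = 0"
  using smul_add_left[of "\<lambda>w. 0" "\<lambda>w. 0" x] by simp

lemma nrm_zero: "AE w in M. nrm 0 w = 0"
  using nrm_smul[of "\<lambda>w. 0" 0] by (simp add: smul_zero)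

lemma el_nbhd_mono:
  assumes "\<epsilon> \<le> \<epsilon>'" "\<mu> \<le> \<mu>'"
  shows "el_nbhd M nrm \<epsilon> \<mu> \<subseteq> el_nbhd M nrm \<epsilon>' \<mu>'"
proof
  fix z assume "z \<in> el_nbhd M nrm \<epsilon> \<mu>"
  moreover have "measure M {w \<in> space M. nrm z w < \<epsilon>} \<le> measure M {w \<in> space M. nrm z w < \<epsilon>'}"
    using assms(1) by (intro finite_measure_mono) auto
  ultimately show "z \<in> el_nbhd M nrm \<epsilon>' \<mu>'"
    using assms(2) by (auto simp: el_nbhd_def)
qed

lemma el_nbhd_zero:
  assumes "\<epsilon> > 0" "\<mu> > 0"
  shows "0 \<in> el_nbhd M nrm \<epsilon> \<mu>"
proof -
  have "measure M {w \<in> space M. nrm 0 w < \<epsilon>} = 1"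
    using nrm_zero assms(1) by (subst prob_eq_1) auto
  then show ?thesis using assms(2) by (simp add: el_nbhd_def)
qed

lemma el_nbhd_add:
  assumes "x \<in> el_nbhd M nrm \<epsilon> \<mu>" "y \<in> el_nbhd M nrm \<epsilon>' \<mu>'"
  shows "x + y \<in> el_nbhd M nrm (\<epsilon> + \<epsilon>') (\<mu> + \<mu>')"
proof -
  let ?A = "{w \<in> space M. nrm x w < \<epsilon>}" and ?B = "{w \<in> space M. nrm y w < \<epsilon>'}"
  let ?C = "{w \<in> space M. nrm (x + y) w < \<epsilon> + \<epsilon>'}"
  have "measure M (?A \<inter> ?B) \<le> measure M ?C"
    using nrm_triangle[of x y] by (intro finite_measure_mono_AE) auto
  moreover have "measure M (?A \<union> ?B) = measure M ?A + measure M ?B - measure M (?A \<inter> ?B)"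
    by (rule measure_Un3) (auto simp: fmeasurable_eq_sets)
  moreover have "measure M (?A \<union> ?B) \<le> 1" by simp
  ultimately show ?thesis using assms by (auto simp: el_nbhd_def)
qed

lemma istopology_el:
  "istopology (\<lambda>U. \<forall>x\<in>U. \<exists>\<epsilon>>0. \<exists>\<mu>\<in>{0<..<1}. \<forall>z. z - x \<in> el_nbhd M nrm \<epsilon> \<mu> \<longrightarrow> z \<in> U)"
    (is "istopology ?P")
  unfolding istopology_def
proof (intro conjI allI impI)
  fix U V assume U: "?P U" and V: "?P V"
  show "?P (U \<inter> V)"
  proof
    fix x assume x: "x \<in> U \<inter> V"
    obtain e l where 1: "e > 0" "l \<in> {0<..<1}" "\<And>z. z - x \<in> el_nbhd M nrm e l \<Longrightarrow> z \<in> U"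
      using U x by blast
    obtain e' l' where 2: "e' > 0" "l' \<in> {0<..<1}" "\<And>z. z - x \<in> el_nbhd M nrm e' l' \<Longrightarrow> z \<in> V"
      using V x by blast
    have "\<forall>z. z - x \<in> el_nbhd M nrm (min e e') (min l l') \<longrightarrow> z \<in> U \<inter> V"
      using 1(3) 2(3) el_nbhd_mono[of "min e e'" e "min l l'" l]
        el_nbhd_mono[of "min e e'" e' "min l l'" l'] by auto
    moreover have "min e e' > 0" "min l l' \<in> {0<..<1}" using 1 2 by auto
    ultimately show "\<exists>\<epsilon>>0. \<exists>\<mu>\<in>{0<..<1}. \<forall>z. z - x \<in> el_nbhd M nrm \<epsilon> \<mu> \<longrightarrow> z \<in> U \<inter> V"
      by blast
  qed
next
  fix \<K> assume "\<forall>K\<in>\<K>. ?P K"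
  then show "?P (\<Union>\<K>)" by (meson UnionE UnionI)
qed

lemma openin_el:
  "openin (el_topology M nrm) U \<longleftrightarrow>
     (\<forall>x\<in>U. \<exists>\<epsilon>>0. \<exists>\<mu>\<in>{0<..<1}. \<forall>z. z - x \<in> el_nbhd M nrm \<epsilon> \<mu> \<longrightarrow> z \<in> U)"
  unfolding el_topology_def by (simp add: topology_inverse'[OF istopology_el])

lemma topspace_el: "topspace (el_topology M nrm) = UNIV"
proof -
  have "openin (el_topology M nrm) UNIV"
    unfolding openin_el by (intro ballI exI[of _ 1] conjI bexI[of _ "1/2"]) auto
  then show ?thesis using openin_subset by blast
qed

lemma limitin_el:
  "limitin (el_topology M nrm) f l F \<longleftrightarrow>
     (\<forall>\<epsilon>>0. \<forall>\<mu>\<in>{0<..<1}. \<forall>\<^sub>F n in F. f n - l \<in> el_nbhd M nrm \<epsilon> \<mu>)"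
proof
  assume R: "\<forall>\<epsilon>>0. \<forall>\<mu>\<in>{0<..<1}. \<forall>\<^sub>F n in F. f n - l \<in> el_nbhd M nrm \<epsilon> \<mu>"
  show "limitin (el_topology M nrm) f l F"
    unfolding limitin_def topspace_el
  proof (intro conjI allI impI UNIV_I, elim conjE)
    fix U assume "openin (el_topology M nrm) U" "l \<in> U"
    then obtain e m where "e > 0" "m \<in> {0<..<1}"
      and *: "\<And>z. z - l \<in> el_nbhd M nrm e m \<Longrightarrow> z \<in> U"
      unfolding openin_el by blast
    then have "\<forall>\<^sub>F n in F. f n - l \<in> el_nbhd M nrm e m" using R by blast
    then show "\<forall>\<^sub>F n in F. f n \<in> U" by eventually_elim (rule *)
  qed
next
  assume L: "limitin (el_topology M nrm) f l F"
  show "\<forall>\<epsilon>>0. \<forall>\<mu>\<in>{0<..<1}. \<forall>\<^sub>F n in F. f n - l \<in> el_nbhd M nrm \<epsilon> \<mu>"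
  proof (intro allI impI ballI)
    fix e m :: real assume e: "e > 0" and m: "m \<in> {0<..<1}"
    define U where "U = {x. \<exists>d>0. \<exists>k\<in>{0<..<1}. \<forall>z. z - x \<in> el_nbhd M nrm d k
                          \<longrightarrow> z - l \<in> el_nbhd M nrm e m}"
    have "openin (el_topology M nrm) U"
      unfolding openin_el
    proof
      fix x assume "x \<in> U"
      then obtain d k where d: "d > 0" "k \<in> {0<..<1}"
        and *: "\<And>z. z - x \<in> el_nbhd M nrm d k \<Longrightarrow> z - l \<in> el_nbhd M nrm e m"
        unfolding U_def by blast
      have "y \<in> U" if y: "y - x \<in> el_nbhd M nrm (d/2) (k/2)" for y
      proof -
        have "z - l \<in> el_nbhd M nrm e m" if "z - y \<in> el_nbhd M nrm (d/2) (k/2)" for z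
          using *[of z] el_nbhd_add[OF that y] by simp
        moreover have "d/2 > 0" "k/2 \<in> {0<..<1}" using d by auto
        ultimately show ?thesis unfolding U_def by blast
      qed
      moreover have "d/2 > 0" "k/2 \<in> {0<..<1}" using d by auto
      ultimately show "\<exists>\<epsilon>>0. \<exists>\<mu>\<in>{0<..<1}. \<forall>z. z - x \<in> el_nbhd M nrm \<epsilon> \<mu> \<longrightarrow> z \<in> U"
        by blast
    qed
    moreover have "l \<in> U" using e m unfolding U_def by blast
    ultimately have "\<forall>\<^sub>F n in F. f n \<in> U" using L unfolding limitin_def by blast
    then show "\<forall>\<^sub>F n in F. f n - l \<in> el_nbhd M nrm e m"
    proof eventually_elim
      case (elim n)
      then obtain d k where "d > 0" "k \<in> {0<..<1}"
        "\<And>z. z - f n \<in> el_nbhd M nrm d k \<Longrightarrow> z - l \<in> el_nbhd M nrm e m"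
        unfolding U_def by blast
      then show ?case using el_nbhd_zero[of d k] by auto
    qed
  qed
qed

end


subsection \<open>Riemann integrals\<close>

definition riemann_filter :: "real \<Rightarrow> real \<Rightarrow> (real \<times> real set) set filter" where
  "riemann_filter a b =
     (INF \<delta>\<in>{0<..}. principal {p. p tagged_division_of {a..b} \<and> (\<forall>(t, J)\<in>p. measure lborel J < \<delta>)})"

definition has_riemann_integral ::
  "'w measure \<Rightarrow> (('w \<Rightarrow> 'k::real_normed_field) \<Rightarrow> 's::ab_group_add \<Rightarrow> 's) \<Rightarrow> ('s \<Rightarrow> 'w \<Rightarrow> real)
    \<Rightarrow> (real \<Rightarrow> 's) \<Rightarrow> 's \<Rightarrow> real \<Rightarrow> real \<Rightarrow> bool" where
  "has_riemann_integral M smul nrm f y a b \<longleftrightarrow>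
     limitin (el_topology M nrm)
       (\<lambda>p. \<Sum>(t, J)\<in>p. smul (\<lambda>w. of_real (measure lborel J)) (f t)) y (riemann_filter a b)"

definition has_improper_integral ::
  "'w measure \<Rightarrow> (('w \<Rightarrow> 'k::real_normed_field) \<Rightarrow> 's::ab_group_add \<Rightarrow> 's) \<Rightarrow> ('s \<Rightarrow> 'w \<Rightarrow> real)
    \<Rightarrow> (real \<Rightarrow> 's) \<Rightarrow> 's \<Rightarrow> bool" where
  "has_improper_integral M smul nrm f y \<longleftrightarrow>
     (\<exists>I. (\<forall>L\<ge>0. has_riemann_integral M smul nrm f (I L) 0 L) \<and>
          limitin (el_topology M nrm) I y at_top)"


subsection \<open>Almost surely bounded operators\<close>

definition as_bounds :: "'w measure \<Rightarrow> ('s \<Rightarrow> 'w \<Rightarrow> real) \<Rightarrow> ('s \<Rightarrow> 's) \<Rightarrow> ('w \<Rightarrow> real) set" where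
  "as_bounds M nrm T = {\<eta> \<in> L0_pos M. \<forall>z. AE w in M. nrm (T z) w \<le> \<eta> w * nrm z w}"

text \<open>
  Linearity means linearity over \<open>K\<close>, embedded into \<open>L\<^sup>0\<close> as the constant functions;
  \<open>L\<^sup>0\<close>-linearity is then a consequence of almost sure boundedness.
\<close>

definition bounded_ops ::
  "'w measure \<Rightarrow> (('w \<Rightarrow> 'k) \<Rightarrow> 's::ab_group_add \<Rightarrow> 's) \<Rightarrow> ('s \<Rightarrow> 'w \<Rightarrow> real) \<Rightarrow> ('s \<Rightarrow> 's) set" where
  "bounded_ops M smul nrm =
     {T. (\<forall>x y. T (x + y) = T x + T y) \<and> (\<forall>c x. T (smul (\<lambda>w. c) x) = smul (\<lambda>w. c) (T x)) \<and>
         as_bounds M nrm T \<noteq> {}}"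

text \<open>The infimum in the almost sure order (unique up to a null set).\<close>

definition is_as_Inf :: "'w measure \<Rightarrow> ('w \<Rightarrow> real) set \<Rightarrow> ('w \<Rightarrow> real) \<Rightarrow> bool" where
  "is_as_Inf M H \<zeta> \<longleftrightarrow>
     \<zeta> \<in> borel_measurable M \<and> (\<forall>\<eta>\<in>H. AE w in M. \<zeta> w \<le> \<eta> w) \<and>
     (\<forall>\<gamma>\<in>borel_measurable M. (\<forall>\<eta>\<in>H. AE w in M. \<gamma> w \<le> \<eta> w) \<longrightarrow> (AE w in M. \<gamma> w \<le> \<zeta> w))"

definition op_norm :: "'w measure \<Rightarrow> ('s \<Rightarrow> 'w \<Rightarrow> real) \<Rightarrow> ('s \<Rightarrow> 's) \<Rightarrow> 'w \<Rightarrow> real" where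
  "op_norm M nrm T = (SOME \<zeta>. is_as_Inf M (as_bounds M nrm T) \<zeta>)"


subsection \<open>Module homomorphisms with a domain\<close>

text \<open>
  An operator \<open>(A, D(A))\<close> is a partial function \<open>A\<close> with \<open>D(A) = dom A\<close>, so that equality of
  operators is equality of partial functions.
\<close>

definition module_hom_on ::
  "'w measure \<Rightarrow> (('w \<Rightarrow> 'k::topological_space) \<Rightarrow> 's::ab_group_add \<Rightarrow> 's) \<Rightarrow> ('s \<rightharpoonup> 's) \<Rightarrow> bool" where
  "module_hom_on M smul A \<longleftrightarrow>
     0 \<in> dom A \<and>
     (\<forall>x\<in>dom A. \<forall>y\<in>dom A. x + y \<in> dom A \<and> the (A (x + y)) = the (A x) + the (A y)) \<and>
     (\<forall>f\<in>borel_measurable M. \<forall>x\<in>dom A. smul f x \<in> dom A \<and> the (A (smul f x)) = smul f (the (A x)))"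

text \<open>The operator \<open>C\<^sup>-\<^sup>1AC\<close> with its maximal domain, for injective \<open>C\<close>.\<close>

definition conj_op :: "('s \<Rightarrow> 's) \<Rightarrow> ('s \<rightharpoonup> 's) \<Rightarrow> ('s \<rightharpoonup> 's)" where
  "conj_op C A =
     (\<lambda>x. if C x \<in> dom A \<and> the (A (C x)) \<in> range C then Some (inv C (the (A (C x)))) else None)"

definition shifted_op ::
  "(('w \<Rightarrow> 'k) \<Rightarrow> 's::ab_group_add \<Rightarrow> 's) \<Rightarrow> ('w \<Rightarrow> 'k) \<Rightarrow> ('s \<rightharpoonup> 's) \<Rightarrow> 's \<Rightarrow> 's" where
  "shifted_op smul \<eta> A x = smul \<eta> x - the (A x)"

definition C_resolvent_set ::
  "'w measure \<Rightarrow> (('w \<Rightarrow> 'k::topological_space) \<Rightarrow> 's::ab_group_add \<Rightarrow> 's) \<Rightarrow> ('s \<Rightarrow> 's) \<Rightarrow> ('s \<rightharpoonup> 's)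
    \<Rightarrow> ('w \<Rightarrow> 'k) set" where
  "C_resolvent_set M smul C A =
     {\<eta> \<in> borel_measurable M. inj_on (shifted_op smul \<eta> A) (dom A) \<and>
        range C \<subseteq> shifted_op smul \<eta> A ` dom A}"

definition C_resolvent ::
  "(('w \<Rightarrow> 'k) \<Rightarrow> 's::ab_group_add \<Rightarrow> 's) \<Rightarrow> ('s \<Rightarrow> 's) \<Rightarrow> ('w \<Rightarrow> 'k) \<Rightarrow> ('s \<rightharpoonup> 's) \<Rightarrow> 's \<Rightarrow> 's" where
  "C_resolvent smul C \<eta> A x = inv_into (dom A) (shifted_op smul \<eta> A) (C x)"


subsection \<open>\<open>C\<close>-semigroups\<close>

text \<open>A family indexed by \<open>[0, \<infinity>)\<close> is a function on the reals, only used at nonnegative times.\<close>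

definition strongly_continuous ::
  "'w measure \<Rightarrow> ('s::ab_group_add \<Rightarrow> 'w \<Rightarrow> real) \<Rightarrow> (real \<Rightarrow> 's \<Rightarrow> 's) \<Rightarrow> bool" where
  "strongly_continuous M nrm W \<longleftrightarrow>
     (\<forall>x. continuous_map (top_of_set {0..}) (el_topology M nrm) (\<lambda>s. W s x))"

definition C_semigroup ::
  "'w measure \<Rightarrow> (('w \<Rightarrow> 'k) \<Rightarrow> 's::ab_group_add \<Rightarrow> 's) \<Rightarrow> ('s \<Rightarrow> 'w \<Rightarrow> real) \<Rightarrow> ('s \<Rightarrow> 's)
    \<Rightarrow> (real \<Rightarrow> 's \<Rightarrow> 's) \<Rightarrow> bool" where
  "C_semigroup M smul nrm C W \<longleftrightarrow>
     C \<in> bounded_ops M smul nrm \<and> inj C \<and>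
     (\<forall>t\<ge>0. W t \<in> bounded_ops M smul nrm) \<and> strongly_continuous M nrm W \<and>
     W 0 = C \<and> (\<forall>s\<ge>0. \<forall>t\<ge>0. C \<circ> W (s + t) = W t \<circ> W s)"

definition diff_quot ::
  "(('w \<Rightarrow> 'k::real_normed_field) \<Rightarrow> 's::ab_group_add \<Rightarrow> 's) \<Rightarrow> ('s \<Rightarrow> 's) \<Rightarrow> (real \<Rightarrow> 's \<Rightarrow> 's)
    \<Rightarrow> 's \<Rightarrow> real \<Rightarrow> 's" where
  "diff_quot smul C W x s = smul (\<lambda>w. of_real (1 / s)) (W s x - C x)"

definition generator ::
  "'w measure \<Rightarrow> (('w \<Rightarrow> 'k::real_normed_field) \<Rightarrow> 's::ab_group_add \<Rightarrow> 's) \<Rightarrow> ('s \<Rightarrow> 'w \<Rightarrow> real)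
    \<Rightarrow> ('s \<Rightarrow> 's) \<Rightarrow> (real \<Rightarrow> 's \<Rightarrow> 's) \<Rightarrow> ('s \<rightharpoonup> 's)" where
  "generator M smul nrm C W =
     (\<lambda>x. if \<exists>l\<in>range C. limitin (el_topology M nrm) (diff_quot smul C W x) l (at_right 0)
          then Some (inv C (THE l. limitin (el_topology M nrm) (diff_quot smul C W x) l (at_right 0)))
          else None)"

end

theory Submission
  imports Defs
begin

text \<open>
  The Laplace transform \<open>R \<eta> x = \<integral>\<^sub>0\<^sup>\<infinity> e\<^sup>-\<^sup>\<eta>\<^sup>s W(s) x ds\<close> is only needed along \<open>\<eta> = \<mu> + n\<close> with \<open>\<mu>\<close> random
  and \<open>n\<close> a natural number: it is then a classical transform of the path \<open>e\<^sup>-\<^sup>\<mu>\<^sup>s W(s) x\<close>. After weighting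
  with a random variable, such a path lies in a Banach space of \<open>L\<^sup>1\<close> type, where integration theory
  and the uniqueness theorem for the Laplace transform are available.

  The key consequence: if \<open>R \<eta> (\<eta> x - z) = C x\<close> for all admissible \<open>\<eta>\<close>, then
  \<open>e\<^sup>-\<^sup>\<mu>\<^sup>t W(t) x = C x + \<integral>\<^sub>0\<^sup>t e\<^sup>-\<^sup>\<mu>\<^sup>s W(s) (z - \<mu> x) ds\<close>, because both sides have the same transform; hence the
  difference quotient of \<open>W\<close> at \<open>x\<close> tends to \<open>W(0) z\<close>. Both directions apply this to
  \<open>z = A x\<close>. From (a) to (b) the hypothesis holds since \<open>R \<eta>\<close> commutes with the semigroup; from (b) to
  (a) it is the resolvent identity, and the semigroup law again follows by uniqueness of transforms.
\<close>

section \<open>Banach spaces carried by sets\<close>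

text \<open>The obstacle is integration: the (\<epsilon>, \<lambda>)-topology is in general not
  locally convex, and there a continuous path on a compact interval need not have a Riemann
  integral. Integrals exist here because the paths are dominated by one random variable
  \<open>b\<close> at all times; the weight 1 / (1 + |b|) then makes convergence in probability
  along the path a convergence in norm. The improper integral needs domination integrable in time.
  The gap \<eta> - \<xi> is positive but may come arbitrarily close to 0, so there is no
  deterministic exponential rate. The function 1 / (1 + s^2) serves as a common rate, the random gap
  being moved into \<open>b\<close>; its primitive, the arctangent, supplies all bounds for tails.
  The weight depends on the path, which is why Banach spaces occur as subsets of the module and not
  as one fixed type. A shift of the parameter by \<open>n\<close> multiplies the path by the number
  exp (- n s) and so stays in the same space, whereas another random parameter could require another
  weight; this is the reason for uniqueness from integer values alone.\<close>

definition banach_on :: "'s::ab_group_add set \<Rightarrow> (real \<Rightarrow> 's \<Rightarrow> 's) \<Rightarrow> ('s \<Rightarrow> real) \<Rightarrow> bool" where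
  "banach_on D sc N \<longleftrightarrow>
     0 \<in> D \<and> (\<forall>x\<in>D. \<forall>y\<in>D. x + y \<in> D) \<and> (\<forall>r. \<forall>x\<in>D. sc r x \<in> D) \<and>
     (\<forall>r. \<forall>x\<in>D. \<forall>y\<in>D. sc r (x + y) = sc r x + sc r y) \<and>
     (\<forall>r s. \<forall>x\<in>D. sc (r + s) x = sc r x + sc s x) \<and>
     (\<forall>r s. \<forall>x\<in>D. sc r (sc s x) = sc (r * s) x) \<and> (\<forall>x\<in>D. sc 1 x = x) \<and>
     (\<forall>x\<in>D. N x = 0 \<longrightarrow> x = 0) \<and> (\<forall>x\<in>D. \<forall>y\<in>D. N (x + y) \<le> N x + N y) \<and>
     (\<forall>r. \<forall>x\<in>D. N (sc r x) = \<bar>r\<bar> * N x) \<and>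
     (\<forall>X. (\<forall>n. X n \<in> D) \<longrightarrow> (\<forall>e>0. \<exists>n0. \<forall>m\<ge>n0. \<forall>n\<ge>n0. N (X m - X n) < e) \<longrightarrow>
        (\<exists>l\<in>D. (\<lambda>n. N (X n - l)) \<longlonglongrightarrow> 0))"

lemma
  assumes "banach_on D sc N"
  shows banach_on_zero: "0 \<in> D"
    and banach_on_add: "x \<in> D \<Longrightarrow> y \<in> D \<Longrightarrow> x + y \<in> D"
    and banach_on_scale: "x \<in> D \<Longrightarrow> sc r x \<in> D"
    and banach_on_scale_add_right: "x \<in> D \<Longrightarrow> y \<in> D \<Longrightarrow> sc r (x + y) = sc r x + sc r y"
    and banach_on_scale_add_left: "x \<in> D \<Longrightarrow> sc (r + s) x = sc r x + sc s x"
    and banach_on_scale_scale: "x \<in> D \<Longrightarrow> sc r (sc s x) = sc (r * s) x"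
    and banach_on_scale_one: "x \<in> D \<Longrightarrow> sc 1 x = x"
    and banach_on_norm_zeroD: "x \<in> D \<Longrightarrow> N x = 0 \<Longrightarrow> x = 0"
    and banach_on_norm_triangle: "x \<in> D \<Longrightarrow> y \<in> D \<Longrightarrow> N (x + y) \<le> N x + N y"
    and banach_on_norm_scale: "x \<in> D \<Longrightarrow> N (sc r x) = \<bar>r\<bar> * N x"
    and banach_on_complete: "(\<And>n. X n \<in> D) \<Longrightarrow>
      (\<And>e. e > 0 \<Longrightarrow> \<exists>n0. \<forall>m\<ge>n0. \<forall>n\<ge>n0. N (X m - X n) < e) \<Longrightarrow>
      \<exists>l\<in>D. (\<lambda>n. N (X n - l)) \<longlonglongrightarrow> 0"
  using assms unfolding banach_on_def by (elim conjE; simp)+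

lemma banach_on_scale_zero:
  assumes "banach_on D sc N" "x \<in> D"
  shows "sc 0 x = 0"
  using banach_on_scale_add_left[OF assms, of 0 0] by simp

lemma banach_on_scale_zero_right:
  assumes "banach_on D sc N"
  shows "sc r 0 = 0"
proof -
  have "sc r (0 + 0) = sc r 0 + sc r 0"
    by (intro banach_on_scale_add_right[OF assms] banach_on_zero[OF assms])
  then show ?thesis by (metis add.right_neutral add_left_imp_eq)
qed

lemma banach_on_scale_minus_one:
  assumes "banach_on D sc N" "x \<in> D"
  shows "sc (-1) x = - x"
  using banach_on_scale_add_left[OF assms, of 1 "-1"] banach_on_scale_zero[OF assms]
    banach_on_scale_one[OF assms] by (simp add: eq_neg_iff_add_eq_0 add.commute)

lemma banach_on_uminus:
  assumes "banach_on D sc N" "x \<in> D"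
  shows "- x \<in> D"
  using banach_on_scale[OF assms, of "-1"] banach_on_scale_minus_one[OF assms] by simp

lemma banach_on_diff:
  assumes "banach_on D sc N" "x \<in> D" "y \<in> D"
  shows "x - y \<in> D"
  using banach_on_add[OF assms(1,2) banach_on_uminus[OF assms(1,3)]] by simp

lemma banach_on_norm_zero:
  assumes "banach_on D sc N"
  shows "N 0 = 0"
  using banach_on_norm_scale[OF assms banach_on_zero[OF assms], of 0]
    banach_on_scale_zero[OF assms banach_on_zero[OF assms]] by simp

lemma banach_on_norm_uminus:
  assumes "banach_on D sc N" "x \<in> D"
  shows "N (- x) = N x"
  using banach_on_norm_scale[OF assms, of "-1"] banach_on_scale_minus_one[OF assms] by simp

lemma banach_on_norm_nonneg:
  assumes "banach_on D sc N" "x \<in> D"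
  shows "0 \<le> N x"
  using banach_on_norm_triangle[OF assms banach_on_uminus[OF assms]]
    banach_on_norm_uminus[OF assms] banach_on_norm_zero[OF assms(1)] by simp

text \<open>A Banach structure becomes a value, so that it can index the product below. The zero
  space makes the type nonempty over every group.\<close>

typedef (overloaded) 's banach_structure =
  "{(D :: 's::ab_group_add set, sc, N). banach_on D sc N}"
  by (rule exI[of _ "({0}, \<lambda>_ _. 0, \<lambda>_. 0)"]) (simp add: banach_on_def)

definition bs_carrier :: "'s::ab_group_add banach_structure \<Rightarrow> 's set" where
  "bs_carrier d = fst (Rep_banach_structure d)"
definition bs_scale :: "'s::ab_group_add banach_structure \<Rightarrow> real \<Rightarrow> 's \<Rightarrow> 's" where
  "bs_scale d = fst (snd (Rep_banach_structure d))"
definition bs_norm :: "'s::ab_group_add banach_structure \<Rightarrow> 's \<Rightarrow> real" where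
  "bs_norm d = snd (snd (Rep_banach_structure d))"

lemma banach_on_bs: "banach_on (bs_carrier d) (bs_scale d) (bs_norm d)"
  using Rep_banach_structure[of d]
  by (auto simp: bs_carrier_def bs_scale_def bs_norm_def)

lemmas bs_zero = banach_on_zero[OF banach_on_bs]
  and bs_add = banach_on_add[OF banach_on_bs]
  and bs_diff = banach_on_diff[OF banach_on_bs]
  and bs_uminus = banach_on_uminus[OF banach_on_bs]
  and bs_norm_zero = banach_on_norm_zero[OF banach_on_bs]
  and bs_norm_uminus = banach_on_norm_uminus[OF banach_on_bs]
  and bs_norm_triangle = banach_on_norm_triangle[OF banach_on_bs]

lemma banach_on_is_bs:
  assumes "banach_on D sc N"
  obtains d where "bs_carrier d = D" "bs_scale d = sc" "bs_norm d = N"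
  using Abs_banach_structure_inverse[of "(D, sc, N)"] assms that[of "Abs_banach_structure (D, sc, N)"]
  by (simp add: bs_carrier_def bs_scale_def bs_norm_def)

text \<open>
  A type cannot depend on a set with operations, but it can be the \<open>\<ell>\<^sup>\<infinity>\<close>-product of all
  Banach spaces carried by subsets of a fixed group; each of these spaces is a closed linear
  subspace of the product. This makes the analysis of Banach space types available for them.
\<close>

typedef (overloaded) 's banach_product =
  "{F :: 's::ab_group_add banach_structure \<Rightarrow> 's.
      (\<forall>d. F d \<in> bs_carrier d) \<and> bdd_above (range (\<lambda>d. bs_norm d (F d)))}"
  by (rule exI[of _ "\<lambda>_. 0"])
    (auto simp: bs_zero bs_norm_zero)

setup_lifting type_definition_banach_product

lemma bdd_above_range_mono:
  fixes f g :: "'a \<Rightarrow> real"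
  assumes "bdd_above (range g)" "\<And>x. f x \<le> g x"
  shows "bdd_above (range f)"
  using assms unfolding bdd_above_def by (metis (no_types, opaque_lifting) order_trans rangeE rangeI)

lemma bdd_above_range_add:
  fixes f g :: "'a \<Rightarrow> real"
  assumes "bdd_above (range f)" "bdd_above (range g)"
  shows "bdd_above (range (\<lambda>x. f x + g x))"
proof -
  obtain a b where "\<And>x. f x \<le> a" "\<And>x. g x \<le> b"
    using assms unfolding bdd_above_def by blast
  then have "\<And>x. f x + g x \<le> a + b" by (simp add: add_mono)
  then show ?thesis unfolding bdd_above_def by blast
qed

lemma bdd_above_range_mult:
  fixes f :: "'a \<Rightarrow> real"
  assumes "bdd_above (range f)" "c \<ge> 0"
  shows "bdd_above (range (\<lambda>x. c * f x))"
proof -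
  obtain a where "\<And>x. f x \<le> a"
    using assms unfolding bdd_above_def by blast
  then have "\<And>x. c * f x \<le> c * a" using assms(2) by (simp add: mult_left_mono)
  then show ?thesis unfolding bdd_above_def by blast
qed

instantiation banach_product :: (ab_group_add) real_normed_vector
begin

lift_definition zero_banach_product :: "'a banach_product" is "\<lambda>_. 0"
  by (auto simp: bs_zero bs_norm_zero)

lift_definition plus_banach_product ::
  "'a banach_product \<Rightarrow> 'a banach_product \<Rightarrow> 'a banach_product" is "\<lambda>F G d. F d + G d"
proof (intro conjI allI)
  fix F G :: "'a banach_structure \<Rightarrow> 'a" and d
  assume F: "(\<forall>d. F d \<in> bs_carrier d) \<and> bdd_above (range (\<lambda>d. bs_norm d (F d)))"
    and G: "(\<forall>d. G d \<in> bs_carrier d) \<and> bdd_above (range (\<lambda>d. bs_norm d (G d)))"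
  show "F d + G d \<in> bs_carrier d"
    using F G by (simp add: bs_add)
  have "bdd_above (range (\<lambda>d. bs_norm d (F d) + bs_norm d (G d)))"
    using F G by (intro bdd_above_range_add) simp_all
  then show "bdd_above (range (\<lambda>d. bs_norm d (F d + G d)))"
    by (rule bdd_above_range_mono) (use F G in \<open>simp add: bs_norm_triangle\<close>)
qed

lift_definition uminus_banach_product :: "'a banach_product \<Rightarrow> 'a banach_product" is "\<lambda>F d. - F d"
  by (auto simp: bs_uminus bs_norm_uminus)

definition minus_banach_product :: "'a banach_product \<Rightarrow> 'a banach_product \<Rightarrow> 'a banach_product"
  where "minus_banach_product F G = F + - G"

lift_definition scaleR_banach_product :: "real \<Rightarrow> 'a banach_product \<Rightarrow> 'a banach_product"
  is "\<lambda>r F d. bs_scale d r (F d)"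
  by (auto simp: banach_on_scale[OF banach_on_bs] banach_on_norm_scale[OF banach_on_bs]
      intro!: bdd_above_range_mult)

lift_definition norm_banach_product :: "'a banach_product \<Rightarrow> real"
  is "\<lambda>F. SUP d. bs_norm d (F d)" .

definition sgn_banach_product :: "'a banach_product \<Rightarrow> 'a banach_product"
  where "sgn_banach_product F = scaleR (inverse (norm F)) F"

definition dist_banach_product :: "'a banach_product \<Rightarrow> 'a banach_product \<Rightarrow> real"
  where "dist_banach_product F G = norm (F - G)"

definition uniformity_banach_product :: "('a banach_product \<times> 'a banach_product) filter"
  where "uniformity_banach_product = (INF e\<in>{0<..}. principal {(x, y). dist x y < e})"

definition open_banach_product :: "'a banach_product set \<Rightarrow> bool"
  where "open_banach_product U =
    (\<forall>x\<in>U. eventually (\<lambda>(x', y). x' = x \<longrightarrow> y \<in> U) uniformity)"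

instance
proof
  fix F G H :: "'a banach_product" and r s :: real
  show "F + G + H = F + (G + H)" by transfer (simp add: add.assoc)
  show "F + G = G + F" by transfer (simp add: add.commute)
  show "0 + F = F" by transfer simp
  show "- F + F = 0" by transfer simp
  show "F - G = F + - G" by (simp add: minus_banach_product_def)
  show "r *\<^sub>R (F + G) = r *\<^sub>R F + r *\<^sub>R G"
    by transfer (simp add: banach_on_scale_add_right[OF banach_on_bs])
  show "(r + s) *\<^sub>R F = r *\<^sub>R F + s *\<^sub>R F"
    by transfer (simp add: banach_on_scale_add_left[OF banach_on_bs])
  show "r *\<^sub>R s *\<^sub>R F = (r * s) *\<^sub>R F"
    by transfer (simp add: banach_on_scale_scale[OF banach_on_bs])
  show "1 *\<^sub>R F = F"
    by transfer (simp add: banach_on_scale_one[OF banach_on_bs])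
  show "dist F G = norm (F - G)" by (simp add: dist_banach_product_def)
  show "sgn F = inverse (norm F) *\<^sub>R F" by (simp add: sgn_banach_product_def)
  show "uniformity = (INF e\<in>{0<..}. principal {(x :: 'a banach_product, y). dist x y < e})"
    by (simp add: uniformity_banach_product_def)
  show "open U = (\<forall>x\<in>U. eventually (\<lambda>(x', y). x' = x \<longrightarrow> y \<in> U) uniformity)"
    for U :: "'a banach_product set"
    by (simp add: open_banach_product_def)
  show "norm F = 0 \<longleftrightarrow> F = 0"
  proof transfer
    fix F :: "'a banach_structure \<Rightarrow> 'a"
    assume F: "(\<forall>d. F d \<in> bs_carrier d) \<and> bdd_above (range (\<lambda>d. bs_norm d (F d)))"
    show "((SUP d. bs_norm d (F d)) = 0) = (F = (\<lambda>_. 0))"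
    proof
      assume 0: "(SUP d. bs_norm d (F d)) = 0"
      have "F d = 0" for d
      proof -
        have d: "F d \<in> bs_carrier d" using F by blast
        have "bs_norm d (F d) \<le> (SUP d. bs_norm d (F d))" using F by (intro cSUP_upper) auto
        then have "bs_norm d (F d) = 0"
          unfolding 0 using banach_on_norm_nonneg[OF banach_on_bs d] by (rule antisym)
        then show ?thesis by (rule banach_on_norm_zeroD[OF banach_on_bs d])
      qed
      then show "F = (\<lambda>_. 0)" by auto
    next
      assume "F = (\<lambda>_. 0)"
      then show "(SUP d. bs_norm d (F d)) = 0" by (simp add: bs_norm_zero)
    qed
  qed
  show "norm (F + G) \<le> norm F + norm G"
  proof transfer
    fix F G :: "'a banach_structure \<Rightarrow> 'a"
    assume F: "(\<forall>d. F d \<in> bs_carrier d) \<and> bdd_above (range (\<lambda>d. bs_norm d (F d)))"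
      and G: "(\<forall>d. G d \<in> bs_carrier d) \<and> bdd_above (range (\<lambda>d. bs_norm d (G d)))"
    show "(SUP d. bs_norm d (F d + G d)) \<le> (SUP d. bs_norm d (F d)) + (SUP d. bs_norm d (G d))"
    proof (rule cSUP_least)
      fix d
      have "bs_norm d (F d + G d) \<le> bs_norm d (F d) + bs_norm d (G d)"
        using F G bs_norm_triangle by blast
      also have "\<dots> \<le> (SUP d. bs_norm d (F d)) + (SUP d. bs_norm d (G d))"
        using F G by (intro add_mono cSUP_upper) auto
      finally show "bs_norm d (F d + G d) \<le> (SUP d. bs_norm d (F d)) + (SUP d. bs_norm d (G d))" .
    qed simp
  qed
  show "norm (r *\<^sub>R F) = \<bar>r\<bar> * norm F"
  proof transfer
    fix r and F :: "'a banach_structure \<Rightarrow> 'a"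
    assume F: "(\<forall>d. F d \<in> bs_carrier d) \<and> bdd_above (range (\<lambda>d. bs_norm d (F d)))"
    have "(SUP d. bs_norm d (bs_scale d r (F d))) = (SUP d. \<bar>r\<bar> * bs_norm d (F d))"
      using F by (simp add: banach_on_norm_scale[OF banach_on_bs])
    also have "\<dots> = \<bar>r\<bar> * (SUP d. bs_norm d (F d))"
      using F by (subst continuous_at_Sup_mono[where f = "\<lambda>x. \<bar>r\<bar> * x"])
        (auto simp: mono_def mult_left_mono image_image intro!: continuous_intros)
    finally show "(SUP d. bs_norm d (bs_scale d r (F d))) = \<bar>r\<bar> * (SUP d. bs_norm d (F d))" .
  qed
qed

end

definition bp_proj :: "'s::ab_group_add banach_structure \<Rightarrow> 's banach_product \<Rightarrow> 's" where
  "bp_proj d F = Rep_banach_product F d"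

text \<open>The default 0 off the carrier makes the map total; linearity and isometry hold on the
  carrier.\<close>

lift_definition bp_emb :: "'s::ab_group_add banach_structure \<Rightarrow> 's \<Rightarrow> 's banach_product"
  is "\<lambda>d x d'. if d' = d \<and> x \<in> bs_carrier d then x else 0"
proof
  fix d :: "'s banach_structure" and x
  show "\<forall>d'. (if d' = d \<and> x \<in> bs_carrier d then x else 0) \<in> bs_carrier d'"
    by (auto simp: bs_zero)
  show "bdd_above (range (\<lambda>d'. bs_norm d' (if d' = d \<and> x \<in> bs_carrier d then x else 0)))"
    by (rule bdd_aboveI[of _ "max 0 (bs_norm d x)"])
      (auto simp: bs_norm_zero)
qed

lemma bp_proj_carrier: "bp_proj d F \<in> bs_carrier d"
  using Rep_banach_product[of F] by (simp add: bp_proj_def)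

lemma bp_proj_add: "bp_proj d (F + G) = bp_proj d F + bp_proj d G"
  by (simp add: bp_proj_def plus_banach_product.rep_eq)

lemma bp_proj_diff: "bp_proj d (F - G) = bp_proj d F - bp_proj d G"
  using bp_proj_add[of d "F - G" G] by (simp add: algebra_simps)

lemma bp_proj_scale: "bp_proj d (r *\<^sub>R F) = bs_scale d r (bp_proj d F)"
  by (simp add: bp_proj_def scaleR_banach_product.rep_eq)

lemma bp_proj_norm: "bs_norm d (bp_proj d F) \<le> norm F"
  unfolding bp_proj_def norm_banach_product.rep_eq
  using Rep_banach_product[of F] by (intro cSUP_upper) auto

lemma bp_norm_le:
  assumes "\<And>d. bs_norm d (bp_proj d F) \<le> c"
  shows "norm F \<le> c"
  unfolding norm_banach_product.rep_eq using assms by (intro cSUP_least) (auto simp: bp_proj_def)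

lemma bp_eqI:
  assumes "\<And>d. bp_proj d F = bp_proj d G"
  shows "F = G"
  using assms by (auto simp: bp_proj_def Rep_banach_product_inject[symmetric])

lemma bp_proj_emb: "x \<in> bs_carrier d \<Longrightarrow> bp_proj d' (bp_emb d x) = (if d' = d then x else 0)"
  by (simp add: bp_proj_def bp_emb.rep_eq)

lemma bp_emb_add:
  assumes "x \<in> bs_carrier d" "y \<in> bs_carrier d"
  shows "bp_emb d (x + y) = bp_emb d x + bp_emb d y"
  using assms by (intro bp_eqI) (simp add: bp_proj_emb bp_proj_add bs_add)

lemma bp_emb_diff:
  assumes "x \<in> bs_carrier d" "y \<in> bs_carrier d"
  shows "bp_emb d (x - y) = bp_emb d x - bp_emb d y"
  using assms by (intro bp_eqI) (simp add: bp_proj_emb bp_proj_diff bs_diff)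

lemma bp_emb_scale:
  assumes "x \<in> bs_carrier d"
  shows "bp_emb d (bs_scale d r x) = r *\<^sub>R bp_emb d x"
proof (rule bp_eqI)
  fix d'
  show "bp_proj d' (bp_emb d (bs_scale d r x)) = bp_proj d' (r *\<^sub>R bp_emb d x)"
    using assms by (simp add: bp_proj_emb bp_proj_scale banach_on_scale[OF banach_on_bs]
        banach_on_scale_zero_right[OF banach_on_bs])
qed

lemma bp_emb_norm:
  assumes "x \<in> bs_carrier d"
  shows "norm (bp_emb d x) = bs_norm d x"
proof (rule antisym)
  show "norm (bp_emb d x) \<le> bs_norm d x"
    using assms banach_on_norm_nonneg[OF banach_on_bs assms]
    by (intro bp_norm_le) (simp add: bp_proj_emb bs_norm_zero)
  show "bs_norm d x \<le> norm (bp_emb d x)"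
    using bp_proj_norm[of d "bp_emb d x"] assms by (simp add: bp_proj_emb)
qed

lemma bp_ex_proj:
  assumes "\<And>d. f d \<in> bs_carrier d" "\<And>d. bs_norm d (f d) \<le> c"
  shows "\<exists>F. \<forall>d. bp_proj d F = f d"
proof -
  have "f \<in> {F. (\<forall>d. F d \<in> bs_carrier d) \<and> bdd_above (range (\<lambda>d. bs_norm d (F d)))}"
  proof (intro CollectI conjI allI)
    show "bdd_above (range (\<lambda>d. bs_norm d (f d)))"
      by (rule bdd_aboveI2[of _ _ c]) (rule assms(2))
  qed (rule assms(1))
  then show ?thesis
    by (intro exI[of _ "Abs_banach_product f"]) (simp add: bp_proj_def Abs_banach_product_inverse)
qed

text \<open>Coordinates converge because each factor is complete. The Cauchy estimate is uniform
  over the coordinates and passes to the limits, which bounds the family of limits and turns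
  coordinatewise convergence into norm convergence.\<close>

instance banach_product :: (ab_group_add) banach
proof
  fix X :: "nat \<Rightarrow> 'a banach_product"
  assume X: "Cauchy X"
  have conv: "\<exists>l\<in>bs_carrier d. (\<lambda>n. bs_norm d (bp_proj d (X n) - l)) \<longlonglongrightarrow> 0" for d
  proof (rule banach_on_complete[OF banach_on_bs])
    fix e :: real assume "e > 0"
    then obtain n0 where n0: "\<And>m n. m \<ge> n0 \<Longrightarrow> n \<ge> n0 \<Longrightarrow> norm (X m - X n) < e"
      using CauchyD[OF X] by blast
    then have "bs_norm d (bp_proj d (X m) - bp_proj d (X n)) < e" if "m \<ge> n0" "n \<ge> n0" for m n
      using bp_proj_norm[of d "X m - X n"] that by (force simp: bp_proj_diff)
    then show "\<exists>n0. \<forall>m\<ge>n0. \<forall>n\<ge>n0. bs_norm d (bp_proj d (X m) - bp_proj d (X n)) < e"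
      by blast
  qed (rule bp_proj_carrier)
  then obtain l where l: "\<And>d. l d \<in> bs_carrier d"
    "\<And>d. (\<lambda>n. bs_norm d (bp_proj d (X n) - l d)) \<longlonglongrightarrow> 0"
    by metis
  \<comment> \<open>Let \<open>m\<close> tend to infinity in the triangle inequality through
    \<open>X m\<close>; the bound \<open>e\<close> is the same for all coordinates.\<close>
  have unif: "bs_norm d (bp_proj d (X n) - l d) \<le> e"
    if e: "\<And>m. m \<ge> n0 \<Longrightarrow> norm (X n - X m) \<le> e" for d n n0 e
  proof (rule tendsto_le[OF _ _ tendsto_const])
    show "(\<lambda>m. e + bs_norm d (bp_proj d (X m) - l d)) \<longlonglongrightarrow> e"
      using tendsto_add[OF tendsto_const l(2)[of d], of e] by simp
    show "\<forall>\<^sub>F m in sequentially. bs_norm d (bp_proj d (X n) - l d) \<le> e + bs_norm d (bp_proj d (X m) - l d)"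
      using eventually_ge_at_top[of n0]
    proof eventually_elim
      case (elim m)
      have "bs_norm d (bp_proj d (X n) - l d) =
          bs_norm d (bp_proj d (X n - X m) + (bp_proj d (X m) - l d))"
        by (simp add: bp_proj_diff)
      also have "\<dots> \<le> bs_norm d (bp_proj d (X n - X m)) + bs_norm d (bp_proj d (X m) - l d)"
        by (intro bs_norm_triangle bp_proj_carrier
            bs_diff l(1))
      also have "bs_norm d (bp_proj d (X n - X m)) \<le> e"
        using bp_proj_norm e[OF elim] by (rule order_trans)
      finally show ?case by simp
    qed
  qed simp
  \<comment> \<open>Distance 1 from the single term \<open>X n0\<close> bounds all coordinates of
    the limit at once, as membership in the product requires.\<close>
  obtain n0 where n0: "\<And>m n. m \<ge> n0 \<Longrightarrow> n \<ge> n0 \<Longrightarrow> norm (X m - X n) < 1"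
    using CauchyD[OF X, of 1] by auto
  have "\<exists>L. \<forall>d. bp_proj d L = l d"
  proof (rule bp_ex_proj)
    fix d
    show "l d \<in> bs_carrier d" by (rule l(1))
    have "bs_norm d (bp_proj d (X n0) - l d) \<le> 1"
      using n0 by (intro unif[of n0]) (auto intro: less_imp_le)
    moreover have "bs_norm d (l d) = bs_norm d (bp_proj d (X n0) + - (bp_proj d (X n0) - l d))"
      by simp
    moreover have "\<dots> \<le> bs_norm d (bp_proj d (X n0)) + bs_norm d (- (bp_proj d (X n0) - l d))"
      by (intro bs_norm_triangle bp_proj_carrier
            bs_uminus bs_diff l(1))
    moreover have "bs_norm d (- (bp_proj d (X n0) - l d)) = bs_norm d (bp_proj d (X n0) - l d)"
      by (intro bs_norm_uminus bs_diff
          bp_proj_carrier l(1))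
    ultimately show "bs_norm d (l d) \<le> norm (X n0) + 1"
      using bp_proj_norm[of d "X n0"] by linarith
  qed
  then obtain L where L: "\<And>d. bp_proj d L = l d" by blast
  have "X \<longlonglongrightarrow> L"
  proof (rule LIMSEQ_I)
    fix e :: real assume "e > 0"
    then obtain n0 where n0: "\<And>m n. m \<ge> n0 \<Longrightarrow> n \<ge> n0 \<Longrightarrow> norm (X m - X n) < e / 2"
      using CauchyD[OF X, of "e / 2"] by auto
    have "norm (X n - L) \<le> e / 2" if "n \<ge> n0" for n
    proof (rule bp_norm_le)
      fix d
      have "bs_norm d (bp_proj d (X n) - l d) \<le> e / 2"
        by (rule unif[of n0]) (use n0[OF that] in \<open>simp add: less_imp_le\<close>)
      then show "bs_norm d (bp_proj d (X n - L)) \<le> e / 2" by (simp add: bp_proj_diff L)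
    qed
    then show "\<exists>n0. \<forall>n\<ge>n0. norm (X n - L) < e" using \<open>e > 0\<close> by fastforce
  qed
  then show "convergent X" by (auto simp: convergent_def)
qed

section \<open>Riemann sums and Laplace transforms in Banach spaces\<close>

lemma eventually_riemann_filter:
  "eventually P (riemann_filter a b) \<longleftrightarrow>
     (\<exists>\<delta>>0. \<forall>p. p tagged_division_of {a..b} \<and> (\<forall>(t, J)\<in>p. measure lborel J < \<delta>) \<longrightarrow> P p)"
  unfolding riemann_filter_def
proof (subst eventually_INF_base)
  fix x y :: real assume "x \<in> {0<..}" "y \<in> {0<..}"
  then show "\<exists>z\<in>{0<..}. principal {p. p tagged_division_of {a..b} \<and> (\<forall>(t, J)\<in>p. measure lborel J < z)}
      \<le> inf (principal {p. p tagged_division_of {a..b} \<and> (\<forall>(t, J)\<in>p. measure lborel J < x)})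
          (principal {p. p tagged_division_of {a..b} \<and> (\<forall>(t, J)\<in>p. measure lborel J < y)})"
    by (intro bexI[of _ "min x y"]) (auto split: prod.splits)
qed (auto simp: eventually_principal)

text \<open>Cousin's lemma: every gauge admits a fine tagged division. With the constant radius d/3
  both endpoints of a cell lie within d/3 of its tag, so its length is below d. Uniqueness of
  integrals rests on this.\<close>

lemma riemann_filter_neq_bot: "riemann_filter a b \<noteq> bot"
proof
  assume "riemann_filter a b = bot"
  then have "eventually (\<lambda>_. False) (riemann_filter a b)" by simp
  then obtain d where d: "d > 0"
    "\<And>p. p tagged_division_of {a..b} \<Longrightarrow> (\<forall>(t, J)\<in>p. measure lborel J < d) \<Longrightarrow> False"
    unfolding eventually_riemann_filter by blast
  have "gauge (\<lambda>x::real. ball x (d / 3))" using d(1) by auto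
  then obtain p where p: "p tagged_division_of {a..b}" "(\<lambda>x. ball x (d / 3)) fine p"
    using fine_division_exists_real by blast
  have "measure lborel J < d" if tJ: "(t, J) \<in> p" for t J
  proof -
    obtain u v where J: "J = cbox u v" using tagged_division_ofD(4)[OF p(1) tJ] by blast
    show ?thesis
    proof (cases "u \<le> v")
      case True
      then have "u \<in> ball t (d / 3)" "v \<in> ball t (d / 3)"
        using p(2) tJ J unfolding fine_def by (auto simp: subset_iff)
      then have "v - u < d" unfolding mem_ball dist_real_def using d(1) by linarith
      then show ?thesis using True J by simp
    next
      case False
      then show ?thesis using J d(1) by simp
    qed
  qed
  then show False using d(2)[OF p(1)] by blast
qed

text \<open>By uniform continuity, on a fine mesh each cell errs by at most \<open>e'\<close> times
  its length, and the lengths add up to that of the interval. This links the mesh filter to the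
  gauge integral of the library.\<close>

lemma tendsto_riemann_sums:
  fixes f :: "real \<Rightarrow> 'a::banach"
  assumes "continuous_on {a..b} f"
  shows "((\<lambda>p. \<Sum>(t, J)\<in>p. measure lborel J *\<^sub>R f t) \<longlongrightarrow> integral {a..b} f) (riemann_filter a b)"
proof (rule tendstoI)
  fix e :: real assume e: "e > 0"
  define c where "c = measure lborel {a..b}"
  \<comment> \<open>The summand 1 covers intervals of length 0 and makes the total error strictly
    smaller than \<open>e\<close>.\<close>
  define e' where "e' = e / (c + 1)"
  have c: "c \<ge> 0" by (simp add: c_def)
  have e': "e' > 0" "e' * c < e"
    using e c by (auto simp: e'_def field_simps)
  obtain d where d: "d > 0"
    "\<And>x y. x \<in> {a..b} \<Longrightarrow> y \<in> {a..b} \<Longrightarrow> dist y x < d \<Longrightarrow> dist (f y) (f x) < e'"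
    using compact_uniformly_continuous[OF assms compact_Icc] e'(1)
    unfolding uniformly_continuous_on_def by metis
  have "dist (\<Sum>(t, J)\<in>p. measure lborel J *\<^sub>R f t) (integral {a..b} f) < e"
    if p: "p tagged_division_of {a..b}" and fine: "\<forall>(t, J)\<in>p. measure lborel J < d" for p
  proof -
    have each: "norm (measure lborel J *\<^sub>R f t - integral J f) \<le> e' * measure lborel J" if tJ: "(t, J) \<in> p" for t J
    proof -
      obtain u v where J: "J = {u..v}" using p tJ by (metis box_real(2) tagged_division_ofD(4))
      have tJ': "t \<in> J" "J \<subseteq> {a..b}" using p tJ by blast+
      then have uv: "u \<le> v" using J by auto
      have cont: "continuous_on {u..v} f" using assms tJ'(2) J continuous_on_subset by blast
      have "v - u < d" using fine tJ J uv by fastforce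
      then have small: "norm (f t - f s) \<le> e'" if "s \<in> {u..v}" for s
      proof -
        have "\<bar>t - s\<bar> < d" using that tJ'(1) J \<open>v - u < d\<close> by auto
        then have "dist (f t) (f s) < e'"
          using that tJ' J by (intro d(2)) (auto simp: dist_real_def)
        then show ?thesis by (simp add: dist_norm)
      qed
      have "measure lborel J *\<^sub>R f t - integral J f = integral {u..v} (\<lambda>s. f t - f s)"
        using uv cont J by (subst integral_diff) (auto intro: integrable_continuous_real)
      also have "norm \<dots> \<le> e' * (v - u)"
        using uv cont small by (intro integral_bound) (auto intro!: continuous_intros)
      finally show ?thesis using J uv by simp
    qed
    have "(\<Sum>(t, J)\<in>p. measure lborel J *\<^sub>R f t) - integral {a..b} f
        = (\<Sum>(t, J)\<in>p. measure lborel J *\<^sub>R f t - integral J f)"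
      using integral_combine_tagged_division_topdown[of f a b p] p integrable_continuous_real[OF assms]
      by (simp add: sum_subtractf split_def)
    also have "norm \<dots> \<le> (\<Sum>(t, J)\<in>p. e' * measure lborel J)"
      using each by (intro sum_norm_le) (auto split: prod.splits)
    also have "\<dots> = e' * c"
      using additive_content_tagged_division[of p a b] p
      by (simp add: c_def sum_distrib_left[symmetric] split_def)
    finally show ?thesis using e'(2) by (simp add: dist_norm)
  qed
  then show "\<forall>\<^sub>F p in riemann_filter a b. dist (\<Sum>(t, J)\<in>p. measure lborel J *\<^sub>R f t) (integral {a..b} f) < e"
    unfolding eventually_riemann_filter using d(1) by blast
qed

lemma integral_inverse_one_plus_square:
  assumes "0 \<le> L"
  shows "integral {0..L} (\<lambda>s. inverse (1 + s\<^sup>2)) = arctan L"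
proof -
  have "((\<lambda>s. inverse (1 + s\<^sup>2)) has_integral (arctan L - arctan 0)) {0..L}"
    using assms by (intro fundamental_theorem_of_calculus)
      (auto simp: has_real_derivative_iff_has_vector_derivative[symmetric]
        intro!: has_field_derivative_at_within DERIV_arctan)
  then show ?thesis by (simp add: integral_unique)
qed

lemma continuous_on_inverse_one_plus_square:
  "continuous_on S (\<lambda>s::real. inverse (1 + s\<^sup>2))"
  by (intro continuous_intros) (simp add: add_nonneg_eq_0_iff)

lemma continuous_on_atLeast_Icc:
  assumes "continuous_on {0..} f" "0 \<le> (a::real)"
  shows "continuous_on {a..b} f"
  by (rule continuous_on_subset[OF assms(1)]) (use assms(2) in auto)

lemma integral_diff_Icc:
  fixes f :: "real \<Rightarrow> 'a::banach"
  assumes "continuous_on {0..} f" "0 \<le> K" "K \<le> L"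
  shows "integral {0..L} f - integral {0..K} f = integral {K..L} f"
  using Henstock_Kurzweil_Integration.integral_combine[OF assms(2,3)
      integrable_continuous_real[OF continuous_on_atLeast_Icc[OF assms(1) order_refl]]]
  by (simp add: algebra_simps)

text \<open>Increments of the integral are dominated by increments of \<open>c\<close> times the
  arctangent, which converges at infinity; so the integrals up to the integers form a Cauchy
  sequence.\<close>

lemma tendsto_improper_integral:
  fixes f :: "real \<Rightarrow> 'a::banach"
  assumes cont: "continuous_on {0..} f"
    and bound: "\<And>s. 0 \<le> s \<Longrightarrow> norm (f s) \<le> c * inverse (1 + s\<^sup>2)"
  shows "\<exists>y. ((\<lambda>L. integral {0..L} f) \<longlongrightarrow> y) at_top"
proof -
  define F where "F = (\<lambda>L. integral {0..L} f)"
  define \<psi> where "\<psi> = (\<lambda>L. c * arctan L)"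
  have F: "norm (F L - F K) \<le> \<psi> L - \<psi> K" if "0 \<le> K" "K \<le> L" for K L
  proof -
    have "norm (F L - F K) \<le> integral {K..L} (\<lambda>s. c * inverse (1 + s\<^sup>2))"
      unfolding F_def integral_diff_Icc[OF cont that] using that
      by (intro integral_norm_bound_integral)
        (auto intro!: integrable_continuous_real bound continuous_on_atLeast_Icc[OF cont]
          continuous_on_mult continuous_on_inverse_one_plus_square)
    also have "\<dots> = c * (arctan L - arctan K)"
      using integral_diff_Icc[OF continuous_on_inverse_one_plus_square that] that
      by (simp add: integral_inverse_one_plus_square)
    finally show ?thesis by (simp add: \<psi>_def right_diff_distrib)
  qed
  have \<psi>: "(\<psi> \<longlongrightarrow> c * (pi / 2)) at_top"
    unfolding \<psi>_def by (intro tendsto_mult tendsto_const tendsto_arctan_at_top)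
  have \<psi>n: "(\<lambda>n. \<psi> (real n)) \<longlonglongrightarrow> c * (pi / 2)"
    by (rule filterlim_compose[OF \<psi> filterlim_real_sequentially])
  have "Cauchy (\<lambda>n. F (real n))"
  proof (rule CauchyI')
    fix e :: real assume "e > 0"
    then obtain n0 where n0: "\<And>m n. m \<ge> n0 \<Longrightarrow> n \<ge> n0 \<Longrightarrow> norm (\<psi> (real m) - \<psi> (real n)) < e"
      using CauchyD[OF LIMSEQ_imp_Cauchy[OF \<psi>n]] by blast
    have "dist (F (real m)) (F (real n)) < e" if mn: "m \<ge> n0" "n > m" for m n
      using F[of "real m" "real n"] n0[of n m] mn by (simp add: dist_norm norm_minus_commute)
    then show "\<exists>n0. \<forall>m\<ge>n0. \<forall>n>m. dist (F (real m)) (F (real n)) < e" by blast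
  qed
  then obtain y where y: "(\<lambda>n. F (real n)) \<longlonglongrightarrow> y"
    by (auto simp: Cauchy_convergent_iff convergent_def)
  \<comment> \<open>Passing to the limit along the integers in the increment bound controls every
    real \<open>K\<close>, which upgrades the limit from a sequence to a real parameter.\<close>
  have rest: "norm (y - F K) \<le> c * (pi / 2) - \<psi> K" if K: "0 \<le> K" for K
  proof (rule tendsto_le[OF sequentially_bot])
    show "(\<lambda>n. norm (F (real n) - F K)) \<longlonglongrightarrow> norm (y - F K)"
      by (intro tendsto_intros y)
    show "(\<lambda>n. \<psi> (real n) - \<psi> K) \<longlonglongrightarrow> c * (pi / 2) - \<psi> K"
      by (intro tendsto_intros \<psi>n)
    show "\<forall>\<^sub>F n in sequentially. norm (F (real n) - F K) \<le> \<psi> (real n) - \<psi> K"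
      using eventually_ge_at_top[of "nat \<lceil>K\<rceil>"]
      by eventually_elim (use K in \<open>auto intro!: F simp: nat_ceiling_le_eq\<close>)
  qed
  have "((\<lambda>K. y - F K) \<longlongrightarrow> 0) at_top"
  proof (rule Lim_null_comparison)
    show "\<forall>\<^sub>F K in at_top. norm (y - F K) \<le> c * (pi / 2) - \<psi> K"
      using eventually_ge_at_top[of 0] by eventually_elim (rule rest)
    show "((\<lambda>K. c * (pi / 2) - \<psi> K) \<longlongrightarrow> 0) at_top"
      using tendsto_diff[OF tendsto_const \<psi>, of "c * (pi / 2)"] by simp
  qed
  from tendsto_diff[OF tendsto_const this, of y] have "(F \<longlongrightarrow> y) at_top" by simp
  then show ?thesis unfolding F_def by blast
qed

abbreviation laplace_upto :: "(real \<Rightarrow> 'a::banach) \<Rightarrow> nat \<Rightarrow> real \<Rightarrow> 'a" where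
  "laplace_upto u n L \<equiv> integral {0..L} (\<lambda>s. exp (- (real n * s)) *\<^sub>R u s)"

text \<open>
  Substituting \<open>x = e\<^sup>-\<^sup>s\<close>, the transform at the integers is a moment sequence on \<open>[0, 1]\<close>, so
  that by Weierstrass \<open>u\<close> integrates to zero against bump functions.
\<close>

lemma laplace_transform_unique:
  fixes u :: "real \<Rightarrow> 'a::banach"
  assumes cont: "continuous_on {0..} u"
    and bound: "\<And>s. 0 \<le> s \<Longrightarrow> norm (u s) \<le> c"
    and lim: "\<And>n::nat. 1 \<le> n \<Longrightarrow>
      ((\<lambda>L. laplace_upto u n L) \<longlongrightarrow> 0) at_top"
    and s0: "0 \<le> s0"
  shows "u s0 = 0"
proof (rule ccontr)
  assume u0: "u s0 \<noteq> 0"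
  note contI = continuous_on_atLeast_Icc[OF cont order_refl]
  have c: "0 \<le> c" using bound[OF s0] norm_ge_zero[of "u s0"] by linarith
  have exp_int: "integral {0..L} (\<lambda>s. exp (- s)) = 1 - exp (- L)" if "0 \<le> L" for L :: real
  proof -
    have "((\<lambda>s. exp (- s)) has_integral (- exp (- L) - - exp (- 0))) {0..L}"
      using that by (intro fundamental_theorem_of_calculus)
        (auto simp: has_real_derivative_iff_has_vector_derivative[symmetric]
          intro!: derivative_eq_intros)
    then show ?thesis by (simp add: integral_unique)
  qed
  \<comment> \<open>The factor exp (- s) is the Jacobian of x = exp (- s). It shifts degrees by one:
    the monomial of degree \<open>i\<close> corresponds to the transform at \<open>Suc i\<close>, so
    exactly the values from 1 on occur.\<close>
  have poly: "((\<lambda>L. integral {0..L} (\<lambda>s. (exp (- s) * p (exp (- s))) *\<^sub>R u s)) \<longlongrightarrow> 0) at_top"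
    if p: "real_polynomial_function p" for p :: "real \<Rightarrow> real"
  proof -
    obtain a N where pa: "p = (\<lambda>x. \<Sum>i\<le>N. a i * x ^ i)"
      using p real_polynomial_function_iff_sum by blast
    have split: "(exp (- s) * p (exp (- s))) *\<^sub>R u s
        = (\<Sum>i\<le>N. a i *\<^sub>R (exp (- (real (Suc i) * s)) *\<^sub>R u s))" for s
    proof -
      have "exp (- (real (Suc i) * s)) = exp (- s) * exp (- s) ^ i" for i
        by (simp add: exp_of_nat_mult[symmetric] exp_add[symmetric] algebra_simps)
      then show ?thesis by (simp add: pa sum_distrib_left scaleR_sum_left mult_ac)
    qed
    have "integral {0..L} (\<lambda>s. (exp (- s) * p (exp (- s))) *\<^sub>R u s)
        = (\<Sum>i\<le>N. a i *\<^sub>R laplace_upto u (Suc i) L)" for L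
    proof -
      have "integral {0..L} (\<lambda>s. (exp (- s) * p (exp (- s))) *\<^sub>R u s)
          = (\<Sum>i\<le>N. integral {0..L} (\<lambda>s. a i *\<^sub>R (exp (- (real (Suc i) * s)) *\<^sub>R u s)))"
        unfolding split
        by (rule integral_sum) (auto intro!: integrable_continuous_real continuous_intros contI)
      then show ?thesis by (simp only: integral_cmul)
    qed
    moreover have "((\<lambda>L. \<Sum>i\<le>N. a i *\<^sub>R laplace_upto u (Suc i) L)
        \<longlongrightarrow> (\<Sum>i\<le>N. a i *\<^sub>R 0)) at_top"
      by (intro tendsto_sum tendsto_scaleR tendsto_const lim) simp
    ultimately show ?thesis by simp
  qed
  have limq: "((\<lambda>L. integral {0..L} (\<lambda>s. (exp (- s) * q (exp (- s))) *\<^sub>R u s)) \<longlongrightarrow> 0) at_top"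
    if q: "continuous_on {0..1} q" for q :: "real \<Rightarrow> real"
  proof (rule tendstoI)
    fix e :: real assume e: "e > 0"
    \<comment> \<open>The Jacobian exp (- s) has mass at most 1 on every {0..L}, so replacing
      \<open>q\<close> by a polynomial within \<open>e'\<close> changes the integral by at most
      \<open>e' * c\<close>, hence by at most e/2, for all \<open>L\<close> alike.\<close>
    define e' where "e' = e / (2 * (c + 1))"
    have e': "e' > 0" "e' * c \<le> e / 2" using e c by (auto simp: e'_def field_simps)
    obtain p where p: "real_polynomial_function p" "\<And>x. x \<in> {0..1} \<Longrightarrow> \<bar>q x - p x\<bar> < e'"
      using Stone_Weierstrass_real_polynomial_function[OF compact_Icc q e'(1)] by blast
    have pc: "continuous_on S p" for S
      using p(1) continuous_on_polymonial_function real_polynomial_function_eq by blast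
    have "\<forall>\<^sub>F L in at_top. norm (integral {0..L} (\<lambda>s. (exp (- s) * p (exp (- s))) *\<^sub>R u s)) < e / 2"
      using tendstoD[OF poly[OF p(1)], of "e / 2"] e by simp
    then show "\<forall>\<^sub>F L in at_top.
        dist (integral {0..L} (\<lambda>s. (exp (- s) * q (exp (- s))) *\<^sub>R u s)) 0 < e"
      using eventually_ge_at_top[of 0]
    proof eventually_elim
      case (elim L)
      have qc: "continuous_on {0..L} (\<lambda>s. q (exp (- s)))"
        by (rule continuous_on_compose2[OF q]) (auto intro!: continuous_intros)
      have pc': "continuous_on {0..L} (\<lambda>s. p (exp (- s)))"
        by (rule continuous_on_compose2[OF pc[of UNIV]]) (auto intro!: continuous_intros)
      have "norm (integral {0..L} (\<lambda>s. (exp (- s) * q (exp (- s))) *\<^sub>R u s)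
          - integral {0..L} (\<lambda>s. (exp (- s) * p (exp (- s))) *\<^sub>R u s))
        = norm (integral {0..L} (\<lambda>s. (exp (- s) * (q (exp (- s)) - p (exp (- s)))) *\<^sub>R u s))"
        by (subst integral_diff[symmetric])
          (auto intro!: integrable_continuous_real continuous_intros contI qc pc'
            simp: algebra_simps)
      also have "\<dots> \<le> integral {0..L} (\<lambda>s. (e' * c) * exp (- s))"
      proof (rule integral_norm_bound_integral)
        fix s assume s: "s \<in> {0..L}"
        have "\<bar>q (exp (- s)) - p (exp (- s))\<bar> \<le> e'"
          using p(2)[of "exp (- s)"] s by (simp add: less_imp_le)
        then have "\<bar>q (exp (- s)) - p (exp (- s))\<bar> * norm (u s) \<le> e' * c"
          using bound[of s] s e'(1) by (intro mult_mono) auto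
        then show "norm ((exp (- s) * (q (exp (- s)) - p (exp (- s)))) *\<^sub>R u s) \<le> e' * c * exp (- s)"
          by (simp add: abs_mult mult_ac)
      qed (auto intro!: integrable_continuous_real continuous_intros contI qc pc')
      also have "\<dots> \<le> e' * c"
        using elim(2) e'(1) c by (simp add: exp_int mult_left_le)
      finally show ?case
        using elim(1) e'(2) norm_triangle_sub[of "integral {0..L} (\<lambda>s. (exp (- s) * q (exp (- s))) *\<^sub>R u s)"
            "integral {0..L} (\<lambda>s. (exp (- s) * p (exp (- s))) *\<^sub>R u s)"]
        by simp
    qed
  qed
  define a where "a = norm (u s0)"
  have a: "a > 0" using u0 by (simp add: a_def)
  obtain r where r: "r > 0" "\<And>s. 0 \<le> s \<Longrightarrow> \<bar>s - s0\<bar> < r \<Longrightarrow> norm (u s - u s0) < a / 2"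
    using cont s0 a unfolding continuous_on_iff dist_norm
    by (metis atLeast_iff half_gt_zero real_norm_def)
  define x0 where "x0 = exp (- s0)"
  have "isCont ln x0" by (rule isCont_ln) (simp add: x0_def)
  then obtain \<rho> where \<rho>: "\<rho> > 0" "\<And>x. \<bar>x - x0\<bar> < \<rho> \<Longrightarrow> \<bar>ln x - ln x0\<bar> < r"
    using r(1) unfolding continuous_at_eps_delta dist_real_def by blast
  \<comment> \<open>A tent around exp (- s0). By the choice of \<rho> its support, pulled back to
    time, lies where \<open>u\<close> differs from \<open>u s0\<close> by less than half of the norm
    of \<open>u s0\<close>.\<close>
  define q where "q = (\<lambda>x. max 0 (\<rho> - \<bar>x - x0\<bar>))"
  define w where "w = (\<lambda>s. exp (- s) * q (exp (- s)))"
  have w0: "w s \<ge> 0" for s by (simp add: w_def q_def)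
  have qc: "continuous_on S q" for S unfolding q_def by (intro continuous_intros)
  have wc: "continuous_on S w" for S
    unfolding w_def by (intro continuous_intros continuous_on_compose2[OF qc[of UNIV]]) auto
  define I where "I = (\<lambda>L. integral {0..L} w)"
  define J where "J = (\<lambda>L. integral {0..L} (\<lambda>s. w s *\<^sub>R u s))"
  have J: "(J \<longlongrightarrow> 0) at_top" using limq[OF qc] by (simp add: J_def w_def)
  \<comment> \<open>On the support of the weight, \<open>u\<close> stays close to
    \<open>u s0\<close>; hence integrating \<open>u\<close> against it cannot give less than
    \<open>a / 2\<close> times the mass \<open>I L\<close>. As \<open>J\<close> vanishes in the
    limit, so would the mass.\<close>
  have IJ: "I L \<le> 2 / a * norm (J L)" for L
  proof -
    have "I L *\<^sub>R u s0 = integral {0..L} (\<lambda>s. w s *\<^sub>R u s0)"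
      unfolding I_def by (rule integral_unique[symmetric], rule has_integral_scaleR_left,
        rule integrable_integral, rule integrable_continuous_real, rule wc)
    then have "norm (J L - I L *\<^sub>R u s0) = norm (integral {0..L} (\<lambda>s. w s *\<^sub>R (u s - u s0)))"
      unfolding J_def scaleR_diff_right
      by (subst integral_diff)
        (auto intro!: integrable_continuous_real continuous_intros contI wc)
    also have "\<dots> \<le> integral {0..L} (\<lambda>s. w s * (a / 2))"
    proof (rule integral_norm_bound_integral)
      fix s assume s: "s \<in> {0..L}"
      have "w s * norm (u s - u s0) \<le> w s * (a / 2)"
      proof (cases "w s = 0")
        case False
        then have "\<bar>exp (- s) - x0\<bar> < \<rho>" by (auto simp: w_def q_def max_def split: if_splits)
        then have "\<bar>s - s0\<bar> < r" using \<rho>(2) by (fastforce simp: x0_def)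
        then show ?thesis using r(2)[of s] s w0[of s] by (intro mult_left_mono) auto
      qed simp
      then show "norm (w s *\<^sub>R (u s - u s0)) \<le> w s * (a / 2)" using w0[of s] by simp
    qed (auto intro!: integrable_continuous_real continuous_intros contI wc)
    also have "\<dots> = I L * (a / 2)" by (simp add: I_def)
    finally have "norm (I L *\<^sub>R u s0) \<le> norm (J L) + I L * (a / 2)"
      using norm_triangle_sub[of "I L *\<^sub>R u s0" "J L"] by (simp add: norm_minus_commute)
    moreover have "I L \<ge> 0" unfolding I_def by (intro integral_nonneg integrable_continuous_real wc w0)
    ultimately have "I L * a \<le> norm (J L) + I L * (a / 2)" by (simp add: a_def)
    then show ?thesis using a by (simp add: field_simps)
  qed
  \<comment> \<open>The interval {0..s0 + 1} is nondegenerate and contains \<open>s0\<close> also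
    when \<open>s0 = 0\<close>; a continuous nonnegative weight that is positive at
    \<open>s0\<close> has positive mass there.\<close>
  have pos: "I (s0 + 1) > 0"
  proof -
    have "w s0 > 0" using \<rho>(1) by (simp add: w_def q_def x0_def)
    then have "I (s0 + 1) \<noteq> 0"
      unfolding I_def using integral_eq_0_iff[of 0 "s0 + 1" w] wc w0 s0 by force
    moreover have "I (s0 + 1) \<ge> 0"
      unfolding I_def by (intro integral_nonneg integrable_continuous_real wc w0)
    ultimately show ?thesis by simp
  qed
  have "\<forall>\<^sub>F L in at_top. norm (J L) < a / 2 * I (s0 + 1)"
    using tendstoD[OF J, of "a / 2 * I (s0 + 1)"] pos a by simp
  then have "\<forall>\<^sub>F L in at_top. norm (J L) < a / 2 * I (s0 + 1) \<and> s0 + 1 \<le> L"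
    using eventually_ge_at_top[of "s0 + 1"] by (rule eventually_conj)
  then obtain L where L: "norm (J L) < a / 2 * I (s0 + 1)" "s0 + 1 \<le> L"
    using eventually_happens'[OF trivial_limit_at_top_linorder] by blast
  have "I (s0 + 1) \<le> I L"
    unfolding I_def using L(2) by (intro integral_subset_le integrable_continuous_real wc) (auto simp: w0)
  also have "I L \<le> 2 / a * norm (J L)" by (rule IJ)
  also have "\<dots> < I (s0 + 1)" using L(1) a by (simp add: field_simps)
  finally show False by simp
qed

text \<open>Integration in time is division by \<open>n\<close> on the transform side. By parts,
  \<open>n\<close> times the transform of \<open>P = c0 + \<integral> v\<close> is
  \<open>z n + c0\<close>; the boundary term at \<open>L\<close> vanishes because the decay of
  \<open>v\<close> makes \<open>P\<close> bounded. By \<open>eq\<close> this is \<open>n\<close>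
  times the transform of \<open>u\<close>, and uniqueness applies to \<open>u - P\<close>.\<close>

lemma laplace_transform_primitive:
  fixes u v :: "real \<Rightarrow> 'a::banach"
  assumes u: "continuous_on {0..} u" "\<And>s. 0 \<le> s \<Longrightarrow> norm (u s) \<le> c"
    and v: "continuous_on {0..} v" "\<And>s. 0 \<le> s \<Longrightarrow> norm (v s) \<le> inverse (1 + s\<^sup>2)"
    and yl: "\<And>n::nat. 1 \<le> n \<Longrightarrow>
      ((\<lambda>L. laplace_upto u n L) \<longlongrightarrow> y n) at_top"
    and zl: "\<And>n::nat. 1 \<le> n \<Longrightarrow>
      ((\<lambda>L. laplace_upto v n L) \<longlongrightarrow> z n) at_top"
    and eq: "\<And>n::nat. 1 \<le> n \<Longrightarrow> real n *\<^sub>R y n = z n + c0"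
    and t: "0 \<le> t"
  shows "u t = c0 + integral {0..t} v"
proof -
  define P where "P = (\<lambda>s. c0 + integral {0..s} v)"
  define w where "w = (\<lambda>s. u s - P s)"
  have deriv: "(P has_vector_derivative v s) (at s within {0..L})" if "s \<in> {0..L}" for s L
    unfolding P_def
    using has_vector_derivative_add[OF has_vector_derivative_const
        integral_has_vector_derivative[OF continuous_on_atLeast_Icc[OF v(1) order_refl] that]] by simp
  have Pc: "continuous_on {0..} P"
    unfolding continuous_on_eq_continuous_within
  proof
    \<comment> \<open>The derivative is available on compact intervals; an interval reaching up to
      \<open>s + 1\<close> has the same filter at \<open>s\<close> as {0..}.\<close>
    fix s :: real assume "s \<in> {0..}"
    then have "continuous (at s within {0..s+1}) P"
      using deriv[of s "s + 1"] has_vector_derivative_continuous by auto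
    moreover have "at s within {0..s+1} = at s within {0..}"
      by (rule at_within_nhd[of _ "{..<s+1}"]) auto
    ultimately show "continuous (at s within {0..}) P"
      by (simp add: continuous_within)
  qed
  have Pb: "norm (P s) \<le> norm c0 + 2" if "0 \<le> s" for s
  proof -
    have "norm (integral {0..s} v) \<le> integral {0..s} (\<lambda>s. inverse (1 + s\<^sup>2))"
      using that
      by (intro integral_norm_bound_integral)
        (auto intro!: integrable_continuous_real v continuous_on_atLeast_Icc[OF v(1)]
          continuous_on_inverse_one_plus_square)
    also have "\<dots> = arctan s" using that by (rule integral_inverse_one_plus_square)
    also have "\<dots> \<le> 2" using arctan_ubound[of s] pi_less_4 by linarith
    finally show ?thesis unfolding P_def using norm_triangle_ineq[of c0 "integral {0..s} v"] by linarith
  qed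
  note contI = continuous_on_atLeast_Icc[OF u(1) order_refl] continuous_on_atLeast_Icc[OF v(1) order_refl]
    continuous_on_atLeast_Icc[OF Pc order_refl]
  have "w t = 0"
  proof (rule laplace_transform_unique[where c = "c + (norm c0 + 2)"])
    show "continuous_on {0..} w" unfolding w_def by (intro continuous_intros u(1) Pc)
    show "norm (w s) \<le> c + (norm c0 + 2)" if "0 \<le> s" for s
      unfolding w_def using u(2)[OF that] Pb[OF that] norm_triangle_ineq4[of "u s" "P s"] by linarith
    show "((\<lambda>L. laplace_upto w n L) \<longlongrightarrow> 0) at_top" if n: "1 \<le> n" for n
    proof -
      have npos: "real n > 0" using n by simp
      have dexp: "((\<lambda>s. exp (- (real n * s))) has_real_derivative - real n * exp (- (real n * s)))
          (at s within T)" for s T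
        by (auto intro!: derivative_eq_intros)
      have explim: "((\<lambda>L. exp (- (real n * L))) \<longlongrightarrow> 0) at_top"
        using npos by (intro filterlim_compose[OF exp_at_bot])
          (simp add: filterlim_uminus_at_bot filterlim_tendsto_pos_mult_at_top[OF tendsto_const _ filterlim_ident])
      have parts: "real n *\<^sub>R laplace_upto P n L = laplace_upto v n L + c0 - exp (- (real n * L)) *\<^sub>R P L"
        if L: "0 \<le> L" for L
      proof -
        have "((\<lambda>s. exp (- (real n * s)) *\<^sub>R v s + (- real n * exp (- (real n * s))) *\<^sub>R P s)
            has_integral (exp (- (real n * L)) *\<^sub>R P L - exp (- (real n * 0)) *\<^sub>R P 0)) {0..L}"
          by (intro fundamental_theorem_of_calculus L has_vector_derivative_scaleR dexp deriv)
        then have "integral {0..L} (\<lambda>s. exp (- (real n * s)) *\<^sub>R v s + (- real n) *\<^sub>R (exp (- (real n * s)) *\<^sub>R P s))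
            = exp (- (real n * L)) *\<^sub>R P L - c0"
          by (simp add: P_def integral_unique)
        then have "laplace_upto v n L + (- real n) *\<^sub>R laplace_upto P n L = exp (- (real n * L)) *\<^sub>R P L - c0"
          by (subst (asm) integral_add, (auto intro!: integrable_continuous_real continuous_intros contI)[2])
            (simp only: integral_cmul)
        then show ?thesis by (simp add: algebra_simps)
      qed
      have "\<forall>\<^sub>F L in at_top. real n *\<^sub>R laplace_upto w n L
          = real n *\<^sub>R laplace_upto u n L - (laplace_upto v n L + c0 - exp (- (real n * L)) *\<^sub>R P L)"
        using eventually_ge_at_top[of 0]
      proof eventually_elim
        case (elim L)
        have "laplace_upto w n L = laplace_upto u n L - laplace_upto P n L"
          unfolding w_def scaleR_diff_right
          by (rule integral_diff) (auto intro!: integrable_continuous_real continuous_intros contI)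
        then show ?case by (simp only: scaleR_diff_right parts[OF elim])
      qed
      moreover have "((\<lambda>L. real n *\<^sub>R laplace_upto u n L - (laplace_upto v n L + c0 - exp (- (real n * L)) *\<^sub>R P L))
          \<longlongrightarrow> real n *\<^sub>R y n - (z n + c0 - 0)) at_top"
      proof (intro tendsto_intros yl zl n)
        show "((\<lambda>L. exp (- (real n * L)) *\<^sub>R P L) \<longlongrightarrow> 0) at_top"
        proof (rule Lim_null_comparison)
          show "\<forall>\<^sub>F L in at_top. norm (exp (- (real n * L)) *\<^sub>R P L) \<le> exp (- (real n * L)) * (norm c0 + 2)"
            using eventually_ge_at_top[of 0] by eventually_elim (auto intro!: mult_left_mono Pb)
          show "((\<lambda>L. exp (- (real n * L)) * (norm c0 + 2)) \<longlongrightarrow> 0) at_top"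
            using tendsto_mult[OF explim tendsto_const, of "norm c0 + 2"] by simp
        qed
      qed
      ultimately have "((\<lambda>L. real n *\<^sub>R laplace_upto w n L) \<longlongrightarrow> 0) at_top"
        by (simp add: tendsto_cong eq[OF n])
      from tendsto_scaleR[OF tendsto_const this, of "inverse (real n)"] npos show ?thesis by simp
    qed
  qed (rule t)
  then show ?thesis by (simp add: w_def P_def)
qed

section \<open>Convergence in probability\<close>

context prob_space
begin

text \<open>A metric for convergence in probability: \<open>X\<^sub>n \<rightarrow> X\<close> iff \<open>prob_size (X\<^sub>n - X) \<rightarrow> 0\<close>.\<close>

definition prob_size :: "('a \<Rightarrow> real) \<Rightarrow> real" where
  "prob_size f = (\<integral>w. min 1 \<bar>f w\<bar> \<partial>M)"

lemma integrable_prob_size: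
  fixes f :: "'a \<Rightarrow> real"
  assumes [measurable]: "f \<in> borel_measurable M"
  shows "integrable M (\<lambda>w. min 1 \<bar>f w\<bar>)"
  by (rule integrable_const_bound[where B = 1]) auto

lemma prob_size_nonneg: "0 \<le> prob_size f"
  unfolding prob_size_def by (rule integral_nonneg_AE) auto

lemma prob_size_const: "prob_size (\<lambda>_. c) = min 1 \<bar>c\<bar>"
  by (simp add: prob_size_def prob_space)

lemma prob_size_triangle:
  assumes [measurable]: "f \<in> borel_measurable M" "g \<in> borel_measurable M" "h \<in> borel_measurable M"
    and "AE w in M. \<bar>f w\<bar> \<le> \<bar>g w\<bar> + \<bar>h w\<bar>"
  shows "prob_size f \<le> prob_size g + prob_size h"
proof -
  have "prob_size f \<le> (\<integral>w. min 1 \<bar>g w\<bar> + min 1 \<bar>h w\<bar> \<partial>M)"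
    unfolding prob_size_def
  proof (rule integral_mono_AE)
    show "AE w in M. min 1 \<bar>f w\<bar> \<le> min 1 \<bar>g w\<bar> + min 1 \<bar>h w\<bar>"
      using assms(4) by eventually_elim auto
  qed (auto intro!: integrable_prob_size Bochner_Integration.integrable_add)
  also have "\<dots> = prob_size g + prob_size h"
    unfolding prob_size_def
    by (rule Bochner_Integration.integral_add) (auto intro: integrable_prob_size)
  finally show ?thesis .
qed

lemma prob_size_eq_0D:
  assumes [measurable]: "f \<in> borel_measurable M" and "prob_size f = 0"
  shows "AE w in M. f w = 0"
proof -
  have "AE w in M. min 1 \<bar>f w\<bar> = 0"
    using assms(2) integral_nonneg_eq_0_iff_AE[OF integrable_prob_size[OF assms(1)]]
    by (simp add: prob_size_def)
  then show ?thesis by eventually_elim (auto simp: min_def split: if_splits)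
qed

lemma prob_size_le_tail:
  assumes [measurable]: "f \<in> borel_measurable M" and "e \<ge> 0"
  shows "prob_size f \<le> e + prob {w \<in> space M. e \<le> \<bar>f w\<bar>}"
proof -
  let ?B = "{w \<in> space M. e \<le> \<bar>f w\<bar>}"
  have i: "integrable M (\<lambda>w. indicator ?B w :: real)"
    by (rule integrable_const_bound[where B = 1]) auto
  have "prob_size f \<le> (\<integral>w. e + indicator ?B w \<partial>M)"
    unfolding prob_size_def using assms(2) i
    by (intro integral_mono_AE integrable_prob_size Bochner_Integration.integrable_add)
      (auto simp: indicator_def)
  also have "\<dots> = e + prob ?B"
    using i by (subst Bochner_Integration.integral_add) (auto simp: prob_space)
  finally show ?thesis .
qed

text \<open>Markov's inequality for the truncated variable; \<open>e \<le> 1\<close> keeps the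
  threshold below the truncation level.\<close>

lemma prob_size_markov:
  assumes [measurable]: "f \<in> borel_measurable M" and "0 < e" "e \<le> 1"
  shows "e * prob {w \<in> space M. e \<le> \<bar>f w\<bar>} \<le> prob_size f"
proof -
  let ?B = "{w \<in> space M. e \<le> \<bar>f w\<bar>}"
  have i: "integrable M (\<lambda>w. e * indicator ?B w :: real)"
    by (rule integrable_const_bound[where B = e]) (use assms(2) in \<open>auto simp: indicator_def\<close>)
  have "(\<integral>w. e * indicator ?B w \<partial>M) \<le> prob_size f"
    unfolding prob_size_def using assms(2,3) i
    by (intro integral_mono_AE integrable_prob_size) (auto simp: indicator_def)
  then show ?thesis by simp
qed

text \<open>The events {n < |f|} decrease to the empty set because \<open>f\<close> takes finite
  values. The form \<open>K \<ge> 1\<close> allows \<open>K\<close> to be pulled out of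
  \<open>min 1\<close> in the next lemma.\<close>

lemma prob_tail_small:
  fixes f :: "'a \<Rightarrow> real"
  assumes [measurable]: "f \<in> borel_measurable M" and "0 < e"
  shows "\<exists>K\<ge>1. prob {w \<in> space M. K < \<bar>f w\<bar>} < e"
proof -
  let ?B = "\<lambda>n::nat. {w \<in> space M. real n < \<bar>f w\<bar>}"
  have "(\<lambda>n. prob (?B n)) \<longlonglongrightarrow> prob (\<Inter>n. ?B n)"
    by (rule finite_Lim_measure_decseq) (auto simp: decseq_def)
  moreover have "(\<Inter>n. ?B n) = {}"
  proof -
    have "\<exists>n. \<not> real n < \<bar>f w\<bar>" for w using real_arch_simple[of "\<bar>f w\<bar>"] by (auto simp: not_less)
    then show ?thesis by auto
  qed
  ultimately have "(\<lambda>n. prob (?B n)) \<longlonglongrightarrow> 0" by simp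
  then have "\<forall>\<^sub>F n in sequentially. prob (?B n) < e" using assms(2) by (rule order_tendstoD)
  then have "\<forall>\<^sub>F n in sequentially. prob (?B n) < e \<and> 1 \<le> n"
    using eventually_ge_at_top by (rule eventually_conj)
  then obtain n where "prob (?B n) < e" "1 \<le> n"
    using eventually_happens'[OF sequentially_bot] by blast
  then show ?thesis by (intro exI[of _ "real n"]) auto
qed

text \<open>The factor \<open>h\<close> is unbounded, but at most \<open>K\<close> outside an event
  of small probability. There the truncated size grows at most \<open>K\<close>-fold, and on the
  event itself the truncation costs no more than its probability. This makes multiplication by
  random variables continuous.\<close>

lemma prob_size_tendsto_dominated:
  assumes f: "\<And>n. f n \<in> borel_measurable M" and a: "\<And>n. a n \<in> borel_measurable M"
    and h: "h \<in> borel_measurable M"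
    and lim: "((\<lambda>n. prob_size (a n)) \<longlongrightarrow> 0) F"
    and dom: "\<forall>\<^sub>F n in F. AE w in M. \<bar>f n w\<bar> \<le> \<bar>h w\<bar> * \<bar>a n w\<bar>"
  shows "((\<lambda>n. prob_size (f n)) \<longlongrightarrow> 0) F"
proof (rule tendstoI)
  note [measurable] = f a h
  fix e :: real assume e: "e > 0"
  obtain K where K: "K \<ge> 1" "prob {w \<in> space M. K < \<bar>h w\<bar>} < e / 2"
    using prob_tail_small[OF h, of "e / 2"] e by auto
  let ?B = "{w \<in> space M. K < \<bar>h w\<bar>}"
  have i: "integrable M (\<lambda>w. indicator ?B w :: real)"
    by (rule integrable_const_bound[where B = 1]) auto
  have le: "prob_size (f n) \<le> K * prob_size (a n) + prob ?B"
    if "AE w in M. \<bar>f n w\<bar> \<le> \<bar>h w\<bar> * \<bar>a n w\<bar>" for n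
  proof -
    have "prob_size (f n) \<le> (\<integral>w. K * min 1 \<bar>a n w\<bar> + indicator ?B w \<partial>M)"
      unfolding prob_size_def
    proof (rule integral_mono_AE)
      show "AE w in M. min 1 \<bar>f n w\<bar> \<le> K * min 1 \<bar>a n w\<bar> + indicator ?B w"
        using that AE_space
      proof eventually_elim
        case (elim w)
        show ?case
        proof (cases "K < \<bar>h w\<bar>")
          case True
          then have "indicator ?B w = (1 :: real)" using elim(2) by simp
          moreover have "0 \<le> K * min 1 \<bar>a n w\<bar>" using K(1) by simp
          ultimately show ?thesis by linarith
        next
          case False
          then have "\<bar>f n w\<bar> \<le> K * \<bar>a n w\<bar>"
            using elim(1) mult_right_mono[of "\<bar>h w\<bar>" K "\<bar>a n w\<bar>"] by simp
          then have "min 1 \<bar>f n w\<bar> \<le> K * min 1 \<bar>a n w\<bar>" using K(1) by (auto simp: min_def)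
          then show ?thesis by (simp add: indicator_def)
        qed
      qed
    qed (auto intro!: integrable_prob_size Bochner_Integration.integrable_add i)
    also have "\<dots> = K * prob_size (a n) + prob ?B"
      unfolding prob_size_def using i
      by (subst Bochner_Integration.integral_add) (auto intro!: integrable_prob_size)
    finally show ?thesis .
  qed
  have "\<forall>\<^sub>F n in F. prob_size (a n) < e / (2 * K)"
    using order_tendstoD(2)[OF lim, of "e / (2 * K)"] e K(1) by simp
  then show "\<forall>\<^sub>F n in F. dist (prob_size (f n)) 0 < e"
    using dom
  proof eventually_elim
    case (elim n)
    have "K * prob_size (a n) < e / 2" using elim(1) K(1) by (simp add: field_simps)
    then show ?case using le[OF elim(2)] K(2) prob_size_nonneg[of "f n"] by simp
  qed
qed

lemma prob_size_tendsto_AE: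
  assumes [measurable]: "\<And>n. f n \<in> borel_measurable M" and lim: "AE w in M. (\<lambda>n. f n w) \<longlonglongrightarrow> 0"
  shows "(\<lambda>n. prob_size (f n)) \<longlonglongrightarrow> 0"
proof -
  have "(\<lambda>n. \<integral>w. min 1 \<bar>f n w\<bar> \<partial>M) \<longlonglongrightarrow> (\<integral>w. 0 \<partial>M)"
  proof (rule integral_dominated_convergence[where w = "\<lambda>_. 1"])
    show "AE w in M. (\<lambda>n. min 1 \<bar>f n w\<bar>) \<longlonglongrightarrow> 0"
      using lim
    proof eventually_elim
      case (elim w)
      from tendsto_min[OF tendsto_const tendsto_rabs[OF elim], of 1] show ?case by simp
    qed
  qed auto
  then show ?thesis by (simp add: prob_size_def)
qed

text \<open>The positive part of \<open>y - b * l\<close> is dominated by the errors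
  \<open>z n\<close> and \<open>b * (r n - l)\<close>. Both tend to 0 in probability, while the
  positive part does not depend on \<open>n\<close>, so it vanishes.\<close>

lemma AE_le_of_prob_limit:
  assumes F: "F \<noteq> bot"
    and [measurable]: "y \<in> borel_measurable M" "b \<in> borel_measurable M" "\<And>n. x n \<in> borel_measurable M"
      "\<And>n. z n \<in> borel_measurable M"
    and y: "\<And>n. AE w in M. y w \<le> x n w + z n w"
    and x: "\<forall>\<^sub>F n in F. AE w in M. x n w \<le> b w * r n" and r: "(r \<longlongrightarrow> l) F"
    and z: "((\<lambda>n. prob_size (z n)) \<longlongrightarrow> 0) F"
  shows "AE w in M. y w \<le> b w * l"
proof -
  let ?p = "\<lambda>w. max 0 (y w - b w * l)"
  have "((\<lambda>n. min 1 \<bar>r n - l\<bar>) \<longlongrightarrow> 0) F"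
    using tendsto_min[OF tendsto_const tendsto_rabs[OF LIM_zero[OF r]], of 1] by simp
  then have "((\<lambda>n. prob_size (\<lambda>w. b w * (r n - l))) \<longlongrightarrow> 0) F"
    by (rule prob_size_tendsto_dominated[where a = "\<lambda>n _. r n - l" and h = b,
          unfolded prob_size_const, rotated 3])
      (auto simp: abs_mult)
  from tendsto_add[OF z this]
  have sum0: "((\<lambda>n. prob_size (z n) + prob_size (\<lambda>w. b w * (r n - l))) \<longlongrightarrow> 0) F" by simp
  have "\<forall>\<^sub>F n in F. prob_size ?p \<le> prob_size (z n) + prob_size (\<lambda>w. b w * (r n - l))"
    using x
  proof eventually_elim
    case (elim n)
    have "AE w in M. \<bar>?p w\<bar> \<le> \<bar>z n w\<bar> + \<bar>b w * (r n - l)\<bar>"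
      using elim y[of n]
    proof eventually_elim
      case (elim w)
      then have "y w - b w * l \<le> z n w + b w * (r n - l)" by (simp add: algebra_simps)
      then show ?case by linarith
    qed
    then show ?case by (intro prob_size_triangle) auto
  qed
  then have "prob_size ?p \<le> 0" by (intro tendsto_lowerbound[OF sum0 _ F])
  then have "prob_size ?p = 0" using prob_size_nonneg[of ?p] by simp
  then have "AE w in M. ?p w = 0" by (intro prob_size_eq_0D) auto
  then show ?thesis by eventually_elim (auto simp: max_def split: if_splits)
qed

end

section \<open>Random normed modules\<close>

context random_normed_module
begin

abbreviation tends :: "('i \<Rightarrow> 's) \<Rightarrow> 's \<Rightarrow> 'i filter \<Rightarrow> bool" where
  "tends \<equiv> limitin (el_topology M nrm)"

lemma smul_zero_right: "f \<in> borel_measurable M \<Longrightarrow> smul f 0 = 0"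
  using smul_add_right[of f 0 0] by simp

lemma smul_minus_right: "f \<in> borel_measurable M \<Longrightarrow> smul f (- x) = - smul f x"
  using smul_add_right[of f x "- x"] smul_zero_right[of f] by (simp add: eq_neg_iff_add_eq_0 add.commute)

lemma smul_diff_right: "f \<in> borel_measurable M \<Longrightarrow> smul f (x - y) = smul f x - smul f y"
  using smul_add_right[of f x "- y"] smul_minus_right[of f y] by simp

lemma smul_minus_left: "f \<in> borel_measurable M \<Longrightarrow> smul (\<lambda>w. - f w) x = - smul f x"
  using smul_add_left[of f "\<lambda>w. - f w" x] by (simp add: smul_zero eq_neg_iff_add_eq_0 add.commute)

lemma smul_diff_left:
  "f \<in> borel_measurable M \<Longrightarrow> g \<in> borel_measurable M \<Longrightarrow> smul (\<lambda>w. f w - g w) x = smul f x - smul g x"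
  using smul_add_left[of f "\<lambda>w. - g w" x] smul_minus_left[of g x] by simp

lemma smul_commute:
  "f \<in> borel_measurable M \<Longrightarrow> g \<in> borel_measurable M \<Longrightarrow> smul f (smul g x) = smul g (smul f x)"
  using smul_smul[of f g x] smul_smul[of g f x] by (simp add: mult.commute)

lemma smul_sum_left:
  assumes "finite I" "\<And>i. i \<in> I \<Longrightarrow> f i \<in> borel_measurable M"
  shows "smul (\<lambda>w. \<Sum>i\<in>I. f i w) x = (\<Sum>i\<in>I. smul (f i) x)"
  using assms by (induction I rule: finite_induct) (auto simp: smul_zero smul_add_left)

lemma nrm_minus: "AE w in M. nrm (- x) w = nrm x w"
  using nrm_smul[of "\<lambda>_. -1" x] smul_minus_left[of "\<lambda>_. 1" x] by (simp add: smul_one)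

lemma nrm_diff_triangle: "AE w in M. nrm (x - y) w \<le> nrm x w + nrm y w"
  using nrm_triangle[of x "- y"] nrm_minus[of y] by eventually_elim simp

lemma nrm_le_diff: "AE w in M. nrm x w \<le> nrm y w + nrm (x - y) w"
  using nrm_triangle[of y "x - y"] by simp

lemma nrm_diff_commute: "AE w in M. nrm (x - y) w = nrm (y - x) w"
  using nrm_minus[of "x - y"] by eventually_elim simp

lemma nrm_sum:
  assumes "finite I"
  shows "AE w in M. nrm (\<Sum>i\<in>I. f i) w \<le> (\<Sum>i\<in>I. nrm (f i) w)"
  using assms
proof (induction I rule: finite_induct)
  case empty
  then show ?case using nrm_zero by (auto elim: eventually_mono)
next
  case (insert i I)
  then show ?case using nrm_triangle[of "f i" "\<Sum>i\<in>I. f i"] by (auto elim!: eventually_elim2)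
qed

lemma eq_0_of_prob_size: "prob_size (nrm x) = 0 \<Longrightarrow> x = 0"
  using prob_size_eq_0D[of "nrm x"] by (intro nrm_zeroD) auto

lemma prob_size_nrm_add: "prob_size (nrm (x + y)) \<le> prob_size (nrm x) + prob_size (nrm y)"
  by (rule prob_size_triangle)
    (use nrm_triangle[of x y] nrm_nonneg[of "x + y"] nrm_nonneg[of x] nrm_nonneg[of y] in auto)

lemma prob_size_nrm_diff: "prob_size (nrm (x - y)) \<le> prob_size (nrm x) + prob_size (nrm y)"
  by (rule prob_size_triangle)
    (use nrm_diff_triangle[of x y] nrm_nonneg[of "x - y"] nrm_nonneg[of x] nrm_nonneg[of y] in auto)

lemma mem_el_nbhd:
  "z \<in> el_nbhd M nrm \<epsilon> \<mu> \<longleftrightarrow> prob {w \<in> space M. \<epsilon> \<le> \<bar>nrm z w\<bar>} < \<mu>"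
proof -
  have "prob {w \<in> space M. \<epsilon> \<le> \<bar>nrm z w\<bar>} = prob {w \<in> space M. \<not> nrm z w < \<epsilon>}"
    using nrm_nonneg[of z] by (intro measure_eq_AE) auto
  also have "\<dots> = 1 - prob {w \<in> space M. nrm z w < \<epsilon>}"
    by (rule prob_neg) auto
  finally show ?thesis by (auto simp: el_nbhd_def)
qed

text \<open>The bridge from the neighbourhoods with two parameters to a limit of real numbers, on
  which all later convergence arguments rely.\<close>

lemma tends_iff: "tends f l F \<longleftrightarrow> ((\<lambda>n. prob_size (nrm (f n - l))) \<longlongrightarrow> 0) F"
proof
  assume L: "tends f l F"
  show "((\<lambda>n. prob_size (nrm (f n - l))) \<longlongrightarrow> 0) F"
  proof (rule tendstoI)
    fix e :: real assume e: "e > 0"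
    let ?e = "min (e / 2) (1 / 2)"
    have "?e > 0" "?e \<in> {0<..<1}" using e by auto
    then have "\<forall>\<^sub>F n in F. f n - l \<in> el_nbhd M nrm ?e ?e"
      using L unfolding limitin_el by blast
    then show "\<forall>\<^sub>F n in F. dist (prob_size (nrm (f n - l))) 0 < e"
    proof eventually_elim
      case (elim n)
      have "prob_size (nrm (f n - l)) \<le> ?e + prob {w \<in> space M. ?e \<le> \<bar>nrm (f n - l) w\<bar>}"
        using e by (intro prob_size_le_tail) auto
      also have "\<dots> < e" using elim unfolding mem_el_nbhd by auto
      finally show ?case using prob_size_nonneg[of "nrm (f n - l)"] by simp
    qed
  qed
next
  assume R: "((\<lambda>n. prob_size (nrm (f n - l))) \<longlongrightarrow> 0) F"
  show "tends f l F"
    unfolding limitin_el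
  proof (intro allI impI ballI)
    fix e m :: real assume e: "e > 0" and m: "m \<in> {0<..<1}"
    \<comment> \<open>Capped at 1, as \<open>prob_size_markov\<close> requires; a smaller threshold
      only enlarges the tail event.\<close>
    let ?e = "min e 1"
    have "\<forall>\<^sub>F n in F. prob_size (nrm (f n - l)) < ?e * m"
      using order_tendstoD(2)[OF R, of "?e * m"] e m by auto
    then show "\<forall>\<^sub>F n in F. f n - l \<in> el_nbhd M nrm e m"
    proof eventually_elim
      case (elim n)
      have "?e * prob {w \<in> space M. ?e \<le> \<bar>nrm (f n - l) w\<bar>} \<le> prob_size (nrm (f n - l))"
        using e by (intro prob_size_markov) auto
      also have "\<dots> < ?e * m" by (rule elim)
      finally have "prob {w \<in> space M. ?e \<le> \<bar>nrm (f n - l) w\<bar>} < m"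
        using e by (simp add: mult_less_cancel_left_pos)
      moreover have "prob {w \<in> space M. e \<le> \<bar>nrm (f n - l) w\<bar>}
          \<le> prob {w \<in> space M. ?e \<le> \<bar>nrm (f n - l) w\<bar>}"
        by (intro finite_measure_mono) auto
      ultimately show ?case unfolding mem_el_nbhd by linarith
    qed
  qed
qed

lemma tends_dominated:
  assumes "h \<in> borel_measurable M" "\<And>n. a n \<in> borel_measurable M" "((\<lambda>n. prob_size (a n)) \<longlongrightarrow> 0) F"
    and "\<forall>\<^sub>F n in F. AE w in M. nrm (f n - l) w \<le> \<bar>h w\<bar> * \<bar>a n w\<bar>"
  shows "tends f l F"
  unfolding tends_iff
proof (rule prob_size_tendsto_dominated[OF _ assms(2,1,3)])
  show "\<forall>\<^sub>F n in F. AE w in M. \<bar>nrm (f n - l) w\<bar> \<le> \<bar>h w\<bar> * \<bar>a n w\<bar>"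
    using assms(4)
  proof eventually_elim
    case (elim n)
    then show ?case using nrm_nonneg[of "f n - l"] by eventually_elim simp
  qed
qed simp

lemma tends_dominated_real:
  assumes "h \<in> borel_measurable M" "(r \<longlongrightarrow> 0) F"
    and "\<forall>\<^sub>F n in F. AE w in M. nrm (f n - l) w \<le> \<bar>h w\<bar> * \<bar>r n\<bar>"
  shows "tends f l F"
proof (rule tends_dominated[OF assms(1) _ _ assms(3)])
  show "((\<lambda>n. prob_size (\<lambda>w. r n)) \<longlongrightarrow> 0) F"
    using tendsto_min[OF tendsto_const tendsto_rabs[OF assms(2)], of 1] by (simp add: prob_size_const)
qed simp

lemma tends_unique:
  assumes "tends f l F" "tends f l' F" "F \<noteq> bot"
  shows "l = l'"
proof -
  have "((\<lambda>n. prob_size (nrm (f n - l')) + prob_size (nrm (f n - l))) \<longlongrightarrow> 0) F"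
    using tendsto_add[OF assms(2,1)[unfolded tends_iff]] by simp
  moreover have "prob_size (nrm (l - l')) \<le> prob_size (nrm (f n - l')) + prob_size (nrm (f n - l))" for n
    using prob_size_nrm_diff[of "f n - l'" "f n - l"] by simp
  ultimately have "prob_size (nrm (l - l')) \<le> 0"
    by (intro tendsto_lowerbound[OF _ _ assms(3)]) auto
  then have "l - l' = 0"
    using prob_size_nonneg[of "nrm (l - l')"] by (intro eq_0_of_prob_size) simp
  then show ?thesis by simp
qed

lemma tends_const: "tends (\<lambda>_. l) l F"
  using limitin_const_iff by (simp add: limitin_def topspace_el)

lemma tends_squeeze:
  assumes "((\<lambda>n. r n) \<longlongrightarrow> (0::real)) F" "\<forall>\<^sub>F n in F. prob_size (nrm (f n - l)) \<le> r n"
  shows "tends f l F"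
  unfolding tends_iff
  by (rule tendsto_sandwich[OF _ assms(2) tendsto_const assms(1)]) (simp add: prob_size_nonneg)

lemma tends_add:
  assumes "tends f l F" "tends g l' F"
  shows "tends (\<lambda>n. f n + g n) (l + l') F"
proof (rule tends_squeeze)
  show "((\<lambda>n. prob_size (nrm (f n - l)) + prob_size (nrm (g n - l'))) \<longlongrightarrow> 0) F"
    using tendsto_add[OF assms[unfolded tends_iff]] by simp
  show "\<forall>\<^sub>F n in F. prob_size (nrm (f n + g n - (l + l')))
      \<le> prob_size (nrm (f n - l)) + prob_size (nrm (g n - l'))"
    using prob_size_nrm_add[of "f n - l" "g n - l'" for n] by (simp add: algebra_simps)
qed

lemma tends_cong:
  assumes "\<forall>\<^sub>F n in F. f n = g n"
  shows "tends f l F \<longleftrightarrow> tends g l F"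
  unfolding tends_iff by (rule tendsto_cong) (use assms in eventually_elim, simp)

lemma tends_compose:
  assumes "tends f l F" "filterlim h F G"
  shows "tends (\<lambda>n. f (h n)) l G"
  using assms(1) unfolding tends_iff by (rule filterlim_compose) (rule assms(2))

lemma limit_nrm_le:
  assumes "tends x y F" "F \<noteq> bot" "b \<in> borel_measurable M" "(r \<longlongrightarrow> l) F"
    and "\<forall>\<^sub>F n in F. AE w in M. nrm (x n) w \<le> b w * r n"
  shows "AE w in M. nrm y w \<le> b w * l"
proof (rule AE_le_of_prob_limit[OF assms(2) _ assms(3) _ _ _ assms(5,4)])
  show "((\<lambda>n. prob_size (nrm (x n - y))) \<longlongrightarrow> 0) F" using assms(1) by (simp add: tends_iff)
  show "AE w in M. nrm y w \<le> nrm (x n) w + nrm (x n - y) w" for n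
    using nrm_le_diff[of y "x n"] nrm_diff_commute[of y "x n"] by eventually_elim simp
qed auto

section \<open>Almost surely bounded operators and their linearity over random scalars\<close>

abbreviation bops :: "('s \<Rightarrow> 's) set" where "bops \<equiv> bounded_ops M smul nrm"

lemma bopsI:
  assumes "\<And>x y. T (x + y) = T x + T y" "\<And>c x. T (smul (\<lambda>w. c) x) = smul (\<lambda>w. c) (T x)"
    and "h \<in> borel_measurable M" "\<And>x. AE w in M. nrm (T x) w \<le> h w * nrm x w"
  shows "T \<in> bops"
proof -
  have "AE w in M. nrm (T x) w \<le> \<bar>h w\<bar> * nrm x w" for x
    using assms(4)[of x] nrm_nonneg[of x]
    by eventually_elim (meson abs_ge_self mult_right_mono order_trans)
  then have "(\<lambda>w. \<bar>h w\<bar>) \<in> as_bounds M nrm T"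
    using assms(3) by (auto simp: as_bounds_def L0_pos_def)
  then show ?thesis using assms(1,2) by (auto simp: bounded_ops_def)
qed

lemma bops_add: "T \<in> bops \<Longrightarrow> T (x + y) = T x + T y"
  by (simp add: bounded_ops_def)

lemma bops_const: "T \<in> bops \<Longrightarrow> T (smul (\<lambda>w. c) x) = smul (\<lambda>w. c) (T x)"
  by (simp add: bounded_ops_def)

lemma bops_zero: "T \<in> bops \<Longrightarrow> T 0 = 0"
  using bops_add[of T 0 0] by simp

lemma bops_diff: "T \<in> bops \<Longrightarrow> T (x - y) = T x - T y"
  using bops_add[of T "x - y" y] by (simp add: algebra_simps)

lemma bops_minus: "T \<in> bops \<Longrightarrow> T (- x) = - T x"
  using bops_diff[of T 0 x] by (simp add: bops_zero)

lemma bops_sum: "T \<in> bops \<Longrightarrow> T (\<Sum>i\<in>I. f i) = (\<Sum>i\<in>I. T (f i))"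
  by (induction I rule: infinite_finite_induct) (auto simp: bops_add bops_zero)

lemma bops_bound:
  assumes "T \<in> bops"
  obtains h where "h \<in> borel_measurable M" "AE w in M. 0 \<le> h w" "\<And>x. AE w in M. nrm (T x) w \<le> h w * nrm x w"
  using assms by (auto simp: bounded_ops_def as_bounds_def L0_pos_def)

lemma bops_tends:
  assumes T: "T \<in> bops" and "tends f l F"
  shows "tends (\<lambda>n. T (f n)) (T l) F"
proof -
  obtain h where h: "h \<in> borel_measurable M" "AE w in M. 0 \<le> h w"
    "\<And>x. AE w in M. nrm (T x) w \<le> h w * nrm x w"
    using bops_bound[OF T] by blast
  show ?thesis
  proof (rule tends_dominated[OF h(1), where a = "\<lambda>n. nrm (f n - l)"])
    show "((\<lambda>n. prob_size (nrm (f n - l))) \<longlongrightarrow> 0) F" using assms(2) by (simp add: tends_iff)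
    have "AE w in M. nrm (T (f n) - T l) w \<le> \<bar>h w\<bar> * \<bar>nrm (f n - l) w\<bar>" for n
      using h(2) h(3)[of "f n - l"] nrm_nonneg[of "f n - l"]
      by eventually_elim (simp add: bops_diff[OF T])
    then show "\<forall>\<^sub>F n in F. AE w in M. nrm (T (f n) - T l) w \<le> \<bar>h w\<bar> * \<bar>nrm (f n - l) w\<bar>" by simp
  qed simp
qed

lemma bops_smul_op:
  assumes f [measurable]: "f \<in> borel_measurable M"
  shows "smul f \<in> bops"
proof (rule bopsI[where h = "\<lambda>w. norm (f w)"])
  show "AE w in M. nrm (smul f x) w \<le> norm (f w) * nrm x w" for x
    using nrm_smul[OF f, of x] by eventually_elim simp
qed (auto simp: smul_add_right f smul_commute)

lemma bops_compose:
  assumes T: "T \<in> bops" and U: "U \<in> bops"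
  shows "(\<lambda>x. T (U x)) \<in> bops"
proof -
  obtain h where h: "h \<in> borel_measurable M" "AE w in M. 0 \<le> h w"
    "\<And>x. AE w in M. nrm (T x) w \<le> h w * nrm x w"
    using bops_bound[OF T] by blast
  obtain k where k: "k \<in> borel_measurable M" "AE w in M. 0 \<le> k w"
    "\<And>x. AE w in M. nrm (U x) w \<le> k w * nrm x w"
    using bops_bound[OF U] by blast
  show ?thesis
  proof (rule bopsI[where h = "\<lambda>w. h w * k w"])
    show "AE w in M. nrm (T (U x)) w \<le> h w * k w * nrm x w" for x
      using h(2) h(3)[of "U x"] k(3)[of x]
    proof eventually_elim
      case (elim w)
      then have "h w * nrm (U x) w \<le> h w * (k w * nrm x w)" by (intro mult_left_mono) auto
      then show ?case using elim(2) by (simp add: mult.assoc)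
    qed
  qed (use h(1) k(1) in \<open>auto simp: bops_add[OF T] bops_add[OF U] bops_const[OF T] bops_const[OF U]\<close>)
qed

lemma smul_tends_left:
  assumes [measurable]: "\<And>n. f n \<in> borel_measurable M" "g \<in> borel_measurable M"
    and "((\<lambda>n. prob_size (\<lambda>w. norm (f n w - g w))) \<longlongrightarrow> 0) F"
  shows "tends (\<lambda>n. smul (f n) x) (smul g x) F"
proof (rule tends_dominated[OF nrm_measurable[of x] _ assms(3)])
  have "AE w in M. nrm (smul (f n) x - smul g x) w \<le> \<bar>nrm x w\<bar> * \<bar>norm (f n w - g w)\<bar>" for n
    using nrm_smul[of "\<lambda>w. f n w - g w" x] nrm_nonneg[of x]
    by (auto simp: smul_diff_left mult.commute elim: eventually_elim2)
  then show "\<forall>\<^sub>F n in F. AE w in M. nrm (smul (f n) x - smul g x) w \<le> \<bar>nrm x w\<bar> * \<bar>norm (f n w - g w)\<bar>"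
    by simp
qed simp

text \<open>Boundedness makes \<open>T\<close> local: the image of an element supported on
  \<open>B\<close> has norm 0 off \<open>B\<close>. Splitting \<open>x\<close> along
  \<open>B\<close> and its complement then gives the claim. Simple functions and limits follow, so
  that linearity over the constants becomes linearity over all random scalars.\<close>

lemma bops_smul_indicator:
  assumes T: "T \<in> bops" and B [measurable]: "B \<in> sets M"
  shows "T (smul (indicator B) x) = smul (indicator B) (T x)"
proof -
  have zero: "smul (indicator A) (T (smul (indicator B) x)) = 0"
    if [measurable]: "A \<in> sets M" "B \<in> sets M" and "A \<inter> B = {}" for A B x
  proof (rule nrm_zeroD)
    obtain h where h: "h \<in> borel_measurable M" "AE w in M. 0 \<le> h w"
      "\<And>x. AE w in M. nrm (T x) w \<le> h w * nrm x w"
      using bops_bound[OF T] by blast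
    show "AE w in M. nrm (smul (indicator A) (T (smul (indicator B) x))) w = 0"
      using nrm_smul[of "indicator A" "T (smul (indicator B) x)", simplified]
        h(3)[of "smul (indicator B) x"] nrm_smul[of "indicator B" x, simplified]
        nrm_nonneg[of "T (smul (indicator B) x)"]
    proof eventually_elim
      case (elim w)
      then show ?case using that(3) by (cases "w \<in> A"; cases "w \<in> B") auto
    qed
  qed
  have one: "smul (indicator B) z + smul (indicator (space M - B)) z = z" for z
  proof -
    have "smul (indicator B) z + smul (indicator (space M - B)) z
        = smul (\<lambda>w. indicator B w + indicator (space M - B) w) z"
      by (rule smul_add_left[symmetric]) auto
    also have "\<dots> = smul (\<lambda>w. 1) z"
      by (rule smul_cong) (auto simp: indicator_def)
    finally show ?thesis by (simp add: smul_one)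
  qed
  have "T (smul (indicator B) x) = smul (indicator B) (T (smul (indicator B) x))"
    using one[of "T (smul (indicator B) x)"] zero[of "space M - B" B x]
    by (simp add: Diff_Int_distrib2)
  also have "\<dots> = smul (indicator B) (T (smul (indicator B) x) + T (smul (indicator (space M - B)) x))"
    using zero[of B "space M - B" x] by (simp add: smul_add_right Diff_Int_distrib)
  also have "\<dots> = smul (indicator B) (T x)"
    by (simp add: bops_add[OF T, symmetric] one)
  finally show ?thesis .
qed

lemma bops_smul_simple:
  assumes T: "T \<in> bops" and s: "simple_function M s"
  shows "T (smul s x) = smul s (T x)"
proof -
  let ?g = "\<lambda>y w. y * indicator (s -` {y} \<inter> space M) w"
  have fin: "finite (s ` space M)" using s by (rule simple_functionD(1))
  have sets [measurable]: "s -` {y} \<inter> space M \<in> sets M" for y using s by (rule simple_functionD(2))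
  have sm [measurable]: "s \<in> borel_measurable M" using s by (rule borel_measurable_simple_function)
  have expand: "smul s z = (\<Sum>y\<in>s ` space M. smul (\<lambda>w. y) (smul (indicator (s -` {y} \<inter> space M)) z))" for z
  proof -
    have "smul s z = smul (\<lambda>w. \<Sum>y\<in>s ` space M. ?g y w) z"
    proof (rule smul_cong)
      show "AE w in M. s w = (\<Sum>y\<in>s ` space M. ?g y w)"
      proof (rule AE_I2)
        fix w assume w: "w \<in> space M"
        have "(\<Sum>y\<in>s ` space M. ?g y w) = (\<Sum>y\<in>{s w}. ?g y w)"
          using fin w by (intro sum.mono_neutral_right) (auto simp: indicator_def)
        then show "s w = (\<Sum>y\<in>s ` space M. ?g y w)" using w by simp
      qed
    qed auto
    also have "\<dots> = (\<Sum>y\<in>s ` space M. smul (?g y) z)"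
      using fin by (intro smul_sum_left) auto
    also have "\<dots> = (\<Sum>y\<in>s ` space M. smul (\<lambda>w. y) (smul (indicator (s -` {y} \<inter> space M)) z))"
      by (intro sum.cong refl smul_smul) auto
    finally show ?thesis .
  qed
  show ?thesis
    unfolding expand by (simp add: bops_sum[OF T] bops_const[OF T] bops_smul_indicator[OF T])
qed

text \<open>Simple functions converge to \<open>f\<close> pointwise, hence in probability, and both
  sides are continuous in the scalar.\<close>

lemma bops_smul:
  assumes T: "T \<in> bops" and f [measurable]: "f \<in> borel_measurable M"
  shows "T (smul f x) = smul f (T x)"
proof -
  obtain s where s: "\<And>i. simple_function M (s i)" "\<And>w. w \<in> space M \<Longrightarrow> (\<lambda>i. s i w) \<longlonglongrightarrow> f w"
    using borel_measurable_implies_sequence_metric[OF f, of 0] by blast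
  have [measurable]: "s i \<in> borel_measurable M" for i
    using s(1) by (rule borel_measurable_simple_function)
  have "AE w in M. (\<lambda>i. norm (s i w - f w)) \<longlonglongrightarrow> 0"
    by (rule AE_I2) (rule tendsto_norm_zero, rule LIM_zero, rule s(2))
  then have size: "(\<lambda>i. prob_size (\<lambda>w. norm (s i w - f w))) \<longlonglongrightarrow> 0"
    by (intro prob_size_tendsto_AE) auto
  then have lim: "tends (\<lambda>i. smul (s i) z) (smul f z) sequentially" for z
    by (intro smul_tends_left) auto
  show ?thesis
    using bops_tends[OF T lim[of x]] lim[of "T x"]
    by (intro tends_unique[where F = sequentially]) (auto simp: bops_smul_simple[OF T s(1)])
qed

end

section \<open>Integrals in random normed modules\<close>

context random_normed_module
begin

abbreviation rsc :: "real \<Rightarrow> 's \<Rightarrow> 's" where "rsc r x \<equiv> smul (\<lambda>w. of_real r) x"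

abbreviation ssm :: "('w \<Rightarrow> real) \<Rightarrow> 's \<Rightarrow> 's" where
  "ssm \<eta> x \<equiv> smul (\<lambda>w. of_real (\<eta> w)) x"

abbreviation rint :: "(real \<Rightarrow> 's) \<Rightarrow> 's \<Rightarrow> real \<Rightarrow> real \<Rightarrow> bool" where
  "rint \<equiv> has_riemann_integral M smul nrm"

abbreviation iint :: "(real \<Rightarrow> 's) \<Rightarrow> 's \<Rightarrow> bool" where
  "iint \<equiv> has_improper_integral M smul nrm"

lemma eventually_tagged_division:
  "\<forall>\<^sub>F p in riemann_filter a b. p tagged_division_of {a..b}"
  unfolding eventually_riemann_filter by (intro exI[of _ 1]) auto

lemma rint_unique: "rint f y a b \<Longrightarrow> rint f z a b \<Longrightarrow> y = z"
  unfolding has_riemann_integral_def by (rule tends_unique[OF _ _ riemann_filter_neq_bot])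

lemma rint_cong:
  assumes "\<And>s. s \<in> {a..b} \<Longrightarrow> f s = g s"
  shows "rint f y a b \<longleftrightarrow> rint g y a b"
  unfolding has_riemann_integral_def
proof (rule tends_cong)
  show "\<forall>\<^sub>F p in riemann_filter a b. (\<Sum>(t, J)\<in>p. rsc (measure lborel J) (f t))
      = (\<Sum>(t, J)\<in>p. rsc (measure lborel J) (g t))"
    using eventually_tagged_division
  proof eventually_elim
    case (elim p)
    have "f t = g t" if "(t, J) \<in> p" for t J
      using tagged_division_ofD(2,3)[OF elim that] assms by blast
    then show ?case by (intro sum.cong) auto
  qed
qed

lemma rint_add:
  assumes "rint f y a b" "rint g z a b"
  shows "rint (\<lambda>s. f s + g s) (y + z) a b"
  using tends_add[OF assms[unfolded has_riemann_integral_def]]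
  by (simp add: has_riemann_integral_def split_def smul_add_right sum.distrib)

lemma rint_bops:
  assumes T: "T \<in> bops" and "rint f y a b"
  shows "rint (\<lambda>s. T (f s)) (T y) a b"
  using bops_tends[OF T assms(2)[unfolded has_riemann_integral_def]]
  by (simp add: has_riemann_integral_def split_def bops_sum[OF T] bops_const[OF T])

text \<open>For fixed \<open>w\<close>, the function \<open>nrm (f s) w\<close> of \<open>s\<close>
  depends on representatives chosen separately at uncountably many times. The product form of the
  bound avoids integrating it: each Riemann sum involves finitely many exceptional null sets and is
  bounded by \<open>b w\<close> times a real Riemann sum of \<open>\<psi>\<close>.\<close>

lemma rint_bound:
  assumes "rint f y a c" and b: "b \<in> borel_measurable M" and \<psi>: "continuous_on {a..c} \<psi>"
    and le: "\<And>s. s \<in> {a..c} \<Longrightarrow> AE w in M. nrm (f s) w \<le> b w * \<psi> s"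
  shows "AE w in M. nrm y w \<le> b w * integral {a..c} \<psi>"
proof (rule limit_nrm_le[OF _ riemann_filter_neq_bot b tendsto_riemann_sums[OF \<psi>]])
  show "tends (\<lambda>p. \<Sum>(t, J)\<in>p. rsc (measure lborel J) (f t)) y (riemann_filter a c)"
    using assms(1) by (simp add: has_riemann_integral_def)
  show "\<forall>\<^sub>F p in riemann_filter a c. AE w in M.
      nrm (\<Sum>(t, J)\<in>p. rsc (measure lborel J) (f t)) w
        \<le> b w * (\<Sum>(t, J)\<in>p. measure lborel J *\<^sub>R \<psi> t)"
    using eventually_tagged_division
  proof eventually_elim
    case (elim p)
    have fin: "finite p" using elim by blast
    have "AE w in M. nrm (rsc (measure lborel J) (f t)) w \<le> b w * (measure lborel J * \<psi> t)"
      if "(t, J) \<in> p" for t J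
    proof -
      have t: "t \<in> {a..c}" using tagged_division_ofD(2,3)[OF elim that] by blast
      show ?thesis
        using nrm_smul[of "\<lambda>w. of_real (measure lborel J)" "f t", simplified] le[OF t]
      proof eventually_elim
        case (elim w)
        then show ?case
          using mult_left_mono[OF elim(2), of "measure lborel J"] by (simp add: mult_ac)
      qed
    qed
    then have "AE w in M. \<forall>q\<in>p. nrm (case q of (t, J) \<Rightarrow> rsc (measure lborel J) (f t)) w
        \<le> b w * (case q of (t, J) \<Rightarrow> measure lborel J * \<psi> t)"
      using fin by (subst AE_ball_countable) (auto simp: countable_finite)
    then show ?case
      using nrm_sum[OF fin, of "\<lambda>q. case q of (t, J) \<Rightarrow> rsc (measure lborel J) (f t)"]
    proof eventually_elim
      case (elim w)
      note elim(2)
      also have "(\<Sum>q\<in>p. nrm (case q of (t, J) \<Rightarrow> rsc (measure lborel J) (f t)) w)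
          \<le> (\<Sum>q\<in>p. b w * (case q of (t, J) \<Rightarrow> measure lborel J * \<psi> t))"
        using elim(1) by (intro sum_mono) blast
      finally show ?case by (simp add: sum_distrib_left)
    qed
  qed
qed

lemma iint_unique:
  assumes "iint f y" "iint f z"
  shows "y = z"
proof -
  obtain I where I: "\<And>L. 0 \<le> L \<Longrightarrow> rint f (I L) 0 L" "tends I y at_top"
    using assms(1) by (auto simp: has_improper_integral_def)
  obtain J where J: "\<And>L. 0 \<le> L \<Longrightarrow> rint f (J L) 0 L" "tends J z at_top"
    using assms(2) by (auto simp: has_improper_integral_def)
  have "\<forall>\<^sub>F L in at_top. I L = J L"
    using eventually_ge_at_top[of 0] by eventually_elim (rule rint_unique[OF I(1) J(1)])
  then have "tends J y at_top" using I(2) by (simp add: tends_cong)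
  then show ?thesis using J(2) by (rule tends_unique) simp
qed

lemma iint_cong:
  assumes "\<And>s. 0 \<le> s \<Longrightarrow> f s = g s"
  shows "iint f y \<longleftrightarrow> iint g y"
proof -
  have "rint f z 0 L \<longleftrightarrow> rint g z 0 L" for z L
    by (rule rint_cong) (use assms in auto)
  then show ?thesis by (simp add: has_improper_integral_def)
qed

lemma iint_add:
  assumes "iint f y" "iint g z"
  shows "iint (\<lambda>s. f s + g s) (y + z)"
proof -
  obtain I where I: "\<And>L. 0 \<le> L \<Longrightarrow> rint f (I L) 0 L" "tends I y at_top"
    using assms(1) by (auto simp: has_improper_integral_def)
  obtain J where J: "\<And>L. 0 \<le> L \<Longrightarrow> rint g (J L) 0 L" "tends J z at_top"
    using assms(2) by (auto simp: has_improper_integral_def)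
  show ?thesis
    unfolding has_improper_integral_def
    using rint_add[OF I(1) J(1)] tends_add[OF I(2) J(2)]
    by (intro exI[of _ "\<lambda>L. I L + J L"]) auto
qed

lemma iint_bops:
  assumes T: "T \<in> bops" and "iint f y"
  shows "iint (\<lambda>s. T (f s)) (T y)"
proof -
  obtain I where I: "\<And>L. 0 \<le> L \<Longrightarrow> rint f (I L) 0 L" "tends I y at_top"
    using assms(2) by (auto simp: has_improper_integral_def)
  show ?thesis
    unfolding has_improper_integral_def
    using rint_bops[OF T I(1)] bops_tends[OF T I(2)] by (intro exI[of _ "\<lambda>L. T (I L)"]) auto
qed

lemma bops_uminus: "uminus \<in> bops"
proof (rule bopsI[where h = "\<lambda>_. 1"])
  show "AE w in M. nrm (- x) w \<le> 1 * nrm x w" for x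
    using nrm_minus[of x] by eventually_elim simp
qed (auto simp: smul_minus_right)

lemma iint_diff:
  assumes "iint f y" "iint g z"
  shows "iint (\<lambda>s. f s - g s) (y - z)"
  using iint_add[OF assms(1) iint_bops[OF bops_uminus assms(2)]] by simp

lemma iint_bound:
  assumes "iint f y" and b: "b \<in> borel_measurable M"
    and le: "\<And>s. 0 \<le> s \<Longrightarrow> AE w in M. nrm (f s) w \<le> b w * inverse (1 + s\<^sup>2)"
  shows "AE w in M. nrm y w \<le> b w * (pi / 2)"
proof -
  obtain I where I: "\<And>L. 0 \<le> L \<Longrightarrow> rint f (I L) 0 L" "tends I y at_top"
    using assms(1) by (auto simp: has_improper_integral_def)
  show ?thesis
  proof (rule limit_nrm_le[OF I(2) _ b tendsto_arctan_at_top])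
    show "\<forall>\<^sub>F L in at_top. AE w in M. nrm (I L) w \<le> b w * arctan L"
      using eventually_ge_at_top[of 0]
    proof eventually_elim
      case (elim L)
      show ?case
        using rint_bound[OF I(1)[OF elim] b continuous_on_inverse_one_plus_square le]
        by (simp add: integral_inverse_one_plus_square elim)
    qed
  qed simp
qed

section \<open>Continuous, bounded and decaying paths\<close>

definition el_path :: "(real \<Rightarrow> 's) \<Rightarrow> bool" where
  "el_path f \<longleftrightarrow> (\<forall>s\<ge>0. tends f (f s) (at s within {0..}))"

lemma el_path_continuous_map:
  assumes "continuous_map (top_of_set {0..}) (el_topology M nrm) f"
  shows "el_path f"
  unfolding el_path_def
proof (intro allI impI)
  fix s :: real assume s: "0 \<le> s"
  have "limitin (el_topology M nrm) f (f s) (atin (top_of_set {0..}) s)"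
    using assms s by (simp add: continuous_map_atin)
  moreover have "eventually P (atin (top_of_set {0..}) s) \<longleftrightarrow> eventually P (at s within {0..})" for P
    using s by (auto simp: atin_subtopology_within eventually_atin_within eventually_at_topological)
  then have "atin (top_of_set {0..}) s = at s within {0..}" by (simp add: filter_eq_iff)
  ultimately show "tends f (f s) (at s within {0..})" by simp
qed

lemma el_path_add: "el_path f \<Longrightarrow> el_path g \<Longrightarrow> el_path (\<lambda>s. f s + g s)"
  by (simp add: el_path_def tends_add)

lemma el_path_bops: "T \<in> bops \<Longrightarrow> el_path f \<Longrightarrow> el_path (\<lambda>s. T (f s))"
  by (simp add: el_path_def bops_tends)

lemma el_path_shift:
  assumes f: "el_path f" and "0 \<le> h"
  shows "el_path (\<lambda>s. f (s + h))"
  unfolding el_path_def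
proof (intro allI impI)
  fix s :: real assume "0 \<le> s"
  show "tends (\<lambda>t. f (t + h)) (f (s + h)) (at s within {0..})"
  proof (rule tends_compose[where f = f and h = "\<lambda>t. t + h"])
    show "tends f (f (s + h)) (at (s + h) within {0..})"
      using f \<open>0 \<le> s\<close> \<open>0 \<le> h\<close> by (simp add: el_path_def)
    show "LIM t at s within {0..}. t + h :> at (s + h) within {0..}"
      using \<open>0 \<le> h\<close> by (auto simp: filterlim_at eventually_at_filter intro!: tendsto_eq_intros)
  qed
qed

lemma exp_diff_bound:
  fixes a b :: real
  shows "\<bar>exp a - exp b\<bar> \<le> \<bar>a - b\<bar> * exp (max a b)"
proof -
  have *: "exp b - exp a \<le> (b - a) * exp b" for a b :: real
  proof -
    have "(1 + (a - b)) * exp b \<le> exp (a - b) * exp b"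
      by (intro mult_right_mono exp_ge_add_one_self) simp
    then show ?thesis by (simp add: exp_diff algebra_simps)
  qed
  show ?thesis
  proof (cases "a \<le> b")
    case True
    then show ?thesis using *[of b a] by (simp add: abs_if max_def)
  next
    case False
    then show ?thesis using *[of a b] by (simp add: abs_if max_def)
  qed
qed

lemma measurable_exp_scale [measurable]:
  fixes s :: real
  assumes [measurable]: "\<eta> \<in> borel_measurable M"
  shows "(\<lambda>w. of_real (exp (- \<eta> w * s)) :: 'k) \<in> borel_measurable M"
  by measurable

lemma nrm_smul_exp:
  assumes "\<eta> \<in> borel_measurable M"
  shows "AE w in M. nrm (ssm (\<lambda>w. exp (- \<eta> w * s)) x) w = exp (- \<eta> w * s) * nrm x w"
  using nrm_smul[OF measurable_exp_scale[OF assms], of s x] by simp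

text \<open>Split into exp (- \<eta> r_i) (f_i - l) and (exp (- \<eta> r_i) - exp (- \<eta> a)) l.
  Once |r_i| is at most |a| + 1, the random variable \<open>?h\<close> bounds all exponentials
  involved, so dominated convergence in probability applies to both parts.\<close>

lemma tends_smul_exp:
  fixes r :: "'i \<Rightarrow> real"
  assumes f: "tends f l F" and r: "(r \<longlongrightarrow> a) F" and [measurable]: "\<eta> \<in> borel_measurable M"
  shows "tends (\<lambda>i. ssm (\<lambda>w. exp (- \<eta> w * r i)) (f i)) (ssm (\<lambda>w. exp (- \<eta> w * a)) l) F"
proof -
  let ?e = "\<lambda>t w. of_real (exp (- \<eta> w * t)) :: 'k"
  let ?h = "\<lambda>w. exp (\<bar>\<eta> w\<bar> * (\<bar>a\<bar> + 1))"
  have near: "\<forall>\<^sub>F i in F. \<bar>r i\<bar> \<le> \<bar>a\<bar> + 1"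
    using tendstoD[OF r zero_less_one] by eventually_elim (auto simp: dist_real_def)
  have le: "exp (- \<eta> w * t) \<le> ?h w" if "\<bar>t\<bar> \<le> \<bar>a\<bar> + 1" for t w
  proof -
    have "- \<eta> w * t \<le> \<bar>\<eta> w * t\<bar>" by simp
    also have "\<dots> \<le> \<bar>\<eta> w\<bar> * (\<bar>a\<bar> + 1)" unfolding abs_mult using that by (intro mult_left_mono) auto
    finally show ?thesis by simp
  qed
  have 1: "tends (\<lambda>i. smul (?e (r i)) (f i - l)) 0 F"
  proof (rule tends_dominated[where h = ?h and a = "\<lambda>i. nrm (f i - l)"])
    show "((\<lambda>i. prob_size (nrm (f i - l))) \<longlongrightarrow> 0) F" using f by (simp add: tends_iff)
    show "\<forall>\<^sub>F i in F. AE w in M. nrm (smul (?e (r i)) (f i - l) - 0) w \<le> \<bar>?h w\<bar> * \<bar>nrm (f i - l) w\<bar>"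
      using near
    proof eventually_elim
      case (elim i)
      show ?case
        using nrm_smul_exp[OF assms(3), of "r i" "f i - l"] nrm_nonneg[of "f i - l"]
        by eventually_elim (use le[OF elim] in \<open>auto intro!: mult_right_mono\<close>)
    qed
  qed auto
  have 2: "tends (\<lambda>i. smul (?e (r i)) l) (smul (?e a) l) F"
  proof (rule tends_dominated_real[where h = "\<lambda>w. \<bar>\<eta> w\<bar> * ?h w * nrm l w" and r = "\<lambda>i. r i - a"])
    show "((\<lambda>i. r i - a) \<longlongrightarrow> 0) F" using r by (rule LIM_zero)
    show "\<forall>\<^sub>F i in F. AE w in M.
        nrm (smul (?e (r i)) l - smul (?e a) l) w \<le> \<bar>\<bar>\<eta> w\<bar> * ?h w * nrm l w\<bar> * \<bar>r i - a\<bar>"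
      using near
    proof eventually_elim
      case (elim i)
      let ?d = "\<lambda>w. exp (- \<eta> w * r i) - exp (- \<eta> w * a)"
      have "smul (?e (r i)) l - smul (?e a) l = smul (\<lambda>w. of_real (?d w)) l"
        using smul_diff_left[of "?e (r i)" "?e a" l] by simp
      moreover have "AE w in M. nrm (smul (\<lambda>w. of_real (?d w) :: 'k) l) w = \<bar>?d w\<bar> * nrm l w"
        using nrm_smul[of "\<lambda>w. of_real (?d w)" l] by (simp add: norm_of_real del: of_real_diff)
      ultimately have "AE w in M. nrm (smul (?e (r i)) l - smul (?e a) l) w = \<bar>?d w\<bar> * nrm l w"
        by simp
      then show ?case
        using nrm_nonneg[of l]
      proof eventually_elim
        case (elim w)
        have "exp (max (- \<eta> w * r i) (- \<eta> w * a)) \<le> ?h w"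
          using le[of "r i" w] le[of a w] \<open>\<bar>r i\<bar> \<le> \<bar>a\<bar> + 1\<close> by (simp add: max_def)
        then have "\<bar>?d w\<bar> \<le> \<bar>- \<eta> w * r i - - \<eta> w * a\<bar> * ?h w"
          by (intro order_trans[OF exp_diff_bound] mult_left_mono) auto
        also have "\<bar>- \<eta> w * r i - - \<eta> w * a\<bar> = \<bar>\<eta> w\<bar> * \<bar>r i - a\<bar>"
          by (simp add: abs_mult[symmetric] algebra_simps abs_minus_commute)
        finally have "\<bar>?d w\<bar> * nrm l w \<le> (\<bar>\<eta> w\<bar> * \<bar>r i - a\<bar> * ?h w) * nrm l w"
          using elim(2) by (rule mult_right_mono)
        then show ?case using elim by (simp add: abs_mult mult_ac)
      qed
    qed
  qed auto
  show ?thesis using tends_add[OF 1 2] by (simp add: smul_diff_right)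
qed

lemma el_path_smul_exp:
  assumes "el_path f" "\<eta> \<in> borel_measurable M"
  shows "el_path (\<lambda>s. ssm (\<lambda>w. exp (- \<eta> w * s)) (f s))"
  unfolding el_path_def
  by (intro allI impI tends_smul_exp tendsto_ident_at) (use assms in \<open>auto simp: el_path_def\<close>)

text \<open>
  For a bounded path the dominating random variable does not depend on time; for a decaying path
  the decay is that of an integrable function of time only, so that random decay rates must be
  absorbed in the dominating random variable.
\<close>

definition bounded_path :: "(real \<Rightarrow> 's) \<Rightarrow> bool" where
  "bounded_path f \<longleftrightarrow> el_path f \<and>
     (\<exists>b\<in>borel_measurable M. \<forall>s\<ge>0. AE w in M. nrm (f s) w \<le> b w)"

definition decaying_path :: "(real \<Rightarrow> 's) \<Rightarrow> bool" where
  "decaying_path f \<longleftrightarrow> el_path f \<and>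
     (\<exists>b\<in>borel_measurable M. \<forall>s\<ge>0. AE w in M. nrm (f s) w \<le> b w * inverse (1 + s\<^sup>2))"

lemma inverse_one_plus_square_le_1: "inverse (1 + s\<^sup>2) \<le> (1::real)"
  by (intro inverse_le_1_iff[THEN iffD2]) auto

lemma decaying_imp_bounded_path:
  assumes "decaying_path f"
  shows "bounded_path f"
proof -
  obtain b where b: "b \<in> borel_measurable M"
    "\<And>s. 0 \<le> s \<Longrightarrow> AE w in M. nrm (f s) w \<le> b w * inverse (1 + s\<^sup>2)"
    using assms by (auto simp: decaying_path_def)
  have "AE w in M. nrm (f s) w \<le> \<bar>b w\<bar>" if "0 \<le> s" for s
    using b(2)[OF that]
  proof eventually_elim
    case (elim w)
    have "b w * inverse (1 + s\<^sup>2) \<le> \<bar>b w\<bar> * inverse (1 + s\<^sup>2)"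
      by (intro mult_right_mono) auto
    also have "\<dots> \<le> \<bar>b w\<bar> * 1"
      using inverse_one_plus_square_le_1 by (intro mult_left_mono) auto
    finally show ?case using elim by simp
  qed
  then show ?thesis using b(1) assms
    by (auto simp: bounded_path_def decaying_path_def intro!: bexI[of _ "\<lambda>w. \<bar>b w\<bar>"])
qed

lemma bounded_path_add:
  assumes "bounded_path f" "bounded_path g"
  shows "bounded_path (\<lambda>s. f s + g s)"
proof -
  obtain a where a: "a \<in> borel_measurable M" "\<And>s. 0 \<le> s \<Longrightarrow> AE w in M. nrm (f s) w \<le> a w"
    using assms(1) by (auto simp: bounded_path_def)
  obtain b where b: "b \<in> borel_measurable M" "\<And>s. 0 \<le> s \<Longrightarrow> AE w in M. nrm (g s) w \<le> b w"
    using assms(2) by (auto simp: bounded_path_def)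
  have "AE w in M. nrm (f s + g s) w \<le> a w + b w" if "0 \<le> s" for s
    using a(2)[OF that] b(2)[OF that] nrm_triangle[of "f s" "g s"] by eventually_elim simp
  then show ?thesis
    using a(1) b(1) assms by (auto simp: bounded_path_def el_path_add intro!: bexI[of _ "\<lambda>w. a w + b w"])
qed

lemma bounded_path_bops:
  assumes T: "T \<in> bops" and "bounded_path f"
  shows "bounded_path (\<lambda>s. T (f s))"
proof -
  obtain b where b: "b \<in> borel_measurable M" "\<And>s. 0 \<le> s \<Longrightarrow> AE w in M. nrm (f s) w \<le> b w"
    using assms(2) by (auto simp: bounded_path_def)
  obtain h where h: "h \<in> borel_measurable M" "AE w in M. 0 \<le> h w"
    "\<And>x. AE w in M. nrm (T x) w \<le> h w * nrm x w"
    using bops_bound[OF T] by blast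
  have "AE w in M. nrm (T (f s)) w \<le> h w * b w" if "0 \<le> s" for s
    using h(2) h(3)[of "f s"] b(2)[OF that]
    by eventually_elim (meson mult_left_mono order_trans)
  then show ?thesis
    using b(1) h(1) assms by (auto simp: bounded_path_def el_path_bops intro!: bexI[of _ "\<lambda>w. h w * b w"])
qed

lemma bounded_path_shift:
  assumes "bounded_path f" "0 \<le> h"
  shows "bounded_path (\<lambda>s. f (s + h))"
proof -
  obtain b where b: "b \<in> borel_measurable M" "\<And>s. 0 \<le> s \<Longrightarrow> AE w in M. nrm (f s) w \<le> b w"
    using assms(1) by (auto simp: bounded_path_def)
  have "AE w in M. nrm (f (s + h)) w \<le> b w" if "0 \<le> s" for s
    using that assms(2) by (intro b(2)) simp
  then show ?thesis using assms b(1) unfolding bounded_path_def by (blast intro: el_path_shift)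
qed

text \<open>The factor 2 comes from 1 + s^2 \<le> 2 (1 + s + s^2 / 2) \<le> 2 exp s.\<close>

lemma exp_minus_le_inverse:
  fixes s :: real
  assumes "0 \<le> s" "1 \<le> c"
  shows "exp (- c * s) \<le> 2 * inverse (1 + s\<^sup>2)"
proof -
  have "1 + s\<^sup>2 \<le> 2 * exp s"
    using exp_lower_Taylor_quadratic[OF assms(1)] assms(1) by (simp add: field_simps)
  also have "exp s \<le> exp (c * s)" using assms by (simp add: mult_le_cancel_right1)
  finally have "1 + s\<^sup>2 \<le> 2 * exp (c * s)" by simp
  moreover have "0 < 1 + s\<^sup>2" by (simp add: add_pos_nonneg)
  ultimately show ?thesis by (simp add: exp_minus field_simps)
qed

end

section \<open>Weighted Banach spaces inside a complete module\<close>

locale complete_random_normed_module = random_normed_module +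
  assumes complete: "el_complete M nrm"

text \<open>
  For a random variable \<open>0 < g \<le> 1\<close> the space \<open>{x. E(g \<parallel>x\<parallel>) < \<infinity>}\<close> is a Banach space whose norm
  convergence implies convergence in probability, and finitely many dominated paths have bounded
  images in it for a suitable \<open>g\<close>.
\<close>

locale weighted_module = complete_random_normed_module +
  fixes g :: "'a \<Rightarrow> real"
  assumes g_measurable [measurable]: "g \<in> borel_measurable M"
    and g_pos: "0 < g w" and g_le_1: "g w \<le> 1"
begin

definition wcar :: "'c set" where "wcar = {x. integrable M (\<lambda>w. g w * nrm x w)}"

definition wnorm :: "'c \<Rightarrow> real" where "wnorm x = (\<integral>w. g w * nrm x w \<partial>M)"

lemma weighted_nonneg: "AE w in M. 0 \<le> g w * nrm x w"
  using nrm_nonneg[of x] by eventually_elim (simp add: g_pos less_imp_le)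

lemma wnorm_nonneg: "0 \<le> wnorm x"
  unfolding wnorm_def by (rule integral_nonneg_AE) (rule weighted_nonneg)

lemma weighted_add: "AE w in M. g w * nrm (x + y) w \<le> g w * nrm x w + g w * nrm y w"
  using nrm_triangle[of x y]
  by eventually_elim (metis g_pos less_imp_le mult_left_mono distrib_left)

lemma wcar_add:
  assumes "x \<in> wcar" "y \<in> wcar"
  shows "x + y \<in> wcar"
proof -
  have "integrable M (\<lambda>w. g w * nrm x w + g w * nrm y w)"
    using assms by (auto simp: wcar_def)
  then have "integrable M (\<lambda>w. g w * nrm (x + y) w)"
    by (rule Bochner_Integration.integrable_bound)
      (use weighted_add[of x y] weighted_nonneg[of "x + y"] in auto)
  then show ?thesis by (simp add: wcar_def)
qed

lemma wnorm_triangle: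
  assumes "x \<in> wcar" "y \<in> wcar"
  shows "wnorm (x + y) \<le> wnorm x + wnorm y"
proof -
  have "wnorm (x + y) \<le> (\<integral>w. g w * nrm x w + g w * nrm y w \<partial>M)"
    unfolding wnorm_def using assms wcar_add[OF assms]
    by (intro integral_mono_AE weighted_add) (auto simp: wcar_def)
  also have "\<dots> = wnorm x + wnorm y"
    unfolding wnorm_def using assms by (intro Bochner_Integration.integral_add) (auto simp: wcar_def)
  finally show ?thesis .
qed

lemma weighted_rsc: "AE w in M. g w * nrm (rsc r x) w = \<bar>r\<bar> * (g w * nrm x w)"
  using nrm_smul[OF borel_measurable_const, of "of_real r" x] by eventually_elim simp

lemma wcar_rsc:
  assumes "x \<in> wcar"
  shows "rsc r x \<in> wcar"
proof -
  have "integrable M (\<lambda>w. \<bar>r\<bar> * (g w * nrm x w))" using assms by (auto simp: wcar_def)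
  then have "integrable M (\<lambda>w. g w * nrm (rsc r x) w)"
    by (rule integrable_cong_AE_imp) (use weighted_rsc[of r x] in \<open>auto elim: eventually_mono\<close>)
  then show ?thesis by (simp add: wcar_def)
qed

lemma wnorm_rsc: "wnorm (rsc r x) = \<bar>r\<bar> * wnorm x"
proof -
  have "wnorm (rsc r x) = (\<integral>w. \<bar>r\<bar> * (g w * nrm x w) \<partial>M)"
    unfolding wnorm_def by (rule integral_cong_AE) (use weighted_rsc[of r x] in auto)
  then show ?thesis by (simp add: wnorm_def)
qed

lemma wcar_diff: "x \<in> wcar \<Longrightarrow> y \<in> wcar \<Longrightarrow> x - y \<in> wcar"
  using wcar_add[of x "rsc (-1) y"] wcar_rsc[of y "-1"] smul_minus_left[of "\<lambda>_. 1" y]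
  by (simp add: smul_one)

lemma wnorm_zeroD:
  assumes "x \<in> wcar" "wnorm x = 0"
  shows "x = 0"
proof (rule nrm_zeroD)
  have "AE w in M. g w * nrm x w = 0"
    using assms integral_nonneg_eq_0_iff_AE[OF _ weighted_nonneg, of x]
    by (simp add: wcar_def wnorm_def)
  then show "AE w in M. nrm x w = 0"
    by eventually_elim (metis g_pos less_irrefl mult_eq_0_iff)
qed

text \<open>The truncated size of \<open>g * nrm\<close> is at most \<open>wnorm\<close>, and the
  unbounded factor 1 / g is absorbed by domination in probability.\<close>

lemma tends_of_wnorm:
  assumes car: "\<forall>\<^sub>F n in F. f n - l \<in> wcar" and lim: "((\<lambda>n. wnorm (f n - l)) \<longlongrightarrow> 0) F"
  shows "tends f l F"
proof (rule tends_dominated[where h = "\<lambda>w. inverse (g w)" and a = "\<lambda>n w. g w * nrm (f n - l) w"])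
  show "((\<lambda>n. prob_size (\<lambda>w. g w * nrm (f n - l) w)) \<longlongrightarrow> 0) F"
  proof (rule tendsto_sandwich[OF _ _ tendsto_const lim])
    show "\<forall>\<^sub>F n in F. prob_size (\<lambda>w. g w * nrm (f n - l) w) \<le> wnorm (f n - l)"
      using car
    proof eventually_elim
      case (elim n)
      then show ?case
        unfolding prob_size_def wnorm_def
        by (intro integral_mono_AE integrable_prob_size)
          (use weighted_nonneg[of "f n - l"] in \<open>auto simp: wcar_def elim: eventually_mono\<close>)
    qed
  qed (simp add: prob_size_nonneg)
  have "AE w in M. nrm (f n - l) w \<le> \<bar>inverse (g w)\<bar> * \<bar>g w * nrm (f n - l) w\<bar>" for n
    using nrm_nonneg[of "f n - l"]
  proof eventually_elim
    case (elim w)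
    then show ?case using g_pos[of w] by (simp add: mult.assoc[symmetric])
  qed
  then show "\<forall>\<^sub>F n in F. AE w in M. nrm (f n - l) w \<le> \<bar>inverse (g w)\<bar> * \<bar>g w * nrm (f n - l) w\<bar>"
    by simp
qed auto

text \<open>The third estimate is a partial converse to \<open>tends_of_wnorm\<close>: under a
  common bound \<open>c\<close>, convergence in probability implies norm convergence. Where
  \<open>nrm x \<le> 1\<close> it uses \<open>g \<le> 1\<close>, elsewhere the bound
  \<open>c\<close>; hence the constant \<open>max 1 c\<close>.\<close>

lemma wnorm_le:
  assumes "0 \<le> c" "AE w in M. g w * nrm x w \<le> c"
  shows "x \<in> wcar" "wnorm x \<le> c" "wnorm x \<le> max 1 c * prob_size (nrm x)"
proof -
  show car: "x \<in> wcar"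
    unfolding wcar_def mem_Collect_eq
    by (rule integrable_const_bound[where B = c])
      (use assms(2) weighted_nonneg[of x] in \<open>auto elim: eventually_elim2\<close>)
  have "wnorm x \<le> (\<integral>w. c \<partial>M)"
    unfolding wnorm_def using assms(2) car by (intro integral_mono_AE) (auto simp: wcar_def)
  then show "wnorm x \<le> c" by (simp add: prob_space)
  have "wnorm x \<le> (\<integral>w. max 1 c * min 1 \<bar>nrm x w\<bar> \<partial>M)"
    unfolding wnorm_def
  proof (rule integral_mono_AE)
    show "AE w in M. g w * nrm x w \<le> max 1 c * min 1 \<bar>nrm x w\<bar>"
      using assms(2) nrm_nonneg[of x]
    proof eventually_elim
      case (elim w)
      have "g w * nrm x w \<le> 1 * nrm x w" using elim g_le_1 by (intro mult_right_mono) auto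
      moreover have "1 * nrm x w \<le> max 1 c * nrm x w" using elim by (intro mult_right_mono) auto
      ultimately show ?case using elim by (auto simp: min_def)
    qed
  qed (use car integrable_prob_size[of "nrm x"] in \<open>auto simp: wcar_def\<close>)
  then show "wnorm x \<le> max 1 c * prob_size (nrm x)" by (simp add: prob_size_def)
qed

text \<open>As in the completeness proof for L^1: completeness of the module provides a limit in
  probability, a subsequence converges in norm almost surely, and Fatou's lemma carries the Cauchy
  estimate over to the limit.\<close>

lemma wnorm_complete:
  assumes car: "\<And>n. X n \<in> wcar"
    and Cauchy: "\<And>e. 0 < e \<Longrightarrow> \<exists>n0. \<forall>m\<ge>n0. \<forall>n\<ge>n0. wnorm (X m - X n) < e"
  shows "\<exists>l\<in>wcar. (\<lambda>n. wnorm (X n - l)) \<longlonglongrightarrow> 0"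
proof -
  have "\<exists>N. \<forall>m\<ge>N. \<forall>n\<ge>N. X m - X n \<in> el_nbhd M nrm \<epsilon> \<mu>" if "0 < \<epsilon>" "\<mu> \<in> {0<..<1}" for \<epsilon> \<mu>
  proof -
    \<comment> \<open>The product filter turns the Cauchy condition into a single limit, to which
      \<open>tends_of_wnorm\<close> applies.\<close>
    let ?F = "sequentially \<times>\<^sub>F sequentially"
    have "tends (\<lambda>p. X (fst p) - X (snd p)) 0 ?F"
    proof (rule tends_of_wnorm)
      show "((\<lambda>p. wnorm (X (fst p) - X (snd p) - 0)) \<longlongrightarrow> 0) ?F"
      proof (rule tendstoI)
        fix e :: real assume "0 < e"
        then obtain n0 where "\<forall>m\<ge>n0. \<forall>n\<ge>n0. wnorm (X m - X n) < e" using Cauchy by blast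
        then show "\<forall>\<^sub>F p in ?F. dist (wnorm (X (fst p) - X (snd p) - 0)) 0 < e"
          unfolding eventually_prod_sequentially by (auto simp: wnorm_nonneg)
      qed
    qed (simp add: wcar_diff car)
    then have "\<forall>\<^sub>F p in ?F. X (fst p) - X (snd p) - 0 \<in> el_nbhd M nrm \<epsilon> \<mu>"
      using that unfolding limitin_el by blast
    then show ?thesis unfolding eventually_prod_sequentially by auto
  qed
  then obtain l where l: "tends X l sequentially"
    using complete unfolding el_complete_def by blast
  have "(\<lambda>n. \<integral>w. norm (min 1 \<bar>nrm (X n - l) w\<bar>) \<partial>M) \<longlonglongrightarrow> 0"
    using l by (simp add: tends_iff prob_size_def)
  then obtain r where r: "strict_mono r" "AE w in M. (\<lambda>k. min 1 \<bar>nrm (X (r k) - l) w\<bar>) \<longlonglongrightarrow> 0"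
    using tendsto_L1_AE_subseq[of M "\<lambda>n w. min 1 \<bar>nrm (X n - l) w\<bar>"] integrable_prob_size
    by auto
  have sub: "AE w in M. (\<lambda>k. nrm (X (r k) - l) w) \<longlonglongrightarrow> 0"
    using r(2)
  proof eventually_elim
    case (elim w)
    have "\<forall>\<^sub>F k in sequentially. min 1 \<bar>nrm (X (r k) - l) w\<bar> = \<bar>nrm (X (r k) - l) w\<bar>"
      using order_tendstoD(2)[OF elim zero_less_one] by eventually_elim auto
    then show ?case using elim by (simp add: tendsto_cong tendsto_rabs_zero_iff)
  qed
  \<comment> \<open>Fatou yields integrability as well as the estimate; this is how \<open>l\<close>
    is later recognised as an element of \<open>wcar\<close>.\<close>
  have main: "X n - l \<in> wcar \<and> wnorm (X n - l) \<le> e"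
    if e: "\<And>m. n0 \<le> m \<Longrightarrow> wnorm (X n - X m) \<le> e" for n n0 e
  proof -
    let ?f = "\<lambda>k w. ennreal (g w * nrm (X n - X (r k)) w)"
    have AE_all: "AE w in M. \<forall>k. nrm (X n - X (r k)) w \<le> nrm (X n - l) w + nrm (X (r k) - l) w
        \<and> nrm (X n - l) w \<le> nrm (X n - X (r k)) w + nrm (X (r k) - l) w"
      unfolding AE_all_countable
    proof
      fix k
      show "AE w in M. nrm (X n - X (r k)) w \<le> nrm (X n - l) w + nrm (X (r k) - l) w
        \<and> nrm (X n - l) w \<le> nrm (X n - X (r k)) w + nrm (X (r k) - l) w"
        using nrm_diff_triangle[of "X n - l" "X (r k) - l"] nrm_triangle[of "X n - X (r k)" "X (r k) - l"]
        by eventually_elim simp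
    qed
    have lim: "AE w in M. liminf (\<lambda>k. ?f k w) = ennreal (g w * nrm (X n - l) w)"
      using sub AE_all
    proof eventually_elim
      case (elim w)
      have "(\<lambda>k. nrm (X n - X (r k)) w - nrm (X n - l) w) \<longlonglongrightarrow> 0"
        by (rule Lim_null_comparison[OF _ elim(1)]) (use elim(2) in \<open>auto simp: abs_le_iff algebra_simps\<close>)
      then have "(\<lambda>k. nrm (X n - X (r k)) w) \<longlonglongrightarrow> nrm (X n - l) w" by (rule LIM_zero_cancel)
      then show ?case by (intro lim_imp_Liminf tendsto_intros) auto
    qed
    have "(\<integral>\<^sup>+w. ennreal (g w * nrm (X n - l) w) \<partial>M) = (\<integral>\<^sup>+w. liminf (\<lambda>k. ?f k w) \<partial>M)"
      using lim by (intro nn_integral_cong_AE) (auto elim: eventually_mono)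
    also have "\<dots> \<le> liminf (\<lambda>k. \<integral>\<^sup>+w. ?f k w \<partial>M)" by (rule nn_integral_liminf) simp
    also have "\<dots> \<le> ennreal e"
    proof (rule Liminf_le)
      show "\<forall>\<^sub>F k in sequentially. (\<integral>\<^sup>+w. ?f k w \<partial>M) \<le> ennreal e"
        using eventually_ge_at_top[of n0]
      proof eventually_elim
        case (elim k)
        have "(\<integral>\<^sup>+w. ?f k w \<partial>M) = ennreal (wnorm (X n - X (r k)))"
          unfolding wnorm_def using wcar_diff[OF car car]
          by (intro nn_integral_eq_integral weighted_nonneg) (simp add: wcar_def)
        then show ?case using e[of "r k"] elim seq_suble[OF r(1), of k] by (simp add: ennreal_leI)
      qed
    qed simp
    finally have le: "(\<integral>\<^sup>+w. ennreal (g w * nrm (X n - l) w) \<partial>M) \<le> ennreal e" .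
    have "integrable M (\<lambda>w. g w * nrm (X n - l) w)"
      using le weighted_nonneg[of "X n - l"]
      by (intro integrableI_nonneg) (auto intro: le_less_trans)
    moreover have "0 \<le> e" using e[of n0] wnorm_nonneg order_trans by blast
    ultimately show ?thesis
      using le nn_integral_eq_integral[OF _ weighted_nonneg, of "X n - l"]
      by (simp add: wcar_def wnorm_def)
  qed
  have small: "\<exists>n0. \<forall>n\<ge>n0. X n - l \<in> wcar \<and> wnorm (X n - l) \<le> e" if "0 < e" for e
  proof -
    obtain n0 where "\<forall>m\<ge>n0. \<forall>n\<ge>n0. wnorm (X m - X n) < e" using Cauchy[OF \<open>0 < e\<close>] by blast
    then show ?thesis by (intro exI[of _ n0] allI impI main[of n0]) (auto intro: less_imp_le)
  qed
  obtain n0 where "X n0 - l \<in> wcar" using small[of 1] by auto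
  then have "X n0 - (X n0 - l) \<in> wcar" by (rule wcar_diff[OF car])
  then have "l \<in> wcar" by simp
  moreover have "(\<lambda>n. wnorm (X n - l)) \<longlonglongrightarrow> 0"
  proof (rule LIMSEQ_I)
    fix r :: real assume "0 < r"
    then obtain n0 where "\<forall>n\<ge>n0. wnorm (X n - l) \<le> r / 2" using small[of "r / 2"] by auto
    then show "\<exists>n0. \<forall>n\<ge>n0. norm (wnorm (X n - l) - 0) < r"
      using \<open>0 < r\<close> by (intro exI[of _ n0]) (fastforce simp: wnorm_nonneg)
  qed
  ultimately show ?thesis by blast
qed

lemma banach_on_wcar: "banach_on wcar rsc wnorm"
  unfolding banach_on_def
proof (intro conjI ballI allI impI)
  show "0 \<in> wcar" by (rule wnorm_le(1)[OF order_refl]) (use nrm_zero in eventually_elim, simp)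
  show "rsc (r + s) x = rsc r x + rsc s x" for r s x
    using smul_add_left[of "\<lambda>_. of_real r" "\<lambda>_. of_real s" x] by simp
  show "rsc r (rsc s x) = rsc (r * s) x" for r s x
    using smul_smul[of "\<lambda>_. of_real r" "\<lambda>_. of_real s" x] by simp
  show "\<exists>l\<in>wcar. (\<lambda>n. wnorm (X n - l)) \<longlonglongrightarrow> 0"
    if "\<forall>n. X n \<in> wcar" "\<forall>e>0. \<exists>n0. \<forall>m\<ge>n0. \<forall>n\<ge>n0. wnorm (X m - X n) < e" for X
    using that by (intro wnorm_complete) auto
qed (simp_all add: wcar_add wcar_rsc smul_add_right smul_one wnorm_zeroD wnorm_triangle wnorm_rsc)

end

section \<open>Moving paths and integrals between the module and the Banach space\<close>

context weighted_module
begin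

definition wspace :: "'c banach_structure" where
  "wspace = (SOME d. bs_carrier d = wcar \<and> bs_scale d = rsc \<and> bs_norm d = wnorm)"

lemma wspace: "bs_carrier wspace = wcar" "bs_scale wspace = rsc" "bs_norm wspace = wnorm"
proof -
  have "\<exists>d. bs_carrier d = wcar \<and> bs_scale d = rsc \<and> bs_norm d = wnorm"
    using banach_on_is_bs[OF banach_on_wcar] by metis
  from someI_ex[OF this]
  show "bs_carrier wspace = wcar" "bs_scale wspace = rsc" "bs_norm wspace = wnorm"
    unfolding wspace_def by auto
qed

abbreviation emb :: "'c \<Rightarrow> 'c banach_product" where "emb \<equiv> bp_emb wspace"
abbreviation proj :: "'c banach_product \<Rightarrow> 'c" where "proj \<equiv> bp_proj wspace"

lemma emb_diff: "x \<in> wcar \<Longrightarrow> y \<in> wcar \<Longrightarrow> emb (x - y) = emb x - emb y"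
  using bp_emb_diff[of x wspace y] by (simp add: wspace)

lemma emb_add: "x \<in> wcar \<Longrightarrow> y \<in> wcar \<Longrightarrow> emb (x + y) = emb x + emb y"
  using bp_emb_add[of x wspace y] by (simp add: wspace)

lemma emb_rsc: "x \<in> wcar \<Longrightarrow> emb (rsc r x) = r *\<^sub>R emb x"
  using bp_emb_scale[of x wspace r] by (simp add: wspace)

lemma norm_emb: "x \<in> wcar \<Longrightarrow> norm (emb x) = wnorm x"
  using bp_emb_norm[of x wspace] by (simp add: wspace)

lemma proj_emb: "x \<in> wcar \<Longrightarrow> proj (emb x) = x"
  using bp_proj_emb[of x wspace wspace] by (simp add: wspace)

lemma proj_wcar: "proj F \<in> wcar"
  using bp_proj_carrier[of wspace F] by (simp add: wspace)

lemma proj_rsc: "proj (r *\<^sub>R F) = rsc r (proj F)"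
  using bp_proj_scale[of wspace r F] by (simp add: wspace)

lemma proj_zero: "proj 0 = 0"
  using bp_proj_diff[of wspace 0 0] by simp

lemma proj_sum: "proj (\<Sum>i\<in>I. F i) = (\<Sum>i\<in>I. proj (F i))"
  by (induction I rule: infinite_finite_induct) (auto simp: proj_zero bp_proj_add)

lemma tendsto_emb_proj:
  assumes "(F \<longlongrightarrow> G) A"
  shows "((\<lambda>n. emb (proj (F n))) \<longlongrightarrow> emb (proj G)) A"
proof (rule LIM_zero_cancel, rule Lim_null_comparison)
  show "\<forall>\<^sub>F n in A. norm (emb (proj (F n)) - emb (proj G)) \<le> norm (F n - G)"
  proof (rule always_eventually, rule allI)
    fix n
    have "norm (emb (proj (F n)) - emb (proj G)) = wnorm (proj (F n - G))"
      by (simp add: emb_diff[symmetric] proj_wcar norm_emb wcar_diff bp_proj_diff)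
    then show "norm (emb (proj (F n)) - emb (proj G)) \<le> norm (F n - G)"
      using bp_proj_norm[of wspace "F n - G"] by (simp add: wspace)
  qed
  show "((\<lambda>n. norm (F n - G)) \<longlongrightarrow> 0) A" using assms by (intro tendsto_norm_zero LIM_zero)
qed

lemma tends_proj:
  assumes "(F \<longlongrightarrow> G) A"
  shows "tends (\<lambda>n. proj (F n)) (proj G) A"
proof (rule tends_of_wnorm)
  show "((\<lambda>n. wnorm (proj (F n) - proj G)) \<longlongrightarrow> 0) A"
  proof (rule tendsto_sandwich[OF _ _ tendsto_const])
    show "((\<lambda>n. norm (F n - G)) \<longlongrightarrow> 0) A" using assms by (intro tendsto_norm_zero LIM_zero)
    show "\<forall>\<^sub>F n in A. wnorm (proj (F n) - proj G) \<le> norm (F n - G)"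
      using bp_proj_norm[of wspace "F n - G" for n] by (simp add: wspace bp_proj_diff)
  qed (simp add: wnorm_nonneg)
qed (simp add: wcar_diff proj_wcar)

text \<open>The embedded copy of the space is the fixed set of the contraction \<open>emb\<close>
  after \<open>proj\<close>, hence closed. Limits of embedded Riemann sums and integrals can
  therefore be pulled back to the module without loss.\<close>

lemma emb_proj_limit:
  assumes "(F \<longlongrightarrow> G) A" "A \<noteq> bot" "\<forall>\<^sub>F n in A. emb (proj (F n)) = F n"
  shows "emb (proj G) = G"
proof (rule tendsto_unique[OF assms(2) _ assms(1)])
  show "(F \<longlongrightarrow> emb (proj G)) A"
    using tendsto_emb_proj[OF assms(1)] assms(3) by (simp add: tendsto_cong)
qed

text \<open>The bound is almost sure at each time and not merely one on \<open>wnorm\<close>; this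
  is what lets \<open>wnorm_le\<close> turn convergence in probability into norm
  convergence.\<close>

definition wpath :: "real \<Rightarrow> (real \<Rightarrow> 'c) \<Rightarrow> bool" where
  "wpath c f \<longleftrightarrow> el_path f \<and> (\<forall>s\<ge>0. AE w in M. g w * nrm (f s) w \<le> c)"

lemma wpath_nonneg:
  assumes "wpath c f"
  shows "0 \<le> c"
proof -
  have "AE w in M. g w * nrm (f 0) w \<le> c" using assms by (auto simp: wpath_def)
  then have "AE w in M. 0 \<le> c" using weighted_nonneg[of "f 0"] by eventually_elim simp
  then show ?thesis using AE_const prob_space_axioms by (simp add: emeasure_space_1)
qed

lemma wpath_wcar:
  assumes "wpath c f" "0 \<le> s"
  shows "f s \<in> wcar" "norm (emb (f s)) \<le> c"
proof -
  have "AE w in M. g w * nrm (f s) w \<le> c" using assms by (simp add: wpath_def)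
  from wnorm_le[OF wpath_nonneg[OF assms(1)] this]
  show "f s \<in> wcar" "norm (emb (f s)) \<le> c" by (simp_all add: norm_emb)
qed

text \<open>The differences \<open>f t - f s\<close> share the weighted bound \<open>2 * c\<close>,
  so the third estimate of \<open>wnorm_le\<close> upgrades continuity in probability to norm
  continuity.\<close>

lemma continuous_on_emb:
  assumes f: "wpath c f"
  shows "continuous_on {0..} (\<lambda>s. emb (f s))"
  unfolding continuous_on_eq_continuous_within continuous_within
proof
  fix s :: real assume "s \<in> {0..}"
  then have s: "0 \<le> s" by simp
  show "((\<lambda>t. emb (f t)) \<longlongrightarrow> emb (f s)) (at s within {0..})"
  proof (rule LIM_zero_cancel, rule Lim_null_comparison)
    have "\<forall>\<^sub>F t in at s within {0..}. 0 \<le> t"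
      by (auto simp: eventually_at_filter)
    then show "\<forall>\<^sub>F t in at s within {0..}. norm (emb (f t) - emb (f s))
        \<le> max 1 (2 * c) * prob_size (nrm (f t - f s))"
    proof eventually_elim
      case (elim t)
      have "AE w in M. g w * nrm (f t) w \<le> c" "AE w in M. g w * nrm (f s) w \<le> c"
        using f elim s by (auto simp: wpath_def)
      then have "AE w in M. g w * nrm (f t - f s) w \<le> 2 * c"
        using nrm_diff_triangle[of "f t" "f s"]
      proof eventually_elim
        case (elim w)
        have "g w * nrm (f t - f s) w \<le> g w * (nrm (f t) w + nrm (f s) w)"
          using elim(3) g_pos[of w] by (intro mult_left_mono) auto
        then show ?case using elim by (simp add: distrib_left)
      qed
      then have "wnorm (f t - f s) \<le> max 1 (2 * c) * prob_size (nrm (f t - f s))"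
        using wpath_nonneg[OF f] by (intro wnorm_le(3)) auto
      then show ?case
        using wpath_wcar(1)[OF f] elim s by (simp add: emb_diff[symmetric] norm_emb wcar_diff)
    qed
    have "((\<lambda>t. prob_size (nrm (f t - f s))) \<longlongrightarrow> 0) (at s within {0..})"
      using f s by (simp add: wpath_def el_path_def tends_iff)
    then show "((\<lambda>t. max 1 (2 * c) * prob_size (nrm (f t - f s))) \<longlongrightarrow> 0) (at s within {0..})"
      by (rule tendsto_mult_right_zero)
  qed
qed

text \<open>Riemann sums of the embedded path are embeddings of the sums in the module. They
  converge in the Banach space, and \<open>proj\<close> carries the limit back; the second part says
  that the integral stays in the embedded copy.\<close>

lemma wpath_riemann_integral:
  assumes f: "wpath c f" and L: "0 \<le> L"
  shows "rint f (proj (integral {0..L} (\<lambda>s. emb (f s)))) 0 L"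
    and "emb (proj (integral {0..L} (\<lambda>s. emb (f s)))) = integral {0..L} (\<lambda>s. emb (f s))"
proof -
  let ?S = "\<lambda>p. \<Sum>(t, J)\<in>p. measure lborel J *\<^sub>R emb (f t)"
  have lim: "(?S \<longlongrightarrow> integral {0..L} (\<lambda>s. emb (f s))) (riemann_filter 0 L)"
    by (intro tendsto_riemann_sums continuous_on_atLeast_Icc[OF continuous_on_emb[OF f]]) simp
  have S: "proj (?S p) = (\<Sum>(t, J)\<in>p. rsc (measure lborel J) (f t))" "emb (proj (?S p)) = ?S p"
    if p: "p tagged_division_of {0..L}" for p
  proof -
    have t: "f t \<in> wcar" if "(t, J) \<in> p" for t J
    proof -
      have "t \<in> {0..L}" using tagged_division_ofD(2,3)[OF p that] by blast
      then show ?thesis by (intro wpath_wcar(1)[OF f]) simp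
    qed
    then show 1: "proj (?S p) = (\<Sum>(t, J)\<in>p. rsc (measure lborel J) (f t))"
      unfolding proj_sum by (intro sum.cong) (auto simp: proj_rsc proj_emb)
    \<comment> \<open>Additivity of \<open>emb\<close> holds on \<open>wcar\<close>, so membership
      of the partial sums is carried through the induction.\<close>
    have "finite q \<Longrightarrow> q \<subseteq> p \<Longrightarrow> (\<Sum>(t, J)\<in>q. rsc (measure lborel J) (f t)) \<in> wcar \<and>
        emb (\<Sum>(t, J)\<in>q. rsc (measure lborel J) (f t)) = ?S q" for q
    proof (induction q rule: finite_induct)
      case empty
      then show ?case using proj_wcar[of 0] emb_diff[of "proj 0" "proj 0"] by (simp add: proj_zero)
    next
      case (insert a q)
      obtain t J where a: "a = (t, J)" by force
      then have "f t \<in> wcar" using insert.prems t by blast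
      then show ?case using insert a by (simp add: wcar_add wcar_rsc emb_add emb_rsc)
    qed
    moreover have "finite p" using p by blast
    ultimately show "emb (proj (?S p)) = ?S p" unfolding 1 by blast
  qed
  show "rint f (proj (integral {0..L} (\<lambda>s. emb (f s)))) 0 L"
    unfolding has_riemann_integral_def
  proof (subst tends_cong)
    show "\<forall>\<^sub>F p in riemann_filter 0 L. (\<Sum>(t, J)\<in>p. rsc (measure lborel J) (f t)) = proj (?S p)"
      using eventually_tagged_division by eventually_elim (simp add: S(1))
  qed (rule tends_proj[OF lim])
  show "emb (proj (integral {0..L} (\<lambda>s. emb (f s)))) = integral {0..L} (\<lambda>s. emb (f s))"
  proof (rule emb_proj_limit[OF lim riemann_filter_neq_bot])
    show "\<forall>\<^sub>F p in riemann_filter 0 L. emb (proj (?S p)) = ?S p"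
      using eventually_tagged_division by eventually_elim (rule S(2))
  qed
qed

definition wdecaying :: "(real \<Rightarrow> 'c) \<Rightarrow> bool" where
  "wdecaying f \<longleftrightarrow> el_path f \<and>
     (\<exists>c>0. \<forall>s\<ge>0. AE w in M. g w * nrm (f s) w \<le> c * inverse (1 + s\<^sup>2))"

lemma wdecaying_imp_wpath:
  assumes "wdecaying f"
  obtains c where "wpath c f"
proof -
  obtain c where c: "c > 0" "\<And>s. 0 \<le> s \<Longrightarrow> AE w in M. g w * nrm (f s) w \<le> c * inverse (1 + s\<^sup>2)"
    using assms by (auto simp: wdecaying_def)
  have "AE w in M. g w * nrm (f s) w \<le> c" if "0 \<le> s" for s
    using c(2)[OF that]
    by eventually_elim
      (erule order_trans, use c(1) in \<open>auto intro: mult_left_le inverse_one_plus_square_le_1\<close>)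
  then show ?thesis using assms that[of c] by (auto simp: wpath_def wdecaying_def)
qed

lemma wdecaying_improper_integral:
  assumes f: "wdecaying f"
  obtains y where "iint f y" "((\<lambda>L. integral {0..L} (\<lambda>s. emb (f s))) \<longlongrightarrow> emb y) at_top" "y \<in> wcar"
proof -
  obtain c where c: "c > 0" "\<And>s. 0 \<le> s \<Longrightarrow> AE w in M. g w * nrm (f s) w \<le> c * inverse (1 + s\<^sup>2)"
    using f by (auto simp: wdecaying_def)
  obtain c' where wf: "wpath c' f" using wdecaying_imp_wpath[OF f] by blast
  have "norm (emb (f s)) \<le> c * inverse (1 + s\<^sup>2)" if "0 \<le> s" for s
  proof -
    have "0 \<le> c * inverse (1 + s\<^sup>2)" using c(1) by simp
    from wnorm_le(2)[OF this c(2)[OF that]] show ?thesis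
      using wpath_wcar(1)[OF wf that] by (simp add: norm_emb)
  qed
  then obtain Y where Y: "((\<lambda>L. integral {0..L} (\<lambda>s. emb (f s))) \<longlongrightarrow> Y) at_top"
    using tendsto_improper_integral[OF continuous_on_emb[OF wf]] by blast
  have "\<forall>\<^sub>F L in at_top. emb (proj (integral {0..L} (\<lambda>s. emb (f s)))) = integral {0..L} (\<lambda>s. emb (f s))"
    using eventually_ge_at_top[of 0] by eventually_elim (rule wpath_riemann_integral(2)[OF wf])
  then have fixed: "emb (proj Y) = Y"
    by (intro emb_proj_limit[OF Y]) auto
  have "iint f (proj Y)"
    unfolding has_improper_integral_def
    using wpath_riemann_integral(1)[OF wf] tends_proj[OF Y]
    by (intro exI[of _ "\<lambda>L. proj (integral {0..L} (\<lambda>s. emb (f s)))"]) auto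
  then show ?thesis using that[of "proj Y"] Y fixed proj_wcar by simp
qed

lemma wdecaying_iint_tendsto:
  assumes "wdecaying f" "iint f y"
  shows "((\<lambda>L. integral {0..L} (\<lambda>s. emb (f s))) \<longlongrightarrow> emb y) at_top" "y \<in> wcar"
  using wdecaying_improper_integral[OF assms(1)] iint_unique[OF assms(2)] by metis+

lemma wdecaying_exp:
  assumes "wpath c f" "1 \<le> n"
  shows "wdecaying (\<lambda>s. rsc (exp (- n * s)) (f s))"
  unfolding wdecaying_def
\<comment> \<open>The factor 2 is that of \<open>exp_minus_le_inverse\<close>; \<open>c + 1\<close>
  keeps the constant positive when \<open>c = 0\<close>.\<close>
proof (intro conjI exI[of _ "2 * (c + 1)"] allI impI)
  show "el_path (\<lambda>s. rsc (exp (- n * s)) (f s))"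
    using el_path_smul_exp[of f "\<lambda>_. n"] assms(1) by (simp add: wpath_def)
  show "0 < 2 * (c + 1)" using wpath_nonneg[OF assms(1)] by simp
  fix s :: real assume s: "0 \<le> s"
  have "AE w in M. g w * nrm (f s) w \<le> c" using assms(1) s by (simp add: wpath_def)
  then show "AE w in M. g w * nrm (rsc (exp (- n * s)) (f s)) w \<le> 2 * (c + 1) * inverse (1 + s\<^sup>2)"
    using weighted_rsc[of "exp (- n * s)" "f s"] weighted_nonneg[of "f s"]
  proof eventually_elim
    case (elim w)
    have "exp (- n * s) * (g w * nrm (f s) w) \<le> (2 * inverse (1 + s\<^sup>2)) * (c + 1)"
      using elim exp_minus_le_inverse[OF s assms(2)] by (intro mult_mono) auto
    moreover have "2 * (c + 1) * inverse (1 + s\<^sup>2) = (2 * inverse (1 + s\<^sup>2)) * (c + 1)"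
      by (simp only: mult_ac)
    ultimately show ?case by (simp only: elim(2) abs_exp_cancel)
  qed
qed

text \<open>Uniqueness of improper integrals identifies a transform given in the module with the one
  computed in the Banach space.\<close>

lemma wpath_laplace_tendsto:
  assumes f: "wpath c f" and n: "1 \<le> (n::nat)"
    and y: "iint (\<lambda>s. rsc (exp (- real n * s)) (f s)) y"
  shows "((\<lambda>L. laplace_upto (\<lambda>s. emb (f s)) n L) \<longlongrightarrow> emb y) at_top"
    and "y \<in> wcar"
proof -
  have d: "wdecaying (\<lambda>s. rsc (exp (- real n * s)) (f s))"
    using f n by (intro wdecaying_exp) auto
  have "integral {0..L} (\<lambda>s. emb (rsc (exp (- real n * s)) (f s)))
      = laplace_upto (\<lambda>s. emb (f s)) n L" for L
    by (rule integral_cong) (simp add: emb_rsc wpath_wcar(1)[OF f])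
  then show "((\<lambda>L. laplace_upto (\<lambda>s. emb (f s)) n L) \<longlongrightarrow> emb y) at_top"
    using wdecaying_iint_tendsto(1)[OF d y] by simp
  show "y \<in> wcar" by (rule wdecaying_iint_tendsto(2)[OF d y])
qed

end

section \<open>Integrals and Laplace transforms of dominated paths in the module\<close>

context complete_random_normed_module
begin

lemma weighted_module_inverse:
  assumes [measurable]: "b \<in> borel_measurable M"
  shows "weighted_module M smul nrm (\<lambda>w. inverse (1 + \<bar>b w\<bar>))"
  by unfold_locales (auto simp: inverse_le_1_iff add_pos_nonneg)

text \<open>The slack between \<open>b\<close> and \<open>c\<close> lets one weight serve several
  paths, \<open>c\<close> being the sum of their bounds.\<close>

lemma inverse_weight_le:
  fixes x b p :: real
  assumes "x \<le> b * p" "0 \<le> p" "\<bar>b\<bar> \<le> c"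
  shows "inverse (1 + \<bar>c\<bar>) * x \<le> p"
proof -
  have "x \<le> \<bar>b\<bar> * p" using assms(1,2) by (meson abs_ge_self mult_right_mono order_trans)
  also have "\<dots> \<le> (1 + \<bar>c\<bar>) * p" using assms(2,3) by (intro mult_right_mono) auto
  finally have "x \<le> (1 + \<bar>c\<bar>) * p" .
  moreover have "0 < 1 + \<bar>c\<bar>" by simp
  ultimately show ?thesis by (simp add: field_simps)
qed

lemma inverse_weight_le_1:
  fixes x b :: real
  assumes "x \<le> b" "\<bar>b\<bar> \<le> c"
  shows "inverse (1 + \<bar>c\<bar>) * x \<le> 1"
  using inverse_weight_le[of x b 1 c] assms by simp

lemma bounded_path_weight:
  assumes "bounded_path f"
  obtains g where "weighted_module M smul nrm g" "weighted_module.wpath M nrm g 1 f"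
proof -
  obtain b where b: "b \<in> borel_measurable M" "\<And>s. 0 \<le> s \<Longrightarrow> AE w in M. nrm (f s) w \<le> b w"
    using assms by (auto simp: bounded_path_def)
  define g where "g = (\<lambda>w. inverse (1 + \<bar>\<bar>b w\<bar>\<bar>))"
  interpret weighted_module M smul nrm g
    unfolding g_def using b(1) by (intro weighted_module_inverse) simp
  have "AE w in M. g w * nrm (f s) w \<le> 1" if "0 \<le> s" for s
    unfolding g_def using b(2)[OF that] by eventually_elim (erule inverse_weight_le_1, simp)
  then have "wpath 1 f" using assms unfolding wpath_def bounded_path_def by blast
  then show ?thesis using that weighted_module_axioms by blast
qed

lemma decaying_path_weight:
  assumes "decaying_path f"
  obtains g where "weighted_module M smul nrm g" "weighted_module.wdecaying M nrm g f"
proof -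
  obtain b where b: "b \<in> borel_measurable M"
    "\<And>s. 0 \<le> s \<Longrightarrow> AE w in M. nrm (f s) w \<le> b w * inverse (1 + s\<^sup>2)"
    using assms by (auto simp: decaying_path_def)
  define g where "g = (\<lambda>w. inverse (1 + \<bar>\<bar>b w\<bar>\<bar>))"
  interpret weighted_module M smul nrm g
    unfolding g_def using b(1) by (intro weighted_module_inverse) simp
  have "AE w in M. g w * nrm (f s) w \<le> 1 * inverse (1 + s\<^sup>2)" if "0 \<le> s" for s
    unfolding g_def using b(2)[OF that] unfolding mult_1 by eventually_elim (erule inverse_weight_le, simp_all)
  then have "wdecaying f"
    using assms unfolding wdecaying_def decaying_path_def by (intro conjI exI[of _ 1]) auto
  then show ?thesis using that weighted_module_axioms by blast
qed

lemma ex_rint: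
  assumes "bounded_path f" "0 \<le> L"
  shows "\<exists>y. rint f y 0 L"
proof -
  obtain g where "weighted_module M smul nrm g" and w: "weighted_module.wpath M nrm g 1 f"
    using bounded_path_weight[OF assms(1)] by blast
  interpret weighted_module M smul nrm g by fact
  show ?thesis using wpath_riemann_integral(1)[OF w assms(2)] by blast
qed

lemma ex_iint:
  assumes "decaying_path f"
  shows "\<exists>y. iint f y"
proof -
  obtain g where "weighted_module M smul nrm g" and d: "weighted_module.wdecaying M nrm g f"
    using decaying_path_weight[OF assms] by blast
  interpret weighted_module M smul nrm g by fact
  show ?thesis using wdecaying_improper_integral[OF d] by metis
qed

lemma laplace_unique_0:
  assumes u: "bounded_path u"
    and lap: "\<And>n::nat. 1 \<le> n \<Longrightarrow> iint (\<lambda>s. rsc (exp (- real n * s)) (u s)) 0"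
    and t: "0 \<le> t"
  shows "u t = 0"
proof -
  obtain g where "weighted_module M smul nrm g" and w: "weighted_module.wpath M nrm g 1 u"
    using bounded_path_weight[OF u] by blast
  interpret weighted_module M smul nrm g by fact
  have emb0: "emb 0 = 0" using emb_diff[of 0 0] proj_wcar[of 0] by (simp add: proj_zero)
  have "emb (u t) = 0"
    using wpath_laplace_tendsto(1)[OF w _ lap]
    by (intro laplace_transform_unique[OF continuous_on_emb[OF w] wpath_wcar(2)[OF w] _ t])
      (simp_all add: emb0)
  then show ?thesis using proj_emb[OF wpath_wcar(1)[OF w t]] by (simp add: proj_zero)
qed

lemma laplace_unique:
  assumes u: "bounded_path u" and v: "bounded_path v"
    and lap: "\<And>n::nat. 1 \<le> n \<Longrightarrow> iint (\<lambda>s. rsc (exp (- real n * s)) (u s)) (y n)"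
      "\<And>n::nat. 1 \<le> n \<Longrightarrow> iint (\<lambda>s. rsc (exp (- real n * s)) (v s)) (y n)"
    and t: "0 \<le> t"
  shows "u t = v t"
proof -
  have "u t - v t = 0"
  proof (rule laplace_unique_0[OF _ _ t])
    show "bounded_path (\<lambda>s. u s - v s)"
      using bounded_path_add[OF u bounded_path_bops[OF bops_uminus v]] by simp
    show "iint (\<lambda>s. rsc (exp (- real n * s)) (u s - v s)) 0" if "1 \<le> n" for n
      using iint_diff[OF lap[OF that]] by (simp add: smul_diff_right)
  qed
  then show ?thesis by simp
qed

lemma laplace_primitive:
  assumes u: "bounded_path u" and v: "decaying_path v"
    and yl: "\<And>n::nat. 1 \<le> n \<Longrightarrow> iint (\<lambda>s. rsc (exp (- real n * s)) (u s)) (y n)"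
    and zl: "\<And>n::nat. 1 \<le> n \<Longrightarrow> iint (\<lambda>s. rsc (exp (- real n * s)) (v s)) (z n)"
    and eq: "\<And>n::nat. 1 \<le> n \<Longrightarrow> rsc (real n) (y n) = z n + c0"
    and t: "0 \<le> t"
  shows "rint v (u t - c0) 0 t"
proof -
  obtain a where a [measurable]: "a \<in> borel_measurable M"
    and a': "\<And>s. 0 \<le> s \<Longrightarrow> AE w in M. nrm (u s) w \<le> a w"
    using u by (auto simp: bounded_path_def)
  obtain b where b [measurable]: "b \<in> borel_measurable M"
    and b': "\<And>s. 0 \<le> s \<Longrightarrow> AE w in M. nrm (v s) w \<le> b w * inverse (1 + s\<^sup>2)"
    using v by (auto simp: decaying_path_def)
  \<comment> \<open>Both paths and the constant \<open>c0\<close> must lie in the same Banach space,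
    so one weight has to dominate all three.\<close>
  let ?c = "\<lambda>w. \<bar>a w\<bar> + \<bar>b w\<bar> + \<bar>nrm c0 w\<bar>"
  define g where "g = (\<lambda>w. inverse (1 + \<bar>?c w\<bar>))"
  interpret weighted_module M smul nrm g
    unfolding g_def by (intro weighted_module_inverse) measurable
  have "AE w in M. g w * nrm (u s) w \<le> 1" if "0 \<le> s" for s
    unfolding g_def using a'[OF that] by eventually_elim (erule inverse_weight_le_1, simp)
  then have uw: "wpath 1 u" using u unfolding wpath_def bounded_path_def by blast
  have vb: "AE w in M. g w * nrm (v s) w \<le> inverse (1 + s\<^sup>2)" if "0 \<le> s" for s
    unfolding g_def using b'[OF that] by eventually_elim (erule inverse_weight_le, simp_all)
  have vw: "wpath 1 v"
  proof -
    have "AE w in M. g w * nrm (v s) w \<le> 1" if "0 \<le> s" for s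
      using vb[OF that] by eventually_elim (rule order_trans[OF _ inverse_one_plus_square_le_1])
    then show ?thesis using v unfolding wpath_def decaying_path_def by blast
  qed
  have "AE w in M. g w * nrm c0 w \<le> 1"
    unfolding g_def by (rule AE_I2) (rule inverse_weight_le_1[OF order_refl], simp)
  then have c0: "c0 \<in> wcar" by (intro wnorm_le(1)[of 1]) auto
  have "emb (u t) = emb c0 + integral {0..t} (\<lambda>s. emb (v s))"
  proof (rule laplace_transform_primitive[OF continuous_on_emb[OF uw] wpath_wcar(2)[OF uw]
        continuous_on_emb[OF vw] _ wpath_laplace_tendsto(1)[OF uw _ yl]
        wpath_laplace_tendsto(1)[OF vw _ zl] _ t])
    show "norm (emb (v s)) \<le> inverse (1 + s\<^sup>2)" if "0 \<le> s" for s
      using wnorm_le(2)[OF _ vb[OF that]] wpath_wcar(1)[OF vw that] by (simp add: norm_emb)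
    show "real n *\<^sub>R emb (y n) = emb (z n) + emb c0" if "1 \<le> n" for n
      using eq[OF that] wpath_laplace_tendsto(2)[OF uw that yl[OF that]]
        wpath_laplace_tendsto(2)[OF vw that zl[OF that]] c0
      by (simp add: emb_rsc[symmetric] emb_add[symmetric])
  qed auto
  then have "proj (integral {0..t} (\<lambda>s. emb (v s))) = proj (emb (u t) - emb c0)"
    by simp
  also have "\<dots> = u t - c0"
    using wpath_wcar(1)[OF uw t] c0 by (simp add: bp_proj_diff proj_emb)
  finally show ?thesis using wpath_riemann_integral(1)[OF vw t] by simp
qed

text \<open>The integral of the shifted path up to \<open>L\<close> is the integral of
  \<open>f\<close> up to \<open>L + h\<close> minus that up to \<open>h\<close>; substitution and
  splitting of the interval take place in the Banach space.\<close>

lemma iint_shift: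
  assumes f: "decaying_path f" and h: "0 \<le> h" and y: "iint f y" and z: "rint f z 0 h"
  shows "iint (\<lambda>s. f (s + h)) (y - z)"
proof -
  obtain g where "weighted_module M smul nrm g" and d: "weighted_module.wdecaying M nrm g f"
    using decaying_path_weight[OF f] by blast
  interpret weighted_module M smul nrm g by fact
  obtain c where w: "wpath c f" using wdecaying_imp_wpath[OF d] by blast
  have sw: "wpath c (\<lambda>s. f (s + h))"
    using w h unfolding wpath_def by (blast intro: el_path_shift add_nonneg_nonneg)
  let ?F = "\<lambda>s. emb (f s)"
  have Fc: "continuous_on {0..} ?F" by (rule continuous_on_emb[OF w])
  have zF: "z = proj (integral {0..h} ?F)"
    by (rule rint_unique[OF z wpath_riemann_integral(1)[OF w h]])
  have shift: "integral {0..L} (\<lambda>s. emb (f (s + h))) = integral {0..L + h} ?F - integral {0..h} ?F"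
    if "0 \<le> L" for L
    using integral_shift_real_ivl[of h h "L + h" ?F] integral_diff_Icc[OF Fc h, of "L + h"] that by simp
  have yl: "tends (\<lambda>L. proj (integral {0..L} ?F)) y at_top"
    using tends_proj[OF wdecaying_iint_tendsto(1)[OF d y]] wdecaying_iint_tendsto(2)[OF d y]
    by (simp add: proj_emb)
  show ?thesis
    unfolding has_improper_integral_def
  proof (intro exI[of _ "\<lambda>L. proj (integral {0..L + h} ?F) + - z"] conjI allI impI)
    fix L :: real assume L: "0 \<le> L"
    show "rint (\<lambda>s. f (s + h)) (proj (integral {0..L + h} ?F) + - z) 0 L"
      using wpath_riemann_integral(1)[OF sw L] by (simp add: shift[OF L] bp_proj_diff zF)
  next
    have "LIM L at_top. L + h :> at_top"
      using filterlim_tendsto_add_at_top[OF tendsto_const filterlim_ident, of h] by (simp add: add.commute)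
    then have "tends (\<lambda>L. proj (integral {0..L + h} ?F)) y at_top"
      by (rule tends_compose[OF yl])
    from tends_add[OF this tends_const, of "- z"]
    show "tends (\<lambda>L. proj (integral {0..L + h} ?F) + - z) (y - z) at_top" by simp
  qed
qed

text \<open>The fundamental theorem of calculus at the left end of the interval, applied to the
  embedded path and projected back.\<close>

lemma rint_average_tends:
  assumes f: "bounded_path f" and I: "\<And>h. 0 \<le> h \<Longrightarrow> rint f (I h) 0 h"
  shows "tends (\<lambda>h. rsc (1 / h) (I h)) (f 0) (at_right 0)"
proof -
  obtain g where "weighted_module M smul nrm g" and w: "weighted_module.wpath M nrm g 1 f"
    using bounded_path_weight[OF f] by blast
  interpret weighted_module M smul nrm g by fact
  let ?F = "\<lambda>s. emb (f s)"
  have "((\<lambda>u. integral {0..u} ?F) has_vector_derivative ?F 0) (at 0 within {0..1})"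
    by (rule integral_has_vector_derivative)
      (auto intro: continuous_on_atLeast_Icc[OF continuous_on_emb[OF w]])
  moreover have "at 0 within {0..1} = at_right (0::real)"
    by (rule at_within_nhd[of _ "{..<1}"]) auto
  ultimately have "((\<lambda>u. (integral {0..u} ?F - u *\<^sub>R ?F 0) /\<^sub>R \<bar>u\<bar>) \<longlongrightarrow> 0) (at_right 0)"
    by (simp add: has_vector_derivative_def has_derivative_at_within)
  moreover have "\<forall>\<^sub>F u in at_right 0. (integral {0..u} ?F - u *\<^sub>R ?F 0) /\<^sub>R \<bar>u\<bar>
      = inverse u *\<^sub>R integral {0..u} ?F - ?F 0"
    using eventually_at_right_less[of 0] by eventually_elim (simp add: scaleR_diff_right)
  ultimately have "((\<lambda>u. inverse u *\<^sub>R integral {0..u} ?F - ?F 0) \<longlongrightarrow> 0) (at_right 0)"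
    by (simp add: tendsto_cong)
  then have "((\<lambda>u. inverse u *\<^sub>R integral {0..u} ?F) \<longlongrightarrow> ?F 0) (at_right 0)"
    by (rule LIM_zero_cancel)
  from tends_proj[OF this]
  have "tends (\<lambda>h. proj (inverse h *\<^sub>R integral {0..h} ?F)) (f 0) (at_right 0)"
    using wpath_wcar(1)[OF w] by (simp add: proj_emb)
  moreover have "\<forall>\<^sub>F h in at_right 0. rsc (1 / h) (I h) = proj (inverse h *\<^sub>R integral {0..h} ?F)"
    using eventually_at_right_less[of 0]
  proof eventually_elim
    case (elim h)
    then have "I h = proj (integral {0..h} ?F)"
      by (intro rint_unique[OF I wpath_riemann_integral(1)[OF w]]) auto
    then show ?case by (simp add: proj_rsc inverse_eq_divide)
  qed
  ultimately show ?thesis by (simp add: tends_cong)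
qed

end

section \<open>The operator norm is attained\<close>

context random_normed_module
begin

text \<open>Countably many bounds share one exceptional null set. The cut-off at 0 keeps the
  pointwise infimum finite at every point of the space, also where some \<open>\<eta> n\<close> is
  negative.\<close>

lemma as_bounds_inf:
  assumes H: "\<And>n::nat. \<eta> n \<in> as_bounds M nrm T"
  shows "(\<lambda>w. INF n. max 0 (\<eta> n w)) \<in> as_bounds M nrm T"
proof -
  have [measurable]: "\<eta> n \<in> borel_measurable M" for n
    using H[of n] by (auto simp: as_bounds_def L0_pos_def)
  have bdd: "bdd_below (range (\<lambda>n. max 0 (\<eta> n w)))" for w by (rule bdd_belowI2[of _ 0]) simp
  have "AE w in M. nrm (T z) w \<le> (INF n. max 0 (\<eta> n w)) * nrm z w" for z
  proof -
    have "AE w in M. \<forall>n. nrm (T z) w \<le> \<eta> n w * nrm z w"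
      using H by (auto simp: AE_all_countable as_bounds_def)
    then show ?thesis
      using nrm_nonneg[of z]
    proof eventually_elim
      case (elim w)
      show ?case
      proof (cases "nrm z w = 0")
        case True
        then show ?thesis using elim(1)[rule_format, of 0] by simp
      next
        case False
        then have pos: "0 < nrm z w" using elim(2) by simp
        have "nrm (T z) w / nrm z w \<le> (INF n. max 0 (\<eta> n w))"
        proof (rule cINF_greatest)
          fix n
          have "nrm (T z) w / nrm z w \<le> \<eta> n w" using elim(1) pos by (simp add: pos_divide_le_eq)
          then show "nrm (T z) w / nrm z w \<le> max 0 (\<eta> n w)" by simp
        qed simp
        then show ?thesis using pos by (simp add: pos_divide_le_eq)
      qed
    qed
  qed
  moreover have "(\<lambda>w. INF n. max 0 (\<eta> n w)) \<in> borel_measurable M"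
    by (rule borel_measurable_cINF) (auto intro: bdd)
  moreover have "0 \<le> (INF n. max 0 (\<eta> n w))" for w by (rule cINF_greatest) auto
  ultimately show ?thesis by (auto simp: as_bounds_def L0_pos_def)
qed

text \<open>
  The bounds of \<open>T\<close> are closed under countable infima, so that one of them minimises the
  expectation of the arctangent; it is almost surely below every other bound.
\<close>

lemma ex_least_as_bound:
  assumes "T \<in> bops"
  shows "\<exists>\<zeta>\<in>as_bounds M nrm T. \<forall>\<eta>\<in>as_bounds M nrm T. AE w in M. \<zeta> w \<le> \<eta> w"
proof -
  let ?H = "as_bounds M nrm T"
  \<comment> \<open>The arctangent is bounded, so every bound has a finite expectation, and strictly
    increasing, so ordered bounds with equal expectations agree almost surely.\<close>
  define \<phi> where "\<phi> = (\<lambda>\<eta> :: 'w \<Rightarrow> real. \<integral>w. arctan (\<eta> w) \<partial>M)"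
  have meas: "\<eta> \<in> borel_measurable M" if "\<eta> \<in> ?H" for \<eta>
    using that by (auto simp: as_bounds_def L0_pos_def)
  have atan [measurable]: "(\<lambda>w. arctan (\<eta> w)) \<in> borel_measurable M" if "\<eta> \<in> borel_measurable M" for \<eta>
    using that by (rule borel_measurable_continuous_on[OF continuous_on_arctan[OF continuous_on_id], simplified])
  have int: "integrable M (\<lambda>w. arctan (\<eta> w))" if "\<eta> \<in> ?H" for \<eta>
  proof (rule integrable_const_bound[where B = "pi / 2"])
    show "AE w in M. norm (arctan (\<eta> w)) \<le> pi / 2"
    proof (rule AE_I2)
      fix w
      show "norm (arctan (\<eta> w)) \<le> pi / 2"
        using arctan_bounded[of "\<eta> w"] unfolding real_norm_def by linarith
    qed
  qed (rule atan[OF meas[OF that]])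
  have ne: "?H \<noteq> {}" using assms by (simp add: bounded_ops_def)
  have bdd: "bdd_below (\<phi> ` ?H)"
  proof (rule bdd_belowI2)
    fix \<eta> assume "\<eta> \<in> ?H"
    then have "AE w in M. 0 \<le> arctan (\<eta> w)"
      by (auto simp: as_bounds_def L0_pos_def)
    then show "0 \<le> \<phi> \<eta>" unfolding \<phi>_def by (rule integral_nonneg_AE)
  qed
  define \<alpha> where "\<alpha> = Inf (\<phi> ` ?H)"
  have "\<exists>\<eta>\<in>?H. \<phi> \<eta> < \<alpha> + inverse (real (Suc n))" for n
  proof -
    have "Inf (\<phi> ` ?H) < \<alpha> + inverse (real (Suc n))" unfolding \<alpha>_def by simp
    then show ?thesis using cInf_less_iff[OF _ bdd] ne by auto
  qed
  then obtain \<eta> where \<eta>: "\<And>n. \<eta> n \<in> ?H" "\<And>n. \<phi> (\<eta> n) < \<alpha> + inverse (real (Suc n))" by metis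
  define \<zeta> where "\<zeta> = (\<lambda>w. INF n. max 0 (\<eta> n w))"
  have \<zeta>: "\<zeta> \<in> ?H" unfolding \<zeta>_def by (rule as_bounds_inf) (rule \<eta>(1))
  have "\<phi> \<zeta> \<le> \<alpha> + inverse (real (Suc n))" for n
  proof -
    have "AE w in M. 0 \<le> \<eta> n w" using \<eta>(1)[of n] by (simp add: as_bounds_def L0_pos_def)
    then have "AE w in M. arctan (\<zeta> w) \<le> arctan (\<eta> n w)"
    proof eventually_elim
      case (elim w)
      have "\<zeta> w \<le> max 0 (\<eta> n w)"
        unfolding \<zeta>_def by (rule cINF_lower) (auto intro: bdd_belowI2[of _ 0])
      then show ?case using elim by (simp add: arctan_le_iff)
    qed
    then have "\<phi> \<zeta> \<le> \<phi> (\<eta> n)" unfolding \<phi>_def by (intro integral_mono_AE int \<zeta> \<eta>(1))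
    then show ?thesis using \<eta>(2)[of n] by simp
  qed
  moreover have "(\<lambda>n. \<alpha> + inverse (real (Suc n))) \<longlonglongrightarrow> \<alpha>"
    using tendsto_add[OF tendsto_const LIMSEQ_inverse_real_of_nat, of \<alpha>] by simp
  ultimately have \<zeta>_le: "\<phi> \<zeta> \<le> \<alpha>" by (intro LIMSEQ_le_const) auto
  have "AE w in M. \<zeta> w \<le> \<eta>' w" if \<eta>': "\<eta>' \<in> ?H" for \<eta>'
  proof -
    \<comment> \<open>The minimum is again a bound, so its expectation cannot fall below the infimum
      attained at \<open>\<zeta>\<close>; lying below \<open>\<zeta>\<close>, it equals
      \<open>\<zeta>\<close> almost surely.\<close>
    let ?\<mu> = "\<lambda>w. min (\<zeta> w) (\<eta>' w)"
    have \<mu>: "?\<mu> \<in> ?H"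
      using \<zeta> \<eta>' by (auto simp: as_bounds_def L0_pos_def min_def elim: eventually_elim2)
    have "\<alpha> \<le> \<phi> ?\<mu>" unfolding \<alpha>_def using \<mu> bdd by (intro cInf_lower) auto
    then have "(\<integral>w. arctan (\<zeta> w) - arctan (?\<mu> w) \<partial>M) \<le> 0"
      using \<zeta>_le int[OF \<zeta>] int[OF \<mu>] by (simp add: \<phi>_def)
    moreover have nonneg: "AE w in M. 0 \<le> arctan (\<zeta> w) - arctan (?\<mu> w)"
      by (rule AE_I2) (simp add: arctan_le_iff)
    ultimately have "(\<integral>w. arctan (\<zeta> w) - arctan (?\<mu> w) \<partial>M) = 0"
      using integral_nonneg_AE[OF nonneg] by linarith
    then have "AE w in M. arctan (\<zeta> w) - arctan (?\<mu> w) = 0"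
      using integral_nonneg_eq_0_iff_AE[OF _ nonneg] int[OF \<zeta>] int[OF \<mu>] by auto
    then show ?thesis by eventually_elim (auto simp: arctan_eq_iff min_def split: if_splits)
  qed
  then show ?thesis using \<zeta> by blast
qed

text \<open>An infimum of a set need not belong to it. Here the least bound \<open>\<zeta>\<close>
  is itself a lower bound of the set, so it lies below whichever infimum the choice operator picks,
  and its estimate carries over.\<close>

lemma op_norm_bound:
  assumes "T \<in> bops"
  shows "AE w in M. nrm (T x) w \<le> op_norm M nrm T w * nrm x w"
proof -
  let ?H = "as_bounds M nrm T"
  obtain \<zeta> where \<zeta>: "\<zeta> \<in> ?H" "\<And>\<eta>. \<eta> \<in> ?H \<Longrightarrow> AE w in M. \<zeta> w \<le> \<eta> w"
    using ex_least_as_bound[OF assms] by blast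
  have meas: "\<zeta> \<in> borel_measurable M" using \<zeta>(1) by (simp add: as_bounds_def L0_pos_def)
  have "is_as_Inf M ?H \<zeta>" using \<zeta> meas by (auto simp: is_as_Inf_def)
  then have "is_as_Inf M ?H (op_norm M nrm T)" unfolding op_norm_def by (rule someI[of "is_as_Inf M ?H"])
  then have le: "AE w in M. \<zeta> w \<le> op_norm M nrm T w" using \<zeta>(2) meas by (auto simp: is_as_Inf_def)
  have "AE w in M. nrm (T x) w \<le> \<zeta> w * nrm x w" using \<zeta>(1) by (auto simp: as_bounds_def)
  then show ?thesis
    using le nrm_nonneg[of x]
  proof eventually_elim
    case (elim w)
    then show ?case using mult_right_mono[OF elim(2,3)] by simp
  qed
qed

section \<open>Difference quotients of random exponentials\<close>

lemma smul_exp_tends_0: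
  assumes q: "tends q l (at_right 0)" and [measurable]: "\<eta> \<in> borel_measurable M"
  shows "tends (\<lambda>h. ssm (\<lambda>w. exp (\<eta> w * h)) (q h)) l (at_right 0)"
  using tends_smul_exp[OF q tendsto_ident_at, of "\<lambda>w. - \<eta> w"] by (simp add: smul_one)

lemma exp_remainder_bound:
  fixes u :: real
  shows "\<bar>exp u - 1 - u\<bar> \<le> u\<^sup>2 * exp \<bar>u\<bar>"
proof -
  have "(1 + - u) * exp u \<le> exp (- u) * exp u"
    by (intro mult_right_mono exp_ge_add_one_self) simp
  then have "exp u - 1 - u \<le> u * (exp u - 1)" by (simp add: exp_minus algebra_simps)
  also have "\<dots> \<le> \<bar>u\<bar> * (\<bar>u\<bar> * exp \<bar>u\<bar>)"
  proof -
    have "\<bar>exp u - exp 0\<bar> \<le> \<bar>u - 0\<bar> * exp (max u 0)" by (rule exp_diff_bound)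
    also have "\<dots> \<le> \<bar>u\<bar> * exp \<bar>u\<bar>" by (intro mult_mono) auto
    finally have "\<bar>u\<bar> * \<bar>exp u - 1\<bar> \<le> \<bar>u\<bar> * (\<bar>u\<bar> * exp \<bar>u\<bar>)" by (intro mult_left_mono) auto
    then show ?thesis by (metis abs_ge_self abs_mult order_trans)
  qed
  also have "\<dots> = u\<^sup>2 * exp \<bar>u\<bar>" by (simp add: power2_eq_square)
  finally show ?thesis using exp_ge_add_one_self[of u] by linarith
qed

lemma smul_exp_diff_quot:
  fixes h :: real
  assumes [measurable]: "\<eta> \<in> borel_measurable M"
  shows "smul (\<lambda>w. of_real ((exp (\<eta> w * h) - 1) / h)) x
    = rsc (1 / h) (ssm (\<lambda>w. exp (\<eta> w * h)) x - x)"
proof -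
  let ?e = "\<lambda>w. of_real (exp (\<eta> w * h)) :: 'k"
  have "smul (\<lambda>w. of_real ((exp (\<eta> w * h) - 1) / h)) x = smul (\<lambda>w. of_real (1 / h) * (?e w - 1)) x"
    by (simp add: field_simps)
  also have "\<dots> = rsc (1 / h) (smul (\<lambda>w. ?e w - 1) x)"
    by (rule smul_smul) auto
  also have "smul (\<lambda>w. ?e w - 1) x = smul ?e x - x"
    by (subst smul_diff_left) (auto simp: smul_one)
  finally show ?thesis .
qed

text \<open>For 0 < h \<le> 1 the second-order remainder divided by \<open>h\<close> is at most
  \<eta>^2 exp |\<eta>| times \<open>h\<close>: a fixed random variable times a number tending to
  0.\<close>

lemma smul_exp_diff_quot_tends:
  assumes [measurable]: "\<eta> \<in> borel_measurable M"
  shows "tends (\<lambda>h. smul (\<lambda>w. of_real ((exp (\<eta> w * h) - 1) / h)) x)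
    (smul (\<lambda>w. of_real (\<eta> w)) x) (at_right 0)"
proof (rule tends_dominated_real[where h = "\<lambda>w. (\<eta> w)\<^sup>2 * exp \<bar>\<eta> w\<bar> * nrm x w" and r = "\<lambda>h. h"])
  have near: "\<forall>\<^sub>F h in at_right 0. 0 < h \<and> h \<le> (1::real)"
    unfolding eventually_at by (intro exI[of _ 1]) (auto simp: dist_real_def)
  show "\<forall>\<^sub>F h in at_right 0. AE w in M.
      nrm (smul (\<lambda>w. of_real ((exp (\<eta> w * h) - 1) / h)) x - smul (\<lambda>w. of_real (\<eta> w)) x) w
        \<le> \<bar>(\<eta> w)\<^sup>2 * exp \<bar>\<eta> w\<bar> * nrm x w\<bar> * \<bar>h\<bar>"
    using near
  proof eventually_elim
    case (elim h)
    let ?d = "\<lambda>w. (exp (\<eta> w * h) - 1) / h - \<eta> w"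
    have "smul (\<lambda>w. of_real ((exp (\<eta> w * h) - 1) / h)) x - smul (\<lambda>w. of_real (\<eta> w)) x
        = smul (\<lambda>w. of_real (?d w)) x"
      by (subst smul_diff_left[symmetric]) auto
    moreover have "AE w in M. nrm (smul (\<lambda>w. of_real (?d w) :: 'k) x) w = \<bar>?d w\<bar> * nrm x w"
      using nrm_smul[of "\<lambda>w. of_real (?d w)" x] by (simp del: of_real_diff of_real_divide)
    ultimately have "AE w in M. nrm (smul (\<lambda>w. of_real ((exp (\<eta> w * h) - 1) / h)) x
        - smul (\<lambda>w. of_real (\<eta> w)) x) w = \<bar>?d w\<bar> * nrm x w" by simp
    then show ?case
      using nrm_nonneg[of x]
    proof eventually_elim
      case (elim w)
      have h: "0 < h" "h \<le> 1" using \<open>0 < h \<and> h \<le> 1\<close> by auto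
      have "?d w = (exp (\<eta> w * h) - 1 - \<eta> w * h) / h" using h by (simp add: field_simps)
      then have "\<bar>?d w\<bar> = \<bar>exp (\<eta> w * h) - 1 - \<eta> w * h\<bar> / h" using h by (simp add: abs_divide)
      also have "\<dots> \<le> ((\<eta> w * h)\<^sup>2 * exp \<bar>\<eta> w * h\<bar>) / h"
        using h by (intro divide_right_mono exp_remainder_bound) auto
      also have "\<dots> \<le> ((\<eta> w * h)\<^sup>2 * exp \<bar>\<eta> w\<bar>) / h"
        using h by (intro divide_right_mono mult_left_mono) (auto simp: abs_mult intro!: mult_left_le)
      also have "\<dots> = (\<eta> w)\<^sup>2 * exp \<bar>\<eta> w\<bar> * h" using h by (simp add: power2_eq_square field_simps)
      finally have "\<bar>?d w\<bar> * nrm x w \<le> ((\<eta> w)\<^sup>2 * exp \<bar>\<eta> w\<bar> * h) * nrm x w"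
        using elim(2) by (rule mult_right_mono)
      then show ?case using elim h by (simp add: mult_ac)
    qed
  qed
  show "((\<lambda>h. h) \<longlongrightarrow> 0) (at_right (0::real))" by (auto intro!: tendsto_eq_intros)
qed auto

text \<open>At time 0 this turns the integrated equation of \<open>lap_pair_rint\<close> into
  \<open>W 0 x = C x\<close>.\<close>

lemma rint_degenerate:
  assumes "rint f y a a"
  shows "y = 0"
proof (rule nrm_zeroD)
  have "AE w in M. nrm y w \<le> nrm (f a) w * integral {a..a} (\<lambda>_. 1 :: real)"
    using assms by (rule rint_bound) auto
  then show "AE w in M. nrm y w = 0"
    using nrm_nonneg[of y] by eventually_elim simp
qed

lemma tends_diff:
  assumes "tends f l F" "tends g l' F"
  shows "tends (\<lambda>n. f n - g n) (l - l') F"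
  using tends_add[OF assms(1) bops_tends[OF bops_uminus assms(2)]] by simp

end

lemma option_eqI:
  assumes "\<And>z. a = Some z \<longleftrightarrow> b = Some z"
  shows "a = b"
proof (cases a)
  case None
  then show ?thesis using assms by (cases b) auto
next
  case (Some z)
  then show ?thesis using assms[of z] by simp
qed

section \<open>Exponentially bounded families and their Laplace transforms\<close>

text \<open>Add 1 \<le> exp (\<delta> s) to 2 / \<delta>^2 times (\<delta> s)^2 / 2 \<le> exp
  (\<delta> s). For \<delta> the gap between \<eta> and \<xi> is inserted pointwise; the constant is
  then a finite random variable, although possibly an unbounded one.\<close>

lemma exp_decay_le:
  fixes \<delta> s :: real
  assumes "0 < \<delta>" "0 \<le> s"
  shows "exp (- \<delta> * s) \<le> (1 + 2 / \<delta>\<^sup>2) * inverse (1 + s\<^sup>2)"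
proof -
  have ds: "0 \<le> \<delta> * s" using assms by simp
  have "(\<delta> * s)\<^sup>2 / 2 \<le> exp (\<delta> * s)" "1 \<le> exp (\<delta> * s)"
    using exp_lower_Taylor_quadratic[OF ds] ds by (linarith, simp)
  then have "1 + (2 / \<delta>\<^sup>2) * ((\<delta> * s)\<^sup>2 / 2) \<le> exp (\<delta> * s) + (2 / \<delta>\<^sup>2) * exp (\<delta> * s)"
    by (intro add_mono mult_left_mono) auto
  also have "(2 / \<delta>\<^sup>2) * ((\<delta> * s)\<^sup>2 / 2) = s\<^sup>2" using assms by (simp add: power_mult_distrib)
  finally have "1 + s\<^sup>2 \<le> (1 + 2 / \<delta>\<^sup>2) * exp (\<delta> * s)" by (simp add: algebra_simps)
  moreover have "0 < 1 + s\<^sup>2" by (simp add: add_pos_nonneg)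
  ultimately show ?thesis by (simp add: exp_minus divide_simps mult.commute)
qed

text \<open>The common ground of both directions, extended below by the semigroup law and by the
  resolvent equation respectively. The bound is stated on vectors; \<open>op_norm_bound\<close>
  derives it from the one on operator norms.\<close>

locale exp_bounded_family = complete_random_normed_module M smul nrm
  for M :: "'w measure"
    and smul :: "('w \<Rightarrow> 'k::{real_normed_field,euclidean_space}) \<Rightarrow> 's::ab_group_add \<Rightarrow> 's"
    and nrm :: "'s \<Rightarrow> 'w \<Rightarrow> real" +
  fixes C :: "'s \<Rightarrow> 's" and W :: "real \<Rightarrow> 's \<Rightarrow> 's" and m \<xi> :: "'w \<Rightarrow> real"
  assumes C_bops: "C \<in> bops" and C_inj: "inj C"
    and W_bops: "0 \<le> s \<Longrightarrow> W s \<in> bops"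
    and W_path: "el_path (\<lambda>s. W s x)"
    and m_measurable [measurable]: "m \<in> borel_measurable M" and m_nonneg: "AE w in M. 0 \<le> m w"
    and \<xi>_measurable [measurable]: "\<xi> \<in> borel_measurable M"
    and W_bound: "0 \<le> s \<Longrightarrow> AE w in M. nrm (W s x) w \<le> m w * exp (\<xi> w * s) * nrm x w"
begin

abbreviation G :: "('w \<Rightarrow> real) set" where "G \<equiv> L0_above M \<xi>"

abbreviation dq_tends :: "'s \<Rightarrow> 's \<Rightarrow> bool" where
  "dq_tends x l \<equiv> tends (diff_quot smul C W x) l (at_right 0)"

definition V :: "('w \<Rightarrow> real) \<Rightarrow> real \<Rightarrow> 's \<Rightarrow> 's" where
  "V \<eta> s x = ssm (\<lambda>w. exp (- \<eta> w * s)) (W s x)"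

lemma G_measurable: "\<eta> \<in> G \<Longrightarrow> \<eta> \<in> borel_measurable M"
  by (simp add: L0_above_def)

lemma G_add: "\<eta> \<in> G \<Longrightarrow> (\<lambda>w. \<eta> w + real n) \<in> G"
  by (auto simp: L0_above_def elim: eventually_mono)

lemma ssm_measurable [measurable]:
  assumes [measurable]: "\<eta> \<in> borel_measurable M"
  shows "(\<lambda>w. of_real (\<eta> w) :: 'k) \<in> borel_measurable M"
  by measurable

lemma ssm_add: "\<eta> \<in> borel_measurable M \<Longrightarrow> ssm (\<lambda>w. \<eta> w + r) x = ssm \<eta> x + rsc r x"
  using smul_add_left[of "\<lambda>w. of_real (\<eta> w)" "\<lambda>w. of_real r" x] by simp

lemma V_bops: "\<eta> \<in> borel_measurable M \<Longrightarrow> 0 \<le> s \<Longrightarrow> V \<eta> s \<in> bops"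
  unfolding V_def[abs_def] by (intro bops_compose[OF bops_smul_op W_bops]) auto

lemma V_zero: "V \<eta> 0 x = W 0 x"
  by (simp add: V_def smul_one)

lemma V_el_path: "\<eta> \<in> borel_measurable M \<Longrightarrow> el_path (\<lambda>s. V \<eta> s x)"
  unfolding V_def by (intro el_path_smul_exp W_path)

lemma V_bound:
  assumes \<eta>: "\<eta> \<in> G" and s: "0 \<le> s"
  shows "AE w in M. nrm (V \<eta> s x) w
    \<le> (m w * (1 + 2 / (\<eta> w - \<xi> w)\<^sup>2) * nrm x w) * inverse (1 + s\<^sup>2)"
proof -
  have "AE w in M. \<xi> w < \<eta> w" using \<eta> by (simp add: L0_above_def)
  then show ?thesis
    using nrm_smul_exp[OF G_measurable[OF \<eta>], of s "W s x"] W_bound[OF s, of x] m_nonneg nrm_nonneg[of x]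
  proof eventually_elim
    case (elim w)
    have "nrm (V \<eta> s x) w \<le> exp (- \<eta> w * s) * (m w * exp (\<xi> w * s) * nrm x w)"
      unfolding V_def elim(2) using elim(3) by (intro mult_left_mono) auto
    also have "\<dots> = (m w * nrm x w) * (exp (- \<eta> w * s) * exp (\<xi> w * s))"
      by (simp only: mult_ac)
    also have "exp (- \<eta> w * s) * exp (\<xi> w * s) = exp (- (\<eta> w - \<xi> w) * s)"
      by (simp add: exp_add[symmetric] algebra_simps)
    also have "(m w * nrm x w) * exp (- (\<eta> w - \<xi> w) * s)
        \<le> (m w * nrm x w) * ((1 + 2 / (\<eta> w - \<xi> w)\<^sup>2) * inverse (1 + s\<^sup>2))"
      using elim s by (intro mult_left_mono exp_decay_le) auto
    finally show ?case by (simp add: mult_ac)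
  qed
qed

lemma V_decaying: "\<eta> \<in> G \<Longrightarrow> decaying_path (\<lambda>s. V \<eta> s x)"
  unfolding decaying_path_def
proof (intro conjI bexI allI impI)
  assume \<eta>: "\<eta> \<in> G"
  note [measurable] = G_measurable[OF \<eta>]
  show "el_path (\<lambda>s. V \<eta> s x)" by (rule V_el_path) simp
  show "AE w in M. nrm (V \<eta> s x) w
      \<le> (m w * (1 + 2 / (\<eta> w - \<xi> w)\<^sup>2) * nrm x w) * inverse (1 + s\<^sup>2)" if "0 \<le> s" for s
    by (rule V_bound[OF \<eta> that])
  show "(\<lambda>w. m w * (1 + 2 / (\<eta> w - \<xi> w)\<^sup>2) * nrm x w) \<in> borel_measurable M" by measurable
qed

lemma V_bounded: "\<eta> \<in> G \<Longrightarrow> bounded_path (\<lambda>s. V \<eta> s x)"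
  by (intro decaying_imp_bounded_path V_decaying)

definition R :: "('w \<Rightarrow> real) \<Rightarrow> 's \<Rightarrow> 's" where
  "R \<eta> x = (THE y. iint (\<lambda>s. V \<eta> s x) y)"

lemma R_iint: "\<eta> \<in> G \<Longrightarrow> iint (\<lambda>s. V \<eta> s x) (R \<eta> x)"
  unfolding R_def
  by (rule theI') (use ex_iint[OF V_decaying] iint_unique in blast)

lemma R_eqI: "\<eta> \<in> G \<Longrightarrow> iint (\<lambda>s. V \<eta> s x) y \<Longrightarrow> R \<eta> x = y"
  by (rule iint_unique[OF R_iint])

lemma R_bops:
  assumes \<eta>: "\<eta> \<in> G"
  shows "R \<eta> \<in> bops"
proof (rule bopsI)
  note [measurable] = G_measurable[OF \<eta>]
  have V: "V \<eta> s \<in> bops" if "0 \<le> s" for s by (rule V_bops) (use that in auto)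
  show "R \<eta> (x + y) = R \<eta> x + R \<eta> y" for x y
  proof (rule R_eqI[OF \<eta>])
    show "iint (\<lambda>s. V \<eta> s (x + y)) (R \<eta> x + R \<eta> y)"
      using iint_add[OF R_iint[OF \<eta>] R_iint[OF \<eta>], of x y]
      by (rule iint_cong[THEN iffD1, rotated]) (simp add: bops_add[OF V])
  qed
  show "R \<eta> (smul (\<lambda>w. c) x) = smul (\<lambda>w. c) (R \<eta> x)" for c x
  proof (rule R_eqI[OF \<eta>])
    show "iint (\<lambda>s. V \<eta> s (smul (\<lambda>w. c) x)) (smul (\<lambda>w. c) (R \<eta> x))"
      using iint_bops[OF bops_smul_op R_iint[OF \<eta>], of "\<lambda>w. c" x]
      by (rule iint_cong[THEN iffD1, rotated]) (simp_all add: bops_const[OF V])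
  qed
  show "(\<lambda>w. m w * (1 + 2 / (\<eta> w - \<xi> w)\<^sup>2) * (pi / 2)) \<in> borel_measurable M" by measurable
  show "AE w in M. nrm (R \<eta> x) w \<le> m w * (1 + 2 / (\<eta> w - \<xi> w)\<^sup>2) * (pi / 2) * nrm x w" for x
    using iint_bound[OF R_iint[OF \<eta>] _ V_bound[OF \<eta>], of x] by (simp add: mult_ac)
qed

lemma rsc_V:
  assumes [measurable]: "\<eta> \<in> borel_measurable M"
  shows "rsc (exp (- real n * s)) (V \<eta> s x) = V (\<lambda>w. \<eta> w + real n) s x"
  unfolding V_def
  by (subst smul_smul[symmetric]) (auto simp: of_real_mult[symmetric] exp_add[symmetric] algebra_simps
      simp del: of_real_mult)

lemma iint_rsc_V:
  assumes "\<eta> \<in> G"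
  shows "iint (\<lambda>s. rsc (exp (- real n * s)) (V \<eta> s x)) (R (\<lambda>w. \<eta> w + real n) x)"
  using R_iint[OF G_add[OF assms]] by (simp only: rsc_V[OF G_measurable[OF assms]])

lemma smul_exp_inverse:
  assumes [measurable]: "\<eta> \<in> borel_measurable M"
  shows "ssm (\<lambda>w. exp (\<eta> w * t)) (ssm (\<lambda>w. exp (- \<eta> w * t)) x) = x"
  by (subst smul_smul[symmetric])
    (auto simp: of_real_mult[symmetric] exp_add[symmetric] smul_one simp del: of_real_mult)

lemma smul_exp_V:
  "\<eta> \<in> borel_measurable M \<Longrightarrow> ssm (\<lambda>w. exp (\<eta> w * t)) (V \<eta> t x) = W t x"
  unfolding V_def by (rule smul_exp_inverse)

lemma smul_exp_cancel:
  assumes "\<eta> \<in> borel_measurable M"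
    and "ssm (\<lambda>w. exp (- \<eta> w * t)) x = ssm (\<lambda>w. exp (- \<eta> w * t)) y"
  shows "x = y"
  using assms(2) smul_exp_inverse[OF assms(1)] by metis

lemma bops_V:
  assumes "T \<in> bops" "\<eta> \<in> borel_measurable M"
  shows "T (V \<eta> s x) = ssm (\<lambda>w. exp (- \<eta> w * s)) (T (W s x))"
  unfolding V_def using assms by (intro bops_smul) auto

lemma bops_ssm: "T \<in> bops \<Longrightarrow> \<eta> \<in> borel_measurable M \<Longrightarrow> T (ssm \<eta> x) = ssm \<eta> (T x)"
  by (intro bops_smul) auto

text \<open>Expresses \<open>A x = z\<close> through \<open>W\<close> alone, since
  \<open>R \<eta>\<close> is formally the inverse of \<eta> - A composed with
  \<open>C\<close>.\<close>

definition lap_pair :: "'s \<Rightarrow> 's \<Rightarrow> bool" where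
  "lap_pair x z \<longleftrightarrow> (\<forall>\<eta>\<in>G. R \<eta> (ssm \<eta> x - z) = C x)"

text \<open>At the parameter \<mu> + n the hypothesis reads n R x = R (z - \<mu> x) + C x, which is
  the premise of \<open>laplace_primitive\<close> for the paths of \<open>x\<close> and
  \<open>z - \<mu> x\<close> with constant \<open>C x\<close>.\<close>

lemma lap_pair_rint:
  assumes xz: "lap_pair x z" and \<mu>: "\<mu> \<in> G" and t: "0 \<le> t"
  shows "rint (\<lambda>s. V \<mu> s (z - ssm \<mu> x)) (V \<mu> t x - C x) 0 t"
proof (rule laplace_primitive[OF V_bounded[OF \<mu>] V_decaying[OF \<mu>] iint_rsc_V[OF \<mu>] iint_rsc_V[OF \<mu>] _ t])
  fix n :: nat
  let ?\<eta> = "\<lambda>w. \<mu> w + real n"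
  note T = R_bops[OF G_add[OF \<mu>], of n]
  have "R ?\<eta> (ssm ?\<eta> x - z) = C x" by (rule bspec[OF xz[unfolded lap_pair_def] G_add[OF \<mu>]])
  then have "R ?\<eta> (ssm \<mu> x) + rsc (real n) (R ?\<eta> x) - R ?\<eta> z = C x"
    by (simp only: ssm_add[OF G_measurable[OF \<mu>]] bops_diff[OF T] bops_add[OF T] bops_const[OF T])
  then show "rsc (real n) (R ?\<eta> x) = R ?\<eta> (z - ssm \<mu> x) + C x"
    by (simp only: bops_diff[OF T], simp add: algebra_simps del: of_real_of_nat_eq)
qed

lemma ex_G: "(\<lambda>w. \<xi> w + 1) \<in> G"
  by (simp add: L0_above_def)

lemma lap_pair_zero:
  assumes "lap_pair x z"
  shows "W 0 x = C x"
  using rint_degenerate[OF lap_pair_rint[OF assms ex_G order_refl]] by (simp add: V_zero)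

text \<open>Write W(h) x - C x = exp (\<mu> h) (V(h) x - C x) + (exp (\<mu> h) - 1) C x. After
  division by \<open>h\<close> the limits are W(0) (z - \<mu> x) and \<mu> C x, and the terms with
  \<mu> cancel because W(0) x = C x.\<close>

lemma lap_pair_diff_quot:
  assumes xz: "lap_pair x z"
  shows "dq_tends x (W 0 z)"
proof -
  define \<mu> where "\<mu> = (\<lambda>w. \<xi> w + 1)"
  have \<mu>: "\<mu> \<in> G" unfolding \<mu>_def by (rule ex_G)
  note [measurable] = G_measurable[OF \<mu>]
  have W0: "W 0 \<in> bops" by (rule W_bops) simp
  have "tends (\<lambda>h. rsc (1 / h) (V \<mu> h x - C x)) (V \<mu> 0 (z - ssm \<mu> x)) (at_right 0)"
    by (rule rint_average_tends[OF V_bounded[OF \<mu>] lap_pair_rint[OF xz \<mu>]])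
  then have "tends (\<lambda>h. ssm (\<lambda>w. exp (\<mu> w * h)) (rsc (1 / h) (V \<mu> h x - C x))
        + smul (\<lambda>w. of_real ((exp (\<mu> w * h) - 1) / h)) (C x))
      (V \<mu> 0 (z - ssm \<mu> x) + ssm \<mu> (C x)) (at_right 0)"
    by (intro tends_add smul_exp_tends_0 smul_exp_diff_quot_tends) auto
  moreover have "V \<mu> 0 (z - ssm \<mu> x) + ssm \<mu> (C x) = W 0 z"
    by (simp add: V_zero bops_diff[OF W0] bops_ssm[OF W0] lap_pair_zero[OF xz])
  moreover have "\<forall>\<^sub>F h in at_right 0. ssm (\<lambda>w. exp (\<mu> w * h)) (rsc (1 / h) (V \<mu> h x - C x))
        + smul (\<lambda>w. of_real ((exp (\<mu> w * h) - 1) / h)) (C x) = diff_quot smul C W x h"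
    using eventually_at_right_less[of 0]
  proof eventually_elim
    case (elim h)
    let ?e = "\<lambda>w. of_real (exp (\<mu> w * h)) :: 'k"
    have 1: "smul (\<lambda>w. of_real ((exp (\<mu> w * h) - 1) / h)) (C x)
        = rsc (1 / h) (smul ?e (C x)) - rsc (1 / h) (C x)"
      by (subst smul_exp_diff_quot) (auto simp: smul_diff_right)
    have "smul ?e (rsc (1 / h) (V \<mu> h x - C x)) = rsc (1 / h) (smul ?e (V \<mu> h x - C x))"
      by (rule smul_commute) auto
    also have "\<dots> = rsc (1 / h) (W h x) - rsc (1 / h) (smul ?e (C x))"
      by (simp add: smul_diff_right smul_exp_V)
    finally show ?case using 1 by (simp add: diff_quot_def smul_diff_right)
  qed
  ultimately show ?thesis by (simp add: tends_cong)
qed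

lemma generator_eq_Some_iff:
  "generator M smul nrm C W x = Some z \<longleftrightarrow> dq_tends x (C z)"
proof -
  let ?L = "\<lambda>l. dq_tends x l"
  have the: "inv C (THE l. ?L l) = u" if u: "?L (C u)" for u
  proof -
    have "(THE l. ?L l) = C u"
    proof (rule the_equality[where P = ?L, OF u])
      show "l = C u" if "?L l" for l by (rule tends_unique[OF that u]) simp
    qed
    then show ?thesis using inv_f_f[OF C_inj] by simp
  qed
  show ?thesis
  proof (cases "\<exists>l\<in>range C. ?L l")
    case True
    then obtain u where u: "?L (C u)" by blast
    have "generator M smul nrm C W x = Some u"
      unfolding generator_def if_P[OF True] the[OF u] ..
    moreover have "?L (C z) \<longleftrightarrow> u = z" using the[OF u] the[of z] u by blast
    ultimately show ?thesis by simp
  next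
    case False
    then have "\<not> ?L (C z)" by blast
    then show ?thesis unfolding generator_def if_not_P[OF False] by simp
  qed
qed

lemma conj_op_eq_Some_iff: "conj_op C A x = Some z \<longleftrightarrow> A (C x) = Some (C z)"
  using C_inj by (auto simp: conj_op_def inj_eq)

lemma bops_diff_quot:
  assumes T: "T \<in> bops" and "0 \<le> h" "T (W h x) = W h (T x)" "T (C x) = C (T x)"
  shows "T (diff_quot smul C W x h) = diff_quot smul C W (T x) h"
  using assms by (simp add: diff_quot_def bops_const[OF T] bops_diff[OF T])

text \<open>Operators commuting with \<open>W\<close> and \<open>C\<close> preserve the difference
  quotient relation; this is applied to \<open>C\<close> and to the transforms
  \<open>R \<eta>\<close>.\<close>

lemma bops_diff_quot_tends:
  assumes T: "T \<in> bops" and "\<And>h. 0 \<le> h \<Longrightarrow> T (W h x) = W h (T x)" "T (C x) = C (T x)"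
    and "dq_tends x l"
  shows "dq_tends (T x) (T l)"
proof -
  have "\<forall>\<^sub>F h in at_right 0. T (diff_quot smul C W x h) = diff_quot smul C W (T x) h"
    using eventually_at_right_less[of 0] by eventually_elim (intro bops_diff_quot assms, auto)
  then show ?thesis using bops_tends[OF T assms(4)] by (simp add: tends_cong)
qed

end

section \<open>The generator determines the Laplace transform\<close>

locale C_semigroup_family = exp_bounded_family +
  assumes W_zero: "W 0 = C"
    and W_add: "0 \<le> s \<Longrightarrow> 0 \<le> t \<Longrightarrow> C (W (s + t) x) = W t (W s x)"
begin

lemma W_C: "0 \<le> s \<Longrightarrow> W s (C x) = C (W s x)"
  using W_add[of 0 s x] by (simp add: W_zero)

lemma W_commute: "0 \<le> s \<Longrightarrow> 0 \<le> t \<Longrightarrow> W t (W s x) = W s (W t x)"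
  using W_add[of s t x] W_add[of t s x] by (simp add: add.commute)

lemma R_W:
  assumes \<eta>: "\<eta> \<in> G" and t: "0 \<le> t"
  shows "R \<eta> (W t x) = W t (R \<eta> x)"
proof (rule R_eqI[OF \<eta>])
  show "iint (\<lambda>s. V \<eta> s (W t x)) (W t (R \<eta> x))"
  proof (rule iint_cong[THEN iffD1, OF _ iint_bops[OF W_bops[OF t] R_iint[OF \<eta>]]])
    show "W t (V \<eta> s x) = V \<eta> s (W t x)" if "0 \<le> s" for s
      using bops_V[OF W_bops[OF t] G_measurable[OF \<eta>]] W_commute[OF that t] by (simp add: V_def)
  qed
qed

lemma R_C: "\<eta> \<in> G \<Longrightarrow> R \<eta> (C x) = C (R \<eta> x)"
  using R_W[of \<eta> 0 x] by (simp add: W_zero)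

text \<open>This places \<open>R \<eta> x\<close> in the domain of the generator. The semigroup law
  makes W(h) R x equal to \<open>C\<close> of exp (\<eta> h) times the integral over [h,
  \<infinity>), that is, of exp (\<eta> h) (R x - Z h). The quotient is then \<open>C\<close> of a
  sum of two known limits, \<eta> R x and - V(0) x.\<close>

lemma diff_quot_R_tends:
  assumes \<eta>: "\<eta> \<in> G"
  shows "dq_tends (R \<eta> x) (C (ssm \<eta> (R \<eta> x) - C x))"
proof -
  note [measurable] = G_measurable[OF \<eta>]
  define Z where "Z = (\<lambda>h. SOME z. rint (\<lambda>s. V \<eta> s x) z 0 h)"
  have Z: "rint (\<lambda>s. V \<eta> s x) (Z h) 0 h" if "0 \<le> h" for h
    unfolding Z_def by (rule someI_ex[OF ex_rint[OF V_bounded[OF \<eta>] that]])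
  have WR: "W h (R \<eta> x) = C (ssm (\<lambda>w. exp (\<eta> w * h)) (R \<eta> x - Z h))"
    if h: "0 \<le> h" for h
  proof (rule iint_unique)
    let ?e = "ssm (\<lambda>w. exp (\<eta> w * h))"
    show "iint (\<lambda>s. W h (V \<eta> s x)) (W h (R \<eta> x))"
      by (rule iint_bops[OF W_bops[OF h] R_iint[OF \<eta>]])
    have "iint (\<lambda>s. C (?e (V \<eta> (s + h) x))) (C (?e (R \<eta> x - Z h)))"
      by (intro iint_bops[OF C_bops] iint_bops[OF bops_smul_op]
          iint_shift[OF V_decaying[OF \<eta>] h R_iint[OF \<eta>] Z[OF h]]) simp
    then show "iint (\<lambda>s. W h (V \<eta> s x)) (C (?e (R \<eta> x - Z h)))"
    proof (rule iint_cong[THEN iffD1, rotated])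
      fix s :: real assume s: "0 \<le> s"
      have "?e (V \<eta> (s + h) x) = ssm (\<lambda>w. exp (- \<eta> w * s)) (W (s + h) x)"
        unfolding V_def
        by (subst smul_smul[symmetric])
          (auto simp: of_real_mult[symmetric] exp_add[symmetric] algebra_simps simp del: of_real_mult)
      then have "C (?e (V \<eta> (s + h) x)) = ssm (\<lambda>w. exp (- \<eta> w * s)) (C (W (s + h) x))"
        by (simp add: bops_smul[OF C_bops])
      then show "C (?e (V \<eta> (s + h) x)) = W h (V \<eta> s x)"
        using W_add[OF s h] bops_V[OF W_bops[OF h]] by simp
    qed
  qed
  have "tends (\<lambda>h. smul (\<lambda>w. of_real ((exp (\<eta> w * h) - 1) / h)) (R \<eta> x)
      - ssm (\<lambda>w. exp (\<eta> w * h)) (rsc (1 / h) (Z h))) (ssm \<eta> (R \<eta> x) - V \<eta> 0 x) (at_right 0)"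
    by (intro tends_diff smul_exp_diff_quot_tends smul_exp_tends_0
        rint_average_tends[OF V_bounded[OF \<eta>] Z]) auto
  from bops_tends[OF C_bops this]
  have "tends (\<lambda>h. C (smul (\<lambda>w. of_real ((exp (\<eta> w * h) - 1) / h)) (R \<eta> x)
      - ssm (\<lambda>w. exp (\<eta> w * h)) (rsc (1 / h) (Z h)))) (C (ssm \<eta> (R \<eta> x) - C x)) (at_right 0)"
    by (simp add: V_zero W_zero)
  moreover have "\<forall>\<^sub>F h in at_right 0. C (smul (\<lambda>w. of_real ((exp (\<eta> w * h) - 1) / h)) (R \<eta> x)
      - ssm (\<lambda>w. exp (\<eta> w * h)) (rsc (1 / h) (Z h))) = diff_quot smul C W (R \<eta> x) h"
    using eventually_at_right_less[of 0]
  proof eventually_elim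
    case (elim h)
    let ?e = "\<lambda>w. of_real (exp (\<eta> w * h)) :: 'b"
    have 1: "smul (\<lambda>w. of_real ((exp (\<eta> w * h) - 1) / h)) (R \<eta> x)
        = rsc (1 / h) (smul ?e (R \<eta> x) - R \<eta> x)"
      by (rule smul_exp_diff_quot) simp
    have 2: "smul ?e (rsc (1 / h) (Z h)) = rsc (1 / h) (smul ?e (Z h))"
      by (rule smul_commute) auto
    have "C (smul (\<lambda>w. of_real ((exp (\<eta> w * h) - 1) / h)) (R \<eta> x) - smul ?e (rsc (1 / h) (Z h)))
        = rsc (1 / h) (C (smul ?e (R \<eta> x - Z h)) - C (R \<eta> x))"
      unfolding 1 2 by (simp add: smul_diff_right bops_diff[OF C_bops] bops_const[OF C_bops])
    then show ?case using elim by (simp add: diff_quot_def WR)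
  qed
  ultimately show ?thesis by (simp add: tends_cong)
qed

text \<open>The difference quotients of \<open>R \<eta> x\<close> have two descriptions of their
  limit: \<open>R \<eta>\<close> applied to that for \<open>x\<close>, and the one from
  \<open>diff_quot_R_tends\<close>. Equate them and cancel \<open>C\<close>.\<close>

lemma R_of_diff_quot_tends:
  assumes xz: "dq_tends x (C z)" and \<eta>: "\<eta> \<in> G"
  shows "R \<eta> (ssm \<eta> x - z) = C x"
proof -
  have "dq_tends (R \<eta> x) (R \<eta> (C z))"
    by (intro bops_diff_quot_tends[OF R_bops[OF \<eta>] _ _ xz] R_W[OF \<eta>] R_C[OF \<eta>])
  then have "R \<eta> (C z) = C (ssm \<eta> (R \<eta> x) - C x)"
    by (rule tends_unique[OF _ diff_quot_R_tends[OF \<eta>]]) simp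
  then have "R \<eta> z = ssm \<eta> (R \<eta> x) - C x"
    using C_inj by (simp add: R_C[OF \<eta>] inj_eq)
  then show ?thesis
    using R_bops[OF \<eta>] G_measurable[OF \<eta>] by (simp add: bops_diff bops_ssm)
qed

lemma generator_resolvent:
  fixes A
  assumes A: "A = generator M smul nrm C W"
  shows "A = conj_op C A"
    and "\<eta> \<in> G \<Longrightarrow> (\<lambda>w. of_real (\<eta> w)) \<in> C_resolvent_set M smul C A"
    and "\<eta> \<in> G \<Longrightarrow> C_resolvent smul C (\<lambda>w. of_real (\<eta> w)) A x = R \<eta> x"
proof -
  have A_iff: "A x = Some z \<longleftrightarrow> dq_tends x (C z)" for x z
    unfolding A by (rule generator_eq_Some_iff)
  show "A = conj_op C A"
  proof
    fix x
    have "A x = Some z \<longleftrightarrow> A (C x) = Some (C z)" for z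
    proof
      assume "A x = Some z"
      then show "A (C x) = Some (C z)"
        unfolding A_iff
        by (rule bops_diff_quot_tends[OF C_bops _ refl, rotated]) (rule W_C[symmetric])
    next
      assume AC: "A (C x) = Some (C z)"
      \<comment> \<open>The harder inclusion of domains. The pair property for \<open>C x\<close>
        and \<open>C z\<close> loses a factor \<open>C\<close> by injectivity;
        \<open>lap_pair_diff_quot\<close> then produces the limit at \<open>x\<close>
        itself.\<close>
      have "lap_pair x z"
        unfolding lap_pair_def
      proof
        fix \<eta> assume \<eta>: "\<eta> \<in> G"
        have "C (R \<eta> (ssm \<eta> x - z)) = R \<eta> (C (ssm \<eta> x - z))" by (simp add: R_C[OF \<eta>])
        also have "\<dots> = R \<eta> (ssm \<eta> (C x) - C z)"
          using C_bops G_measurable[OF \<eta>] by (simp add: bops_diff bops_ssm)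
        also have "\<dots> = C (C x)" using AC unfolding A_iff by (rule R_of_diff_quot_tends) (rule \<eta>)
        finally show "R \<eta> (ssm \<eta> x - z) = C x" using C_inj by (simp add: inj_eq)
      qed
      from lap_pair_diff_quot[OF this] show "A x = Some z" unfolding A_iff by (simp add: W_zero)
    qed
    then show "A x = conj_op C A x"
      by (intro option_eqI) (simp add: conj_op_eq_Some_iff)
  qed
  assume \<eta>: "\<eta> \<in> G"
  let ?S = "shifted_op smul (\<lambda>w. of_real (\<eta> w)) A"
  have inj: "inj_on ?S (dom A)"
  proof (rule inj_onI)
    fix x y assume "x \<in> dom A" "y \<in> dom A" and eq: "?S x = ?S y"
    then obtain a b where ab: "A x = Some a" "A y = Some b" by blast
    have "C x = R \<eta> (?S x)" "C y = R \<eta> (?S y)"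
      using R_of_diff_quot_tends[OF ab(1)[unfolded A_iff] \<eta>]
        R_of_diff_quot_tends[OF ab(2)[unfolded A_iff] \<eta>] ab by (simp_all add: shifted_op_def)
    then have "C x = C y" using eq by simp
    then show "x = y" by (rule injD[OF C_inj])
  qed
  have AR: "A (R \<eta> x) = Some (ssm \<eta> (R \<eta> x) - C x)" for x
    unfolding A_iff by (rule diff_quot_R_tends[OF \<eta>])
  have SR: "?S (R \<eta> x) = C x" for x by (simp add: shifted_op_def AR)
  have "range C \<subseteq> ?S ` dom A"
  proof
    fix y assume "y \<in> range C"
    then obtain x where "y = ?S (R \<eta> x)" by (auto simp: SR)
    moreover have "R \<eta> x \<in> dom A" by (simp add: AR domI)
    ultimately show "y \<in> ?S ` dom A" by blast
  qed
  then show "(\<lambda>w. of_real (\<eta> w)) \<in> C_resolvent_set M smul C A"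
    using inj G_measurable[OF \<eta>] by (simp add: C_resolvent_set_def)
  show "C_resolvent smul C (\<lambda>w. of_real (\<eta> w)) A x = R \<eta> x"
    unfolding C_resolvent_def by (rule inv_into_f_eq[OF inj _ SR]) (simp add: AR domI)
qed

end

section \<open>The Laplace transform determines the semigroup\<close>

text \<open>Statement (b), unpacked: \<open>A_R\<close> is the range condition, with the integral
  \<open>R \<eta> x\<close> in place of the resolvent, and \<open>A_shift_inj\<close> is injectivity
  of \<eta> - A on its domain.\<close>

locale resolvent_family = exp_bounded_family +
  fixes A :: "'c \<rightharpoonup> 'c"
  assumes A_conj: "A (C x) = Some (C z) \<longleftrightarrow> A x = Some z"
    and A_R: "\<eta> \<in> G \<Longrightarrow> A (R \<eta> x) = Some (ssm \<eta> (R \<eta> x) - C x)"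
    and A_shift_inj: "\<eta> \<in> G \<Longrightarrow> A x = Some u \<Longrightarrow> A y = Some v \<Longrightarrow>
      ssm \<eta> x - u = ssm \<eta> y - v \<Longrightarrow> x = y"
begin

text \<open>Both \<open>R \<eta> (ssm \<eta> x - z)\<close> and \<open>C x\<close> lie in the domain
  of \<open>A\<close>, the latter by \<open>A_conj\<close>, and \<eta> - A maps both to C (\<eta> x
  - z).\<close>

lemma lap_pair_A:
  assumes "A x = Some z"
  shows "lap_pair x z"
  unfolding lap_pair_def
proof
  fix \<eta> assume \<eta>: "\<eta> \<in> G"
  have "A (C x) = Some (C z)" using assms by (simp add: A_conj)
  moreover have "ssm \<eta> (R \<eta> (ssm \<eta> x - z)) - (ssm \<eta> (R \<eta> (ssm \<eta> x - z)) - C (ssm \<eta> x - z))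
      = ssm \<eta> (C x) - C z"
    using C_bops G_measurable[OF \<eta>] by (simp add: bops_diff bops_ssm)
  ultimately show "R \<eta> (ssm \<eta> x - z) = C x" by (rule A_shift_inj[OF \<eta> A_R[OF \<eta>]])
qed

lemma R_C:
  assumes \<eta>: "\<eta> \<in> G"
  shows "R \<eta> (C x) = C (R \<eta> x)"
proof (rule A_shift_inj[OF \<eta> A_R[OF \<eta>]])
  show "A (C (R \<eta> x)) = Some (C (ssm \<eta> (R \<eta> x) - C x))" by (simp add: A_conj A_R[OF \<eta>])
  show "ssm \<eta> (R \<eta> (C x)) - (ssm \<eta> (R \<eta> (C x)) - C (C x))
      = ssm \<eta> (C (R \<eta> x)) - C (ssm \<eta> (R \<eta> x) - C x)"
    using C_bops G_measurable[OF \<eta>] by (simp add: bops_diff bops_ssm)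
qed

lemma R_inj:
  assumes \<eta>: "\<eta> \<in> G" and "R \<eta> x = R \<eta> y"
  shows "x = y"
proof -
  have "Some (ssm \<eta> (R \<eta> y) - C x) = Some (ssm \<eta> (R \<eta> y) - C y)"
    using A_R[OF \<eta>, of x] A_R[OF \<eta>, of y] unfolding assms(2) by (rule trans[OF sym])
  then have "C x = C y" by simp
  then show ?thesis by (rule injD[OF C_inj])
qed

lemma W_C:
  assumes t: "0 \<le> t"
  shows "W t (C x) = C (W t x)"
proof -
  let ?\<mu> = "\<lambda>w. \<xi> w + 1"
  have "V ?\<mu> t (C x) = C (V ?\<mu> t x)"
  proof (rule laplace_unique[OF _ _ _ _ t])
    show "bounded_path (\<lambda>s. V ?\<mu> s (C x))" by (rule V_bounded[OF ex_G])
    show "bounded_path (\<lambda>s. C (V ?\<mu> s x))" by (rule bounded_path_bops[OF C_bops V_bounded[OF ex_G]])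
    fix n :: nat
    show "iint (\<lambda>s. rsc (exp (- real n * s)) (V ?\<mu> s (C x))) (R (\<lambda>w. ?\<mu> w + real n) (C x))"
      by (rule iint_rsc_V[OF ex_G])
    show "iint (\<lambda>s. rsc (exp (- real n * s)) (C (V ?\<mu> s x))) (R (\<lambda>w. ?\<mu> w + real n) (C x))"
      using iint_bops[OF C_bops iint_rsc_V[OF ex_G], of n x]
      by (simp only: bops_const[OF C_bops] R_C[OF G_add[OF ex_G]])
  qed
  also have "\<dots> = ssm (\<lambda>w. exp (- ?\<mu> w * t)) (C (W t x))"
    by (rule bops_V[OF C_bops]) simp
  finally show ?thesis
    unfolding V_def by (rule smul_exp_cancel[rotated]) simp
qed

lemma rsc_cancel:
  assumes "rsc r x = rsc r y" "r \<noteq> 0"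
  shows "x = y"
proof -
  have "rsc (inverse r) (rsc r z) = z" for z
    using smul_smul[of "\<lambda>_. of_real (inverse r)" "\<lambda>_. of_real r" z] assms(2)
    by (simp add: of_real_mult[symmetric] smul_one del: of_real_mult of_real_inverse)
  then show ?thesis using assms(1) by metis
qed

text \<open>The resolvent identity: both products, multiplied by the difference \<open>n\<close> of
  the parameters, equal C R_\<mu> x - C R_\<eta> x. Positivity of \<open>n\<close> allows its
  cancellation.\<close>

lemma R_commute:
  assumes \<mu>: "\<mu> \<in> G" and n: "1 \<le> n"
  defines "\<eta> \<equiv> \<lambda>w. \<mu> w + real n"
  shows "R \<eta> (R \<mu> x) = R \<mu> (R \<eta> x)"
proof (rule rsc_cancel)
  have \<eta>: "\<eta> \<in> G" unfolding \<eta>_def by (rule G_add[OF \<mu>])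
  have ssm: "ssm \<eta> y = ssm \<mu> y + rsc (real n) y" for y
    unfolding \<eta>_def by (rule ssm_add[OF G_measurable[OF \<mu>]])
  have "R \<eta> (ssm \<eta> (R \<mu> x) - (ssm \<mu> (R \<mu> x) - C x)) = C (R \<mu> x)"
    using lap_pair_A[OF A_R[OF \<mu>]] \<eta> by (simp add: lap_pair_def)
  then have "R \<eta> (rsc (real n) (R \<mu> x) + C x) = C (R \<mu> x)" by (simp add: ssm algebra_simps)
  then have 1: "rsc (real n) (R \<eta> (R \<mu> x)) = C (R \<mu> x) - C (R \<eta> x)"
    by (simp add: bops_add[OF R_bops[OF \<eta>]] bops_const[OF R_bops[OF \<eta>]] R_C[OF \<eta>]
        eq_diff_eq del: of_real_of_nat_eq)
  have "R \<mu> (ssm \<mu> (R \<eta> x) - (ssm \<eta> (R \<eta> x) - C x)) = C (R \<eta> x)"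
    using lap_pair_A[OF A_R[OF \<eta>]] \<mu> by (simp add: lap_pair_def)
  then have "R \<mu> (C x - rsc (real n) (R \<eta> x)) = C (R \<eta> x)" by (simp add: ssm algebra_simps)
  then have 2: "rsc (real n) (R \<mu> (R \<eta> x)) = C (R \<mu> x) - C (R \<eta> x)"
    by (simp add: bops_diff[OF R_bops[OF \<mu>]] bops_const[OF R_bops[OF \<mu>]] R_C[OF \<mu>]
        algebra_simps del: of_real_of_nat_eq)
  show "rsc (real n) (R \<eta> (R \<mu> x)) = rsc (real n) (R \<mu> (R \<eta> x))" by (simp only: 1 2)
  show "real n \<noteq> 0" using n by simp
qed

text \<open>Both sides, weighted by exp (- \<mu> t), are bounded paths in \<open>t\<close> with
  transforms \<open>R (\<lambda>w. \<mu> w + real n) (R \<mu> x)\<close>; commutation of the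
  transforms lifts to the family by uniqueness.\<close>

lemma R_W:
  assumes \<mu>: "\<mu> \<in> G" and t: "0 \<le> t"
  shows "R \<mu> (W t x) = W t (R \<mu> x)"
proof -
  have "R \<mu> (V \<mu> t x) = V \<mu> t (R \<mu> x)"
  proof (rule laplace_unique[OF _ _ _ _ t])
    show "bounded_path (\<lambda>s. R \<mu> (V \<mu> s x))" by (rule bounded_path_bops[OF R_bops[OF \<mu>] V_bounded[OF \<mu>]])
    show "bounded_path (\<lambda>s. V \<mu> s (R \<mu> x))" by (rule V_bounded[OF \<mu>])
    fix n :: nat assume n: "1 \<le> n"
    show "iint (\<lambda>s. rsc (exp (- real n * s)) (V \<mu> s (R \<mu> x))) (R (\<lambda>w. \<mu> w + real n) (R \<mu> x))"
      by (rule iint_rsc_V[OF \<mu>])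
    show "iint (\<lambda>s. rsc (exp (- real n * s)) (R \<mu> (V \<mu> s x))) (R (\<lambda>w. \<mu> w + real n) (R \<mu> x))"
      using iint_bops[OF R_bops[OF \<mu>] iint_rsc_V[OF \<mu>], of n x]
      by (simp only: bops_const[OF R_bops[OF \<mu>]] R_commute[OF \<mu> n])
  qed
  then show ?thesis
    using bops_V[OF R_bops[OF \<mu>] G_measurable[OF \<mu>]] smul_exp_cancel[OF G_measurable[OF \<mu>]]
    by (metis V_def)
qed

text \<open>\<open>lap_pair_zero\<close> gives the equation on the domain of \<open>A\<close> only,
  in particular at \<open>R \<eta> x\<close>. Commuting \<open>R \<eta>\<close> past
  \<open>W 0\<close> and \<open>C\<close> and using its injectivity extends it to all
  \<open>x\<close>.\<close>

lemma W_zero: "W 0 x = C x"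
proof (rule R_inj[OF ex_G])
  show "R (\<lambda>w. \<xi> w + 1) (W 0 x) = R (\<lambda>w. \<xi> w + 1) (C x)"
    using lap_pair_zero[OF lap_pair_A[OF A_R[OF ex_G]], of x]
    by (simp add: R_W[OF ex_G] R_C[OF ex_G])
qed

text \<open>Apply \<open>lap_pair_rint\<close> to \<open>R \<eta> x\<close> and its image under
  \<open>A\<close>, with \<mu> = \<eta>: the terms with \<eta> cancel and the integrand is - C V(s)
  x. The right-hand side is \<open>C\<close> of the integral over [t, \<infinity>).\<close>

lemma V_R:
  assumes \<eta>: "\<eta> \<in> G" and t: "0 \<le> t" and Z: "rint (\<lambda>s. V \<eta> s x) Z 0 t"
  shows "V \<eta> t (R \<eta> x) = C (R \<eta> x - Z)"
proof -
  have "rint (\<lambda>s. V \<eta> s (ssm \<eta> (R \<eta> x) - C x - ssm \<eta> (R \<eta> x))) (V \<eta> t (R \<eta> x) - C (R \<eta> x)) 0 t"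
    by (rule lap_pair_rint[OF lap_pair_A[OF A_R[OF \<eta>]] \<eta> t])
  moreover have "rint (\<lambda>s. V \<eta> s (ssm \<eta> (R \<eta> x) - C x - ssm \<eta> (R \<eta> x))) (- C Z) 0 t"
  proof (rule rint_cong[THEN iffD1, OF _ rint_bops[OF bops_uminus rint_bops[OF C_bops Z]]])
    fix s assume "s \<in> {0..t}"
    then have s: "0 \<le> s" by simp
    show "- C (V \<eta> s x) = V \<eta> s (ssm \<eta> (R \<eta> x) - C x - ssm \<eta> (R \<eta> x))"
      using bops_V[OF C_bops G_measurable[OF \<eta>]] W_C[OF s]
        bops_minus[OF V_bops[OF G_measurable[OF \<eta>] s]]
      by (simp add: V_def)
  qed
  ultimately have "V \<eta> t (R \<eta> x) - C (R \<eta> x) = - C Z" by (rule rint_unique)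
  then show ?thesis by (simp add: bops_diff[OF C_bops] algebra_simps)
qed

text \<open>Fix \<open>t\<close> and compare transforms in \<open>s\<close>. On the right the
  transform is V(t) applied to \<open>R\<close> at \<mu> + n; on the left it is exp (n t) times
  \<open>C\<close> of the integral over [t, \<infinity>) at that parameter. \<open>V_R\<close>
  equates the two.\<close>

lemma W_add:
  assumes s: "0 \<le> s" and t: "0 \<le> t"
  shows "C (W (s + t) x) = W t (W s x)"
proof -
  define \<mu> where "\<mu> = (\<lambda>w. \<xi> w + 1)"
  have \<mu>: "\<mu> \<in> G" unfolding \<mu>_def by (rule ex_G)
  note \<mu>m [measurable] = G_measurable[OF \<mu>]
  note Vt = V_bops[OF \<mu>m t]
  have "C (V \<mu> (s + t) x) = V \<mu> t (V \<mu> s x)"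
  proof (rule laplace_unique[OF _ _ _ _ s])
    show "bounded_path (\<lambda>s. C (V \<mu> (s + t) x))"
      by (rule bounded_path_bops[OF C_bops bounded_path_shift[OF V_bounded[OF \<mu>] t]])
    show "bounded_path (\<lambda>s. V \<mu> t (V \<mu> s x))"
      by (rule bounded_path_bops[OF Vt V_bounded[OF \<mu>]])
    fix n :: nat
    let ?\<eta> = "\<lambda>w. \<mu> w + real n"
    note \<eta> = G_add[OF \<mu>, of n]
    show "iint (\<lambda>s. rsc (exp (- real n * s)) (V \<mu> t (V \<mu> s x))) (V \<mu> t (R ?\<eta> x))"
      using iint_bops[OF Vt iint_rsc_V[OF \<mu>], of n x] by (simp only: bops_const[OF Vt])
    obtain Z where Z: "rint (\<lambda>s. V ?\<eta> s x) Z 0 t" using ex_rint[OF V_bounded[OF \<eta>] t] by blast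
    \<comment> \<open>Compensates for the shift: exp (- n s) = exp (n t) exp (- n (s + t)).\<close>
    let ?E = "rsc (exp (real n * t))"
    have E: "?E (rsc (exp (- real n * (s + t))) y) = rsc (exp (- real n * s)) y" for s y
      by (subst smul_smul[symmetric])
        (auto simp: of_real_mult[symmetric] exp_add[symmetric] algebra_simps
          simp del: of_real_mult of_real_of_nat_eq)
    have Emeas: "?E \<in> bops" by (rule bops_smul_op) simp
    have "iint (\<lambda>s. C (?E (V ?\<eta> (s + t) x))) (C (?E (R ?\<eta> x - Z)))"
      by (intro iint_bops[OF C_bops] iint_bops[OF Emeas]
          iint_shift[OF V_decaying[OF \<eta>] t R_iint[OF \<eta>] Z])
    then have "iint (\<lambda>s. rsc (exp (- real n * s)) (C (V \<mu> (s + t) x))) (C (?E (R ?\<eta> x - Z)))"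
      by (simp only: rsc_V[OF \<mu>m, symmetric] E bops_const[OF C_bops])
    moreover have "C (?E (R ?\<eta> x - Z)) = V \<mu> t (R ?\<eta> x)"
      using V_R[OF \<eta> t Z] E[of 0 "V \<mu> t (R ?\<eta> x)"]
      by (simp add: bops_const[OF C_bops] rsc_V[OF \<mu>m, symmetric] smul_one)
    ultimately show "iint (\<lambda>s. rsc (exp (- real n * s)) (C (V \<mu> (s + t) x))) (V \<mu> t (R ?\<eta> x))"
      by simp
  qed
  moreover have eq: "V \<mu> t (V \<mu> s x) = ssm (\<lambda>w. exp (- \<mu> w * (s + t))) (W t (W s x))"
    unfolding V_def bops_smul[OF W_bops[OF t] measurable_exp_scale[OF \<mu>m]]
    by (subst smul_smul[symmetric])
      (auto simp: of_real_mult[symmetric] exp_add[symmetric] algebra_simps simp del: of_real_mult)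
  ultimately have "ssm (\<lambda>w. exp (- \<mu> w * (s + t))) (C (W (s + t) x))
      = ssm (\<lambda>w. exp (- \<mu> w * (s + t))) (W t (W s x))"
    unfolding bops_V[OF C_bops \<mu>m] by (rule trans)
  then show ?thesis by (rule smul_exp_cancel[OF \<mu>m])
qed

text \<open>That \<open>A\<close> is contained in the generator is
  \<open>lap_pair_diff_quot\<close>. Conversely, R_\<mu> (\<mu> x - z) = C x shows
  \<open>C x\<close> as a value of the transform, hence in the domain of \<open>A\<close> with image
  \<open>C z\<close>; \<open>A_conj\<close> removes \<open>C\<close>.\<close>

lemma A_generator: "A = generator M smul nrm C W"
proof
  fix x
  have "A x = Some z \<longleftrightarrow> generator M smul nrm C W x = Some z" for z
    unfolding generator_eq_Some_iff
  proof
    assume "A x = Some z"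
    from lap_pair_diff_quot[OF lap_pair_A[OF this]]
    show "dq_tends x (C z)" by (simp add: W_zero)
  next
    assume q: "dq_tends x (C z)"
    define \<mu> where "\<mu> = (\<lambda>w. \<xi> w + 1)"
    have \<mu>: "\<mu> \<in> G" unfolding \<mu>_def by (rule ex_G)
    have "dq_tends (R \<mu> x) (R \<mu> (C z))"
      by (intro bops_diff_quot_tends[OF R_bops[OF \<mu>] _ _ q] R_W[OF \<mu>] R_C[OF \<mu>])
    moreover have "dq_tends (R \<mu> x) (C (ssm \<mu> (R \<mu> x) - C x))"
      using lap_pair_diff_quot[OF lap_pair_A[OF A_R[OF \<mu>]]] by (simp add: W_zero)
    ultimately have "R \<mu> (C z) = C (ssm \<mu> (R \<mu> x) - C x)"
      by (rule tends_unique) simp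
    then have "R \<mu> z = ssm \<mu> (R \<mu> x) - C x" using C_inj by (simp add: R_C[OF \<mu>] inj_eq)
    then have eq: "R \<mu> (ssm \<mu> x - z) = C x"
      using R_bops[OF \<mu>] G_measurable[OF \<mu>] by (simp add: bops_diff bops_ssm)
    have "A (C x) = Some (ssm \<mu> (C x) - C (ssm \<mu> x - z))"
      using A_R[OF \<mu>, of "ssm \<mu> x - z"] by (simp only: eq)
    also have "ssm \<mu> (C x) - C (ssm \<mu> x - z) = C z"
      using C_bops G_measurable[OF \<mu>] by (simp add: bops_diff bops_ssm)
    finally show "A x = Some z" by (simp add: A_conj)
  qed
  then show "A x = generator M smul nrm C W x" by (rule option_eqI)
qed

end

theorem theorem4p1:
  fixes M :: "'w measure"
    and smul :: "('w \<Rightarrow> 'k::{real_normed_field,euclidean_space}) \<Rightarrow> 's::ab_group_add \<Rightarrow> 's"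
    and nrm :: "'s \<Rightarrow> 'w \<Rightarrow> real"
    and C :: "'s \<Rightarrow> 's"
    and A :: "'s \<rightharpoonup> 's"
    and W :: "real \<Rightarrow> 's \<Rightarrow> 's"
    and m \<xi> :: "'w \<Rightarrow> real"
  assumes "random_normed_module M smul nrm"
    and "el_complete M nrm"
    and "C \<in> bounded_ops M smul nrm" and "inj C"
    and "module_hom_on M smul A"
    and "\<forall>s\<ge>0. W s \<in> bounded_ops M smul nrm"
    and "strongly_continuous M nrm W"
    and "m \<in> L0_pos M" and "\<xi> \<in> borel_measurable M"
    and "\<forall>s\<ge>0. AE w in M. op_norm M nrm (W s) w \<le> m w * exp (\<xi> w * s)"
  shows "(C_semigroup M smul nrm C W \<and> A = generator M smul nrm C W) \<longleftrightarrow>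
    (A = conj_op C A \<and>
     (\<forall>\<eta>\<in>L0_above M \<xi>.
        (\<lambda>w. of_real (\<eta> w)) \<in> C_resolvent_set M smul C A \<and>
        (\<forall>x. has_improper_integral M smul nrm
               (\<lambda>s. smul (\<lambda>w. of_real (exp (- \<eta> w * s))) (W s x))
               (C_resolvent smul C (\<lambda>w. of_real (\<eta> w)) A x))))"
proof -
  interpret random_normed_module M smul nrm by (rule assms(1))
  interpret exp_bounded_family M smul nrm C W m \<xi>
  proof unfold_locales
    show "el_path (\<lambda>s. W s x)" for x
      using assms(7) by (intro el_path_continuous_map) (simp add: strongly_continuous_def)
    show "AE w in M. nrm (W s x) w \<le> m w * exp (\<xi> w * s) * nrm x w" if "0 \<le> s" for s x
    proof -
      have "W s \<in> bounded_ops M smul nrm" using assms(6) that by blast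
      from op_norm_bound[OF this, of x] assms(10)[rule_format, OF that] nrm_nonneg[of x]
      show ?thesis by eventually_elim (meson mult_right_mono order_trans)
    qed
  qed (use assms in \<open>auto simp: L0_pos_def\<close>)
  show ?thesis
  proof (rule iffI, goal_cases)
    case a: 1
    interpret C_semigroup_family M smul nrm C W m \<xi>
    proof unfold_locales
      show "W 0 = C" using a by (simp add: C_semigroup_def)
      show "C (W (s + t) x) = W t (W s x)" if "0 \<le> s" "0 \<le> t" for s t x
      proof -
        have "C \<circ> W (s + t) = W t \<circ> W s" using a that by (simp add: C_semigroup_def)
        from fun_cong[OF this, of x] show ?thesis by simp
      qed
    qed
    have gen: "A = generator M smul nrm C W" using a by blast
    show ?case
      using generator_resolvent[OF gen] R_iint unfolding V_def by auto
  next
    case b: 2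
    interpret resolvent_family M smul nrm C W m \<xi> A
    proof unfold_locales
      show "A (C x) = Some (C z) \<longleftrightarrow> A x = Some z" for x z
        using b conj_op_eq_Some_iff[of A x z] by metis
    next
      fix \<eta> assume \<eta>: "\<eta> \<in> L0_above M \<xi>"
      let ?S = "shifted_op smul (\<lambda>w. of_real (\<eta> w)) A"
      have res: "inj_on ?S (dom A)" "range C \<subseteq> ?S ` dom A"
        using b \<eta> by (auto simp: C_resolvent_set_def)
      show "A (R \<eta> x) = Some (ssm \<eta> (R \<eta> x) - C x)" for x
      proof -
        \<comment> \<open>Uniqueness of the improper integral identifies the resolvent in (b) with
          \<open>R \<eta>\<close>.\<close>
        have R: "R \<eta> x = inv_into (dom A) ?S (C x)"
          using b \<eta> by (intro R_eqI) (auto simp: V_def C_resolvent_def)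
        have mem: "C x \<in> ?S ` dom A" using res(2) by blast
        have "R \<eta> x \<in> dom A" unfolding R by (rule inv_into_into[OF mem])
        then obtain z where z: "A (R \<eta> x) = Some z" by blast
        have "?S (R \<eta> x) = C x" unfolding R by (rule f_inv_into_f[OF mem])
        then have "ssm \<eta> (R \<eta> x) - z = C x" unfolding shifted_op_def z option.sel .
        then have "z = ssm \<eta> (R \<eta> x) - C x" by (metis diff_diff_eq2 add_diff_cancel_left' add.commute)
        then show ?thesis using z by (rule subst)
      qed
      show "x = y" if "A x = Some u" "A y = Some v" "ssm \<eta> x - u = ssm \<eta> y - v" for x y u v
      proof (rule inj_onD[OF res(1)])
        show "?S x = ?S y" unfolding shifted_op_def that(1,2) option.sel by (rule that(3))
      qed (use that in blast)+
    qed
    have "C_semigroup M smul nrm C W"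
      unfolding C_semigroup_def
    proof (intro conjI allI impI)
      show "W 0 = C" by (rule ext) (rule W_zero)
      show "C \<circ> W (s + t) = W t \<circ> W s" if "0 \<le> s" "0 \<le> t" for s t
        by (rule ext) (simp add: W_add that)
    qed (use assms(4,7) C_bops W_bops in auto)
    then show ?case using A_generator by blast
  qed
qed

end
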